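(* There is $\beta_0<\infty$ such that for all $\beta\ge\beta_0$ the following holds. Let $U$ be the telescoping potential of $\nu_\beta^+$ and let $$P(U)=\lim_{V\uparrow\mathbb{Z}}\frac1{|V|}\log Z^f_V,\qquad Z^f_V=\sum_{\sigma\in\Omega_V}\exp\Big[-\sum_{A\subset V}U(A,\sigma)\Big],$$ be the pressure. Define $$Z^\omega_V=\sum_{\sigma_V\in\Omega_V}\exp\Big[-\sum_{A\cap V\ne\emptyset}U(A,\sigma_V\omega_{V^c})\Big].$$ Then for all $\alpha>1$ and all $\omega\in\Omega_\alpha$, $$P(U)=\lim_{V\uparrow\mathbb{Z}}\frac1{|V|}\log Z^\omega_V.$$
   Context: Ising model on $\mathbb{Z}^2$ at zero field: for finite $\Lambda\subset\mathbb{Z}^2$, $\mu^+_{\Lambda,\beta}$ is the probability measure on $\{\pm1\}^\Lambda$ with weights proportional to $\exp[\beta\sum_{\langle xy\rangle:\{x,y\}\cap\Lambda\ne\emptyset}(\sigma_x\sigma_y-1)]$ (nearest neighbour pairs, $\sigma_y=+1$ for $y\notin\Lambda$); $\mu_\beta^+=\lim_\Lambda\mu^+_{\Lambda,\beta}$ is the plus phase with random field $X$. $\Omega=\{\pm1\}^{\mathbb{Z}}$, $\Omega_V=\{\pm1\}^V$; $\nu_\beta^+$ is the law on $\Omega$ of $(X((i,0)))_{i\in\mathbb{Z}}$. $\sigma_V\omega_{V^c}$ equals $\sigma$ on $V$ and $\omega$ off $V$; $\sigma^V$ equals $\sigma$ on $V$ and $+1$ off $V$; $+$ is the all-plus configuration.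 $V\uparrow\mathbb{Z}$ denotes the thermodynamic limit over finite volumes $V\subset\mathbb{Z}$. Specification $\Gamma$ (the monotone right-continuous specification with which $\nu_\beta^+$ is consistent): with $\Lambda_n=([-n,n]\cap\mathbb{Z})^2$, for finite $V\subset\mathbb{Z}$, $\sigma\in\Omega_V$, $\omega\in\Omega$, $$\gamma_V(\sigma|\omega)=\lim_{n\to\infty}\mu^+_{\Lambda_n,\beta}\big(X(i,0)=\sigma_i,\ i\in V\,\big|\,X(i,0)=\omega_i,\ i\in[-n,n]\setminus V\big).$$ Telescoping potential $U$: for $i\in\mathbb{Z}$, $U(\{i\},\xi)=\ln\frac{\gamma_{\{i\}}(+|+)}{\gamma_{\{i\}}(\xi^{\{i\}}|+)}$; for $j<i$, with $\gamma=\gamma_{[j,i]}$, $$U([j,i],\xi)=\ln\frac{\gamma(\xi^{]j,i]}|+)\,\gamma(\xi^{[j,i[}|+)}{\gamma(\xi^{]j,i[}|+)\,\gamma(\xi^{[j,i]}|+)},$$ where $[j,i]=\{j,\dots,i\}$, $]j,i]=\{j+1,\dots,i\}$, $[j,i[=\{j,\dots,i-1\}$, $]j,i[=\{j+1,\dots,i-1\}$; $U(A,\cdot)=0$ for all other finite $A$. $U(A,\sigma)$ depends only on $\sigma_A$. The limit defining $P(U)$ exists. For $1\le\alpha<9/8$ and $i\in\mathbb{Z}$ ($\mathbb{N}=\{1,2,\dots\}$): $l_i^{\alpha,+}(\sigma)=\min\{n\in\mathbb{N}:\forall k\ge n,\ \frac1k\sum_{j=0}^{k-1}\sigma_{i+j}\ge\frac89\alpha\}$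 and $l_i^{\alpha,-}(\sigma)=\min\{n\in\mathbb{N}:\forall k\ge n,\ \frac1k\sum_{j=0}^{k-1}\sigma_{i-j}\ge\frac89\alpha\}$ ($=\infty$ if there is no such $n$). $\Omega_\alpha$ is the set of $\omega\in\Omega$ for which there are $\epsilon>0$, $N\in\mathbb{N}$ with $l_i^{\alpha,\pm}(\omega)\le|i|^{1/(3+\epsilon)}$ for all $|i|\ge N$ (both signs). *)

theory Defs
  imports "HOL-Probability.Probability"
begin

section \<open>The planar Ising model with plus boundary condition\<close>

text \<open>
  Spins are the real numbers \<open>-1\<close> and \<open>1\<close>.  A configuration on a proper subset of the index set is
  an extensional function, so that there are exactly \<open>2 ^ card V\<close> configurations on a finite \<open>V\<close>.
\<close>

definition configs :: "'a set \<Rightarrow> ('a \<Rightarrow> real) set" where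
  "configs V = V \<rightarrow>\<^sub>E {-1, 1}"

abbreviation all_plus :: "'a \<Rightarrow> real" where
  "all_plus \<equiv> (\<lambda>_. 1)"

text \<open>\<open>\<sigma>\<close> on \<open>V\<close> and \<open>\<omega>\<close> off \<open>V\<close>; with \<open>\<omega>\<close> all plus this is the configuration \<open>\<sigma>\<^sup>V\<close>.\<close>

abbreviation glue :: "'a set \<Rightarrow> ('a \<Rightarrow> real) \<Rightarrow> ('a \<Rightarrow> real) \<Rightarrow> 'a \<Rightarrow> real" where
  "glue V \<sigma> \<omega> \<equiv> override_on \<omega> \<sigma> V"

abbreviation plus_off :: "'a set \<Rightarrow> ('a \<Rightarrow> real) \<Rightarrow> 'a \<Rightarrow> real" where
  "plus_off V \<sigma> \<equiv> glue V \<sigma> all_plus"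

definition bonds_meeting :: "(int \<times> int) set \<Rightarrow> (int \<times> int) set set" where
  "bonds_meeting \<Lambda> =
     {{x, y} | x y. \<bar>fst x - fst y\<bar> + \<bar>snd x - snd y\<bar> = 1 \<and> {x, y} \<inter> \<Lambda> \<noteq> {}}"

text \<open>A bond \<open>e = {x, y}\<close> has two distinct ends, so the product over \<open>e\<close> is \<open>\<sigma>\<^sub>x \<sigma>\<^sub>y\<close>.\<close>

definition ising_weight :: "real \<Rightarrow> (int \<times> int) set \<Rightarrow> (int \<times> int \<Rightarrow> real) \<Rightarrow> real" where
  "ising_weight \<beta> \<Lambda> \<sigma> = exp (\<beta> * (\<Sum>e\<in>bonds_meeting \<Lambda>. (\<Prod>x\<in>e. plus_off \<Lambda> \<sigma> x) - 1))"

definition ising_plus :: "real \<Rightarrow> (int \<times> int) set \<Rightarrow> (int \<times> int \<Rightarrow> real) measure" where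
  "ising_plus \<beta> \<Lambda> = point_measure (configs \<Lambda>)
     (\<lambda>\<sigma>. ennreal (ising_weight \<beta> \<Lambda> \<sigma> / (\<Sum>\<tau>\<in>configs \<Lambda>. ising_weight \<beta> \<Lambda> \<tau>)))"

definition square :: "nat \<Rightarrow> (int \<times> int) set" where
  "square n = {- int n..int n} \<times> {- int n..int n}"


section \<open>The specification of the layer and its telescoping potential\<close>

text \<open>
  \<open>layer_spec \<beta> V \<sigma> \<omega>\<close> is \<open>\<gamma>\<^sub>V(\<sigma>|\<omega>)\<close>.  It depends on \<open>\<sigma>\<close> only through the spins in \<open>V\<close>, so a
  configuration on the whole line may be passed instead of its restriction to \<open>V\<close>.
\<close>

definition layer_spec :: "real \<Rightarrow> int set \<Rightarrow> (int \<Rightarrow> real) \<Rightarrow> (int \<Rightarrow> real) \<Rightarrow> real" where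
  "layer_spec \<beta> V \<sigma> \<omega> = lim (\<lambda>n.
     \<P>(X in ising_plus \<beta> (square n). (\<forall>i\<in>V. X (i, 0) = \<sigma> i) \<bar>
        (\<forall>i\<in>{- int n..int n} - V. X (i, 0) = \<omega> i)))"

definition telescoping :: "real \<Rightarrow> int set \<Rightarrow> (int \<Rightarrow> real) \<Rightarrow> real" where
  "telescoping \<beta> A \<xi> =
     (if finite A \<and> A \<noteq> {} \<and> A = {Min A..Max A} then
        (let j = Min A; i = Max A; \<gamma> = (\<lambda>\<sigma>. layer_spec \<beta> A \<sigma> all_plus) in
           if j = i then ln (\<gamma> all_plus / \<gamma> (plus_off {i} \<xi>))
           else ln (\<gamma> (plus_off {j<..i} \<xi>) * \<gamma> (plus_off {j..<i} \<xi>)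
                      / (\<gamma> (plus_off {j<..<i} \<xi>) * \<gamma> (plus_off {j..i} \<xi>))))
      else 0)"


section \<open>Partition functions and pressure\<close>

definition free_partition :: "(int set \<Rightarrow> (int \<Rightarrow> real) \<Rightarrow> real) \<Rightarrow> int set \<Rightarrow> real" where
  "free_partition U V = (\<Sum>\<sigma>\<in>configs V. exp (- (\<Sum>A\<in>Pow V. U A \<sigma>)))"

definition finite_meeting :: "int set \<Rightarrow> int set set" where
  "finite_meeting V = {A. finite A \<and> A \<inter> V \<noteq> {}}"

definition bc_partition ::
    "(int set \<Rightarrow> (int \<Rightarrow> real) \<Rightarrow> real) \<Rightarrow> (int \<Rightarrow> real) \<Rightarrow> int set \<Rightarrow> real" where
  "bc_partition U \<omega> V =
     (\<Sum>\<sigma>\<in>configs V. exp (- (\<Sum>\<^sub>\<infinity>A\<in>finite_meeting V. U A (glue V \<sigma> \<omega>))))"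

text \<open>
  The thermodynamic limit is taken along finite intervals \<open>{a..b}\<close> exhausting the line, with both ends
  moving independently.  For a potential supported by intervals, the limit along \<^emph>\<open>all\<close> finite sets
  ordered by inclusion is not meaningful: adding many isolated far away points to a volume changes
  the free energy per site.
\<close>

definition thermodynamic :: "int set filter" where
  "thermodynamic = filtermap (\<lambda>(a, b). {a..b}) (at_bot \<times>\<^sub>F at_top)"

definition pressure :: "(int set \<Rightarrow> (int \<Rightarrow> real) \<Rightarrow> real) \<Rightarrow> real" where
  "pressure U = Lim thermodynamic (\<lambda>V. ln (free_partition U V) / real (card V))"


section \<open>The set of good boundary conditions\<close>

text \<open>
  In the type \<open>enat\<close> the infimum of the empty set is \<open>\<infinity>\<close>.
\<close>

definition right_scale :: "real \<Rightarrow> int \<Rightarrow> (int \<Rightarrow> real) \<Rightarrow> enat" where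
  "right_scale \<alpha> i \<sigma> = Inf (enat `
     {n. 1 \<le> n \<and> (\<forall>k\<ge>n. 8 / 9 * \<alpha> \<le> 1 / real k * (\<Sum>j<k. \<sigma> (i + int j)))})"

definition left_scale :: "real \<Rightarrow> int \<Rightarrow> (int \<Rightarrow> real) \<Rightarrow> enat" where
  "left_scale \<alpha> i \<sigma> = Inf (enat `
     {n. 1 \<le> n \<and> (\<forall>k\<ge>n. 8 / 9 * \<alpha> \<le> 1 / real k * (\<Sum>j<k. \<sigma> (i - int j)))})"

definition good_configs :: "real \<Rightarrow> (int \<Rightarrow> real) set" where
  "good_configs \<alpha> = {\<omega> \<in> configs UNIV. \<exists>\<epsilon>>0. \<exists>N\<ge>1. \<forall>i. int N \<le> \<bar>i\<bar> \<longrightarrow>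
     ereal_of_enat (right_scale \<alpha> i \<omega>) \<le> ereal (real_of_int \<bar>i\<bar> powr (1 / (3 + \<epsilon>))) \<and>
     ereal_of_enat (left_scale \<alpha> i \<omega>) \<le> ereal (real_of_int \<bar>i\<bar> powr (1 / (3 + \<epsilon>)))}"

end

theory Submission
  imports Defs "HOL-Real_Asymp.Real_Asymp"
begin

text \<open>
  Encode a configuration by its finite set \<open>A\<close> of minus sites.  Up to normalisation its weight is
  \<open>exp (- 2 * \<beta> * n)\<close>, where \<open>n\<close> is the number of bonds with exactly one end in \<open>A\<close>.  Summing over the spins
  off the layer and letting the square grow gives a relative weight \<open>g I\<close> of the finite set \<open>I\<close> of
  minus spins on the layer (\<open>layer_weight\<close>), and the specification with plus boundary condition is \<open>g\<close>,
  normalised.  The energies of the subintervals of \<open>{a..b}\<close> then telescope to \<open>- ln (g I)\<close>, where \<open>I\<close> is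
  the set of minus sites in \<open>{a..b}\<close>.  So the free partition function is the sum of \<open>g\<close> over the
  subsets of \<open>{a..b}\<close>.  If both ends of an interval with ends \<open>j < i\<close> are minus and \<open>K\<close> is the set of minus
  sites strictly between them, its energy is minus the logarithm of
  \<open>g (K \<union> {i, j}) * g K / (g (K \<union> {i}) * g (K \<union> {j}))\<close>; all other intervals of more than one site have energy zero.

  Two properties of \<open>g\<close> carry the proof.  First, minus spins attract each other: by the four functions
  theorem \<open>g I * g J \<le> g (I \<union> J) * g (I \<inter> J)\<close>, and the approximations of \<open>g\<close> increase with the volume
  (\<open>ising_sum_correlation\<close>).  This gives the existence and translation invariance of \<open>g\<close>, the
  superadditivity of the free pressure, and hence its convergence.  Second, correlations decay even in
  the presence of some minus spins (\<open>free_weight_pair_le\<close>): the ratio above is at most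
  \<open>1 + C * (1 / 2) ^ (i - j)\<close> if \<open>K\<close> has at most \<open>(i - j) / 9\<close> sites, and the same holds if further spins
  of the layer are left free.  Exploring the minus cluster of one site bounds the covariance of two
  spins by the probability that a minus path joins them.  Replacing the minus spins in \<open>K\<close> by plus
  spins costs a factor \<open>exp (16 * \<beta>)\<close> for each, and in the plus phase a contour around the path pays
  \<open>exp (- 2 * \<beta>)\<close> for each column between the sites.

  A good boundary condition has at most \<open>k / 18\<close> minus spins in a window of \<open>k\<close> sites that starts at a far
  site \<open>i\<close>, once \<open>k ^ 3 \<ge> \<bar>i\<bar>\<close>.  This makes the sum of energies converge, and shows that the partition
  function with boundary condition is the limit of the sums over \<open>J \<subseteq> {a..b}\<close> of
  \<open>g (J \<union> L \<union> R) / (g L * g R)\<close>, where \<open>L\<close> and \<open>R\<close> are the minus sets of the boundary condition in growing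
  windows to the left and to the right of \<open>{a..b}\<close>.  By attraction it is at least the free partition
  function.  For the converse let the windows grow site by site.  A new minus spin at distance \<open>D\<close> from
  an interval of \<open>c\<close> sites increases the expression by a bounded factor at most; and if \<open>D\<^sup>2 > c\<close>, the two
  windows together contain at most \<open>D / 9\<close> minus spins, and by decay of correlations the factor is at
  most \<open>exp (C' * (1 / 2) ^ D)\<close>.  Altogether the logarithms of the two partition functions differ by
  \<open>O (sqrt c)\<close>, which does not affect the pressure.
\<close>

section \<open>Positive association on finite sets\<close>

text \<open>
  The two pure products are bounded by hypothesis, so only the mixed ones need an argument. Both
  are at most \<open>s = c1 * d0\<close>, and their product is at most \<open>s * (c0 *
  d1)\<close>. Expanding \<open>0 \<le> (s - a0 * b1) * (s - a1 * b0)\<close> then bounds their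
  sum by \<open>s + c0 * d1\<close>.
\<close>

lemma four_functions_one_point:
  fixes a0 a1 b0 b1 c0 c1 d0 d1 :: real
  assumes nn: "0 \<le> a0" "0 \<le> a1" "0 \<le> b0" "0 \<le> b1" "0 \<le> c0" "0 \<le> c1" "0 \<le> d0" "0 \<le> d1"
    and le: "a0 * b0 \<le> c0 * d0" "a0 * b1 \<le> c1 * d0" "a1 * b0 \<le> c1 * d0" "a1 * b1 \<le> c1 * d1"
  shows "(a0 + a1) * (b0 + b1) \<le> (c0 + c1) * (d0 + d1)"
proof -
  define s where "s = c1 * d0"
  have cross: "a0 * b1 + a1 * b0 \<le> s + c0 * d1"
  proof (cases "s = 0")
    case True
    then have "a0 * b1 \<le> 0" "a1 * b0 \<le> 0" "0 \<le> c0 * d1"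
      using le(2,3)[folded s_def] nn by simp_all
    then show ?thesis using True by linarith
  next
    case False
    then have s: "s > 0" using nn by (simp add: s_def less_le)
    have "0 \<le> (s - a0 * b1) * (s - a1 * b0)"
      using le by (simp add: s_def)
    then have "s * (a0 * b1 + a1 * b0) \<le> s * s + (a0 * b0) * (a1 * b1)"
      by (simp add: algebra_simps)
    also have "(a0 * b0) * (a1 * b1) \<le> (c0 * d0) * (c1 * d1)"
      using mult_mono[OF le(1,4)] nn by simp
    also have "s * s + (c0 * d0) * (c1 * d1) = s * (s + c0 * d1)"
      by (simp add: s_def algebra_simps)
    finally show ?thesis using s by simp
  qed
  show ?thesis using cross le by (simp add: s_def algebra_simps)
qed

lemma sum_Pow_insert:
  fixes f :: "'a set \<Rightarrow> real"
  assumes "finite F" "x \<notin> F"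
  shows "(\<Sum>A\<in>Pow (insert x F). f A) = (\<Sum>A\<in>Pow F. f A + f (insert x A))"
proof -
  have inj: "inj_on (insert x) (Pow F)"
    using assms(2) by (auto simp: inj_on_def)
  have "(\<Sum>A\<in>Pow (insert x F). f A) = (\<Sum>A\<in>Pow F. f A) + (\<Sum>A\<in>insert x ` Pow F. f A)"
    unfolding Pow_insert using assms by (intro sum.union_disjoint) auto
  then show ?thesis by (simp add: sum.reindex[OF inj] sum.distrib)
qed

text \<open>
  The four functions theorem of Ahlswede and Daykin. Summing each function over the presence or
  absence of one point \<open>x\<close> gives functions that satisfy the same hypothesis on the
  remaining points, by the one-point inequality.
\<close>

lemma four_functions:
  fixes f1 f2 f3 f4 :: "'a set \<Rightarrow> real"
  assumes "finite S"
    and "\<And>A. A \<subseteq> S \<Longrightarrow> 0 \<le> f1 A" "\<And>A. A \<subseteq> S \<Longrightarrow> 0 \<le> f2 A"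
    and "\<And>A. A \<subseteq> S \<Longrightarrow> 0 \<le> f3 A" "\<And>A. A \<subseteq> S \<Longrightarrow> 0 \<le> f4 A"
    and "\<And>A B. A \<subseteq> S \<Longrightarrow> B \<subseteq> S \<Longrightarrow> f1 A * f2 B \<le> f3 (A \<union> B) * f4 (A \<inter> B)"
  shows "(\<Sum>A\<in>Pow S. f1 A) * (\<Sum>A\<in>Pow S. f2 A) \<le> (\<Sum>A\<in>Pow S. f3 A) * (\<Sum>A\<in>Pow S. f4 A)"
  using assms
proof (induction S arbitrary: f1 f2 f3 f4 rule: finite_induct)
  case empty
  from empty(5)[of "{}" "{}"] show ?case by simp
next
  case (insert x F)
  have sub: "A \<subseteq> insert x F" "insert x A \<subseteq> insert x F" if "A \<subseteq> F" for A
    using that by auto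
  have "(\<Sum>A\<in>Pow F. f1 A + f1 (insert x A)) * (\<Sum>A\<in>Pow F. f2 A + f2 (insert x A))
     \<le> (\<Sum>A\<in>Pow F. f3 A + f3 (insert x A)) * (\<Sum>A\<in>Pow F. f4 A + f4 (insert x A))"
  proof (rule insert.IH)
    fix A B assume AB: "A \<subseteq> F" "B \<subseteq> F"
    have x: "x \<notin> A" "x \<notin> B" using AB insert.hyps by auto
    have e1: "A \<union> insert x B = insert x (A \<union> B)" "insert x A \<union> B = insert x (A \<union> B)"
      "insert x A \<union> insert x B = insert x (A \<union> B)" by auto
    have e2: "A \<inter> insert x B = A \<inter> B" "insert x A \<inter> B = A \<inter> B"
      "insert x A \<inter> insert x B = insert x (A \<inter> B)" using x by auto
    have U: "A \<union> B \<subseteq> F" and I: "A \<inter> B \<subseteq> F" using AB by auto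
    show "(f1 A + f1 (insert x A)) * (f2 B + f2 (insert x B))
      \<le> (f3 (A \<union> B) + f3 (insert x (A \<union> B))) * (f4 (A \<inter> B) + f4 (insert x (A \<inter> B)))"
      using insert.prems(5)[OF sub(1)[OF AB(1)] sub(1)[OF AB(2)]]
        insert.prems(5)[OF sub(1)[OF AB(1)] sub(2)[OF AB(2)]]
        insert.prems(5)[OF sub(2)[OF AB(1)] sub(1)[OF AB(2)]]
        insert.prems(5)[OF sub(2)[OF AB(1)] sub(2)[OF AB(2)]]
      unfolding e1 e2
      by (intro four_functions_one_point)
         (use insert.prems(1-4) sub AB U I in auto)
  qed (auto intro!: add_nonneg_nonneg insert.prems(1-4))
  then show ?case by (simp only: sum_Pow_insert[OF insert.hyps(1,2)])
qed

section \<open>Boundaries of sets of minus spins\<close>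

text \<open>
  A bond is coded by its right or upper end together with a flag that is \<open>True\<close> for
  vertical bonds; \<open>prev_site\<close> is the other end. Every nearest neighbour pair has
  exactly one code, so bonds are counted without unordered pairs, and the boundary of a
  symmetric difference is a symmetric difference.
\<close>

definition prev_site :: "(int \<times> int) \<times> bool \<Rightarrow> int \<times> int" where
  "prev_site e = (if snd e then (fst (fst e), snd (fst e) - 1) else (fst (fst e) - 1, snd (fst e)))"

definition boundary :: "(int \<times> int) set \<Rightarrow> ((int \<times> int) \<times> bool) set" where
  "boundary A = {e. (fst e \<in> A) \<noteq> (prev_site e \<in> A)}"

text \<open>
  If \<open>A\<close> is the minus set of a configuration, this is its Ising weight: each bond
  of the boundary contributes \<open>- 2\<close> to the sum of \<open>\<sigma>\<^sub>x
  \<sigma>\<^sub>y - 1\<close>, and each other bond contributes \<open>0\<close>.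
\<close>

definition weight :: "real \<Rightarrow> (int \<times> int) set \<Rightarrow> real" where
  "weight \<beta> A = exp (- 2 * \<beta> * real (card (boundary A)))"

definition star :: "int \<times> int \<Rightarrow> ((int \<times> int) \<times> bool) set" where
  "star z = {e. fst e = z \<or> prev_site e = z}"

lemma star_eq:
  "star z = {(z, True), (z, False), ((fst z, snd z + 1), True), ((fst z + 1, snd z), False)}"
proof (rule set_eqI)
  fix e :: "(int \<times> int) \<times> bool"
  obtain u v b where e: "e = ((u, v), b)" by (metis prod.exhaust)
  obtain x y where z: "z = (x, y)" by (cases z)
  show "(e \<in> star z) = (e \<in> {(z, True), (z, False), ((fst z, snd z + 1), True), ((fst z + 1, snd z), False)})"
    unfolding e z star_def prev_site_def by (cases b) auto
qed

lemma finite_star [simp]: "finite (star z)"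
  by (simp add: star_eq)

lemma card_star_le: "card (star z) \<le> 4"
  unfolding star_eq by (simp add: card_insert_if)

lemma boundary_subset_star: "boundary A \<subseteq> (\<Union>z\<in>A. star z)"
  by (auto simp: boundary_def star_def)

lemma finite_boundary [simp]: "finite A \<Longrightarrow> finite (boundary A)"
  by (rule finite_subset[OF boundary_subset_star]) auto

lemma weight_pos [simp]: "0 < weight \<beta> A" and weight_nonneg [simp]: "0 \<le> weight \<beta> A"
  by (simp_all add: weight_def)

text \<open>
  This holds bond by bond. A bond that joins \<open>A - B\<close> to \<open>B - A\<close> lies
  in both boundaries on the right and in neither on the left; every other bond is counted
  equally often on both sides.
\<close>

lemma card_boundary_modular:
  assumes "finite A" "finite B"
  shows "card (boundary (A \<union> B)) + card (boundary (A \<inter> B))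
           + 2 * card {e. fst e \<in> A - B \<and> prev_site e \<in> B - A \<or> prev_site e \<in> A - B \<and> fst e \<in> B - A}
         = card (boundary A) + card (boundary B)"
proof -
  define D where "D = {e. fst e \<in> A - B \<and> prev_site e \<in> B - A \<or> prev_site e \<in> A - B \<and> fst e \<in> B - A}"
  define E where "E = (\<Union>z\<in>A \<union> B. star z)"
  have fin: "finite E" using assms by (simp add: E_def)
  have card_E: "card S = (\<Sum>e\<in>E. of_bool (e \<in> S))" if "S \<subseteq> E" for S
    using fin that by (simp add: Int_absorb1)
  have sub: "boundary (A \<union> B) \<subseteq> E" "boundary (A \<inter> B) \<subseteq> E" "boundary A \<subseteq> E" "boundary B \<subseteq> E" "D \<subseteq> E"
    by (auto simp: E_def boundary_def star_def D_def)
  have "(\<Sum>e\<in>E. of_bool (e \<in> boundary (A \<union> B)) + of_bool (e \<in> boundary (A \<inter> B)) + 2 * of_bool (e \<in> D))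
      = (\<Sum>e\<in>E. of_bool (e \<in> boundary A) + of_bool (e \<in> boundary B) :: nat)"
    by (rule sum.cong) (auto simp: boundary_def D_def)
  then show ?thesis
    unfolding D_def[symmetric] card_E[OF sub(1)] card_E[OF sub(2)] card_E[OF sub(3)] card_E[OF sub(4)]
      card_E[OF sub(5)] by (simp add: sum.distrib sum_distrib_left)
qed

lemma weight_supermodular:
  assumes "finite A" "finite B" "0 \<le> \<beta>"
  shows "weight \<beta> A * weight \<beta> B \<le> weight \<beta> (A \<union> B) * weight \<beta> (A \<inter> B)"
proof -
  have "card (boundary (A \<union> B)) + card (boundary (A \<inter> B)) \<le> card (boundary A) + card (boundary B)"
    using card_boundary_modular[OF assms(1,2)] by linarith
  then have "\<beta> * real (card (boundary (A \<union> B)) + card (boundary (A \<inter> B)))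
          \<le> \<beta> * real (card (boundary A) + card (boundary B))"
    using assms(3) by (intro mult_left_mono of_nat_mono) auto
  then show ?thesis
    by (simp add: weight_def exp_add[symmetric] algebra_simps)
qed

text \<open>
  The case of equality is what allows a cluster to be factored out of a configuration once its
  neighbours are known to be plus.
\<close>

lemma weight_modular:
  assumes "finite A" "finite B"
    and "\<And>e. \<not> (fst e \<in> A - B \<and> prev_site e \<in> B - A)" "\<And>e. \<not> (prev_site e \<in> A - B \<and> fst e \<in> B - A)"
  shows "weight \<beta> A * weight \<beta> B = weight \<beta> (A \<union> B) * weight \<beta> (A \<inter> B)"
proof -
  have "{e. fst e \<in> A - B \<and> prev_site e \<in> B - A \<or> prev_site e \<in> A - B \<and> fst e \<in> B - A} = {}"
    using assms(3,4) by blast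
  then have "card (boundary (A \<union> B)) + card (boundary (A \<inter> B)) = card (boundary A) + card (boundary B)"
    using card_boundary_modular[OF assms(1,2)] by (simp only: card.empty mult_0_right add_0_right)
  then have "real (card (boundary (A \<union> B))) + real (card (boundary (A \<inter> B)))
      = real (card (boundary A)) + real (card (boundary B))" by linarith
  then have "-2 * \<beta> * (real (card (boundary (A \<union> B))) + real (card (boundary (A \<inter> B))))
      = -2 * \<beta> * (real (card (boundary A)) + real (card (boundary B)))" by (rule arg_cong)
  then show ?thesis unfolding weight_def exp_add[symmetric] distrib_left
    by (simp only:)
qed

text \<open>
  Changing one spin affects four bonds, each by a factor of at most \<open>exp (2 *
  \<beta>)\<close>.
\<close>

lemma weight_insert_bounds:
  assumes "finite A" "0 \<le> \<beta>"
  shows "weight \<beta> (insert z A) \<le> exp (8 * \<beta>) * weight \<beta> A"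
    and "weight \<beta> A \<le> exp (8 * \<beta>) * weight \<beta> (insert z A)"
proof -
  have four: "card S \<le> card T + 4" if "S \<subseteq> T \<union> star z" "finite T" for S T
  proof -
    have "card S \<le> card (T \<union> star z)" using that by (intro card_mono) auto
    also have "\<dots> \<le> card T + card (star z)" by (rule card_Un_le)
    finally show ?thesis using card_star_le[of z] by linarith
  qed
  have sub: "boundary (insert z A) \<subseteq> boundary A \<union> star z"
    "boundary A \<subseteq> boundary (insert z A) \<union> star z"
    by (auto simp: boundary_def star_def)
  from four[of "boundary (insert z A)" "boundary A"] four[of "boundary A" "boundary (insert z A)"]
  have c: "card (boundary (insert z A)) \<le> card (boundary A) + 4"
    "card (boundary A) \<le> card (boundary (insert z A)) + 4"
    using assms sub by simp_all
  from c have "real (card (boundary (insert z A))) \<le> real (card (boundary A)) + 4"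
    "real (card (boundary A)) \<le> real (card (boundary (insert z A))) + 4" by linarith+
  from this[THEN mult_left_mono, OF assms(2)]
  show "weight \<beta> (insert z A) \<le> exp (8 * \<beta>) * weight \<beta> A"
    and "weight \<beta> A \<le> exp (8 * \<beta>) * weight \<beta> (insert z A)"
    by (simp_all add: weight_def exp_add[symmetric] algebra_simps)
qed

lemma weight_Un_bounds:
  assumes "finite A" "finite B" "0 \<le> \<beta>"
  shows "weight \<beta> (A \<union> B) \<le> exp (8 * \<beta> * real (card B)) * weight \<beta> A \<and>
         weight \<beta> A \<le> exp (8 * \<beta> * real (card B)) * weight \<beta> (A \<union> B)"
  using assms(2)
proof (induction B rule: finite_induct)
  case (insert z B)
  have e: "exp (8 * \<beta> * real (card (insert z B))) = exp (8 * \<beta>) * exp (8 * \<beta> * real (card B))"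
    using insert by (simp add: exp_add[symmetric] algebra_simps)
  have f: "finite (A \<union> B)" using insert assms by simp
  have "weight \<beta> (insert z (A \<union> B)) \<le> exp (8 * \<beta>) * weight \<beta> (A \<union> B)"
    by (rule weight_insert_bounds[OF f assms(3)])
  also have "\<dots> \<le> exp (8 * \<beta>) * (exp (8 * \<beta> * real (card B)) * weight \<beta> A)"
    using insert by (intro mult_left_mono) auto
  finally have 1: "weight \<beta> (insert z (A \<union> B)) \<le> exp (8 * \<beta>) * (exp (8 * \<beta> * real (card B)) * weight \<beta> A)" .
  have "weight \<beta> A \<le> exp (8 * \<beta> * real (card B)) * weight \<beta> (A \<union> B)" using insert by simp
  also have "\<dots> \<le> exp (8 * \<beta> * real (card B)) * (exp (8 * \<beta>) * weight \<beta> (insert z (A \<union> B)))"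
    by (intro mult_left_mono weight_insert_bounds[OF f assms(3)]) auto
  finally have 2: "weight \<beta> A \<le> exp (8 * \<beta> * real (card B)) * (exp (8 * \<beta>) * weight \<beta> (insert z (A \<union> B)))" .
  show ?case
    using 1 2 unfolding e Un_insert_right
    by (simp only: ac_simps simp_thms)
qed simp

section \<open>Ising sums with prescribed minus spins\<close>

text \<open>
  The sum over all configurations in the region \<open>\<Lambda>\<close>; the spins off
  \<open>\<Lambda>\<close> are minus exactly on \<open>B\<close>.
\<close>

definition ising_sum :: "real \<Rightarrow> (int \<times> int) set \<Rightarrow> (int \<times> int) set \<Rightarrow> real" where
  "ising_sum \<beta> \<Lambda> B = (\<Sum>A\<in>Pow \<Lambda>. weight \<beta> (A \<union> B))"

lemma ising_sum_pos: "finite \<Lambda> \<Longrightarrow> 0 < ising_sum \<beta> \<Lambda> B"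
  unfolding ising_sum_def by (rule sum_pos) auto

lemma ising_sum_insert_region:
  assumes "finite \<Lambda>" "z \<notin> \<Lambda>"
  shows "ising_sum \<beta> (insert z \<Lambda>) B = ising_sum \<beta> \<Lambda> B + ising_sum \<beta> \<Lambda> (insert z B)"
  unfolding ising_sum_def sum_Pow_insert[OF assms] by (simp add: sum.distrib)

lemma ising_sum_Un_bounds:
  assumes "finite \<Lambda>" "finite B" "finite K" "0 \<le> \<beta>"
  shows "ising_sum \<beta> \<Lambda> (B \<union> K) \<le> exp (8 * \<beta> * real (card K)) * ising_sum \<beta> \<Lambda> B"
    and "ising_sum \<beta> \<Lambda> B \<le> exp (8 * \<beta> * real (card K)) * ising_sum \<beta> \<Lambda> (B \<union> K)"
proof -
  have "finite (A \<union> B)" if "A \<subseteq> \<Lambda>" for A using that assms finite_subset by auto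
  from weight_Un_bounds[OF this assms(3,4)]
  show "ising_sum \<beta> \<Lambda> (B \<union> K) \<le> exp (8 * \<beta> * real (card K)) * ising_sum \<beta> \<Lambda> B"
    and "ising_sum \<beta> \<Lambda> B \<le> exp (8 * \<beta> * real (card K)) * ising_sum \<beta> \<Lambda> (B \<union> K)"
    unfolding ising_sum_def sum_distrib_left by (auto intro!: sum_mono simp: Un_assoc)
qed

lemma sum_over_event:
  fixes f :: "'a set \<Rightarrow> real"
  assumes "finite T" "S \<subseteq> T"
  shows "(\<Sum>A | A \<subseteq> S \<and> U A. f A) = (\<Sum>A\<in>Pow T. of_bool (A \<subseteq> S \<and> U A) * f A)"
proof -
  have "(\<Sum>A | A \<subseteq> S \<and> U A. f A) = (\<Sum>A\<in>{A \<in> Pow T. A \<subseteq> S \<and> U A}. f A)"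
    by (rule sum.cong) (use assms in auto)
  also have "\<dots> = (\<Sum>A\<in>Pow T. if A \<subseteq> S \<and> U A then f A else 0)"
    by (rule sum.inter_filter) (use assms in simp)
  also have "\<dots> = (\<Sum>A\<in>Pow T. of_bool (A \<subseteq> S \<and> U A) * f A)"
    by (rule sum.cong) auto
  finally show ?thesis .
qed

text \<open>
  Minus spins attract each other. The increasing event \<open>U\<close>, a larger region and
  more prescribed minus spins all favour each other, so they may be collected in one factor on
  the right. The two regions compare volumes, the two sets \<open>B\<close> and \<open>C\<close>
  compare boundary conditions, and \<open>U\<close> gives positive correlation of events in a
  fixed volume.
\<close>

lemma ising_sum_correlation:
  assumes "finite T" "S \<subseteq> T" "finite B" "finite C" "T \<inter> (B \<union> C) = {}" "0 \<le> \<beta>"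
    and up: "\<And>A A'. U A \<Longrightarrow> A \<subseteq> A' \<Longrightarrow> U A'"
  shows "(\<Sum>A | A \<subseteq> S \<and> U A. weight \<beta> (A \<union> B)) * ising_sum \<beta> T C
       \<le> (\<Sum>A | A \<subseteq> T \<and> U A. weight \<beta> (A \<union> (B \<union> C))) * ising_sum \<beta> S (B \<inter> C)"
proof -
  let ?f1 = "\<lambda>A. of_bool (A \<subseteq> S \<and> U A) * weight \<beta> (A \<union> B)"
  let ?f2 = "\<lambda>A. weight \<beta> (A \<union> C)"
  let ?f3 = "\<lambda>A. of_bool (A \<subseteq> T \<and> U A) * weight \<beta> (A \<union> (B \<union> C))"
  let ?f4 = "\<lambda>A. of_bool (A \<subseteq> S \<and> True) * weight \<beta> (A \<union> (B \<inter> C))"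
  have "(\<Sum>A\<in>Pow T. ?f1 A) * (\<Sum>A\<in>Pow T. ?f2 A) \<le> (\<Sum>A\<in>Pow T. ?f3 A) * (\<Sum>A\<in>Pow T. ?f4 A)"
  proof (rule four_functions[OF assms(1)])
    fix A A' assume A: "A \<subseteq> T" "A' \<subseteq> T"
    show "?f1 A * ?f2 A' \<le> ?f3 (A \<union> A') * ?f4 (A \<inter> A')"
    proof (cases "A \<subseteq> S \<and> U A")
      case True
      have e: "(A \<union> B) \<union> (A' \<union> C) = (A \<union> A') \<union> (B \<union> C)"
        "(A \<union> B) \<inter> (A' \<union> C) = (A \<inter> A') \<union> (B \<inter> C)"
        using A assms(5) by auto
      have U: "A \<union> A' \<subseteq> T \<and> U (A \<union> A')" and I: "A \<inter> A' \<subseteq> S \<and> True"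
        using True A up[of A "A \<union> A'"] by auto
      have "weight \<beta> (A \<union> B) * weight \<beta> (A' \<union> C)
          \<le> weight \<beta> ((A \<union> A') \<union> (B \<union> C)) * weight \<beta> ((A \<inter> A') \<union> (B \<inter> C))"
        unfolding e[symmetric]
        by (rule weight_supermodular) (use A assms finite_subset in auto)
      then show ?thesis using True U I by simp
    next
      case False
      then have "?f1 A = 0" by simp
      then show ?thesis by simp
    qed
  qed auto
  moreover have "ising_sum \<beta> S (B \<inter> C) = (\<Sum>A | A \<subseteq> S \<and> True. weight \<beta> (A \<union> (B \<inter> C)))"
    unfolding ising_sum_def by (rule sum.cong) auto
  ultimately show ?thesis
    unfolding sum_over_event[OF assms(1,2)] sum_over_event[OF assms(1) order_refl]
    by (simp only: ising_sum_def)
qed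

lemma ising_sum_correlation_plain:
  assumes "finite T" "S \<subseteq> T" "finite B" "finite C" "T \<inter> (B \<union> C) = {}" "0 \<le> \<beta>"
  shows "ising_sum \<beta> S B * ising_sum \<beta> T C \<le> ising_sum \<beta> T (B \<union> C) * ising_sum \<beta> S (B \<inter> C)"
proof -
  have "{A. A \<subseteq> X \<and> True} = Pow X" for X :: "(int \<times> int) set" by auto
  then show ?thesis using ising_sum_correlation[OF assms, of "\<lambda>_. True"] by (simp add: ising_sum_def)
qed

section \<open>Covariances and minus paths\<close>

definition nbr :: "int \<times> int \<Rightarrow> int \<times> int \<Rightarrow> bool" where
  "nbr x y \<longleftrightarrow> (\<exists>e. fst e = x \<and> prev_site e = y \<or> prev_site e = x \<and> fst e = y)"

definition linked :: "(int \<times> int) set \<Rightarrow> int \<times> int \<Rightarrow> int \<times> int \<Rightarrow> bool" where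
  "linked A = (\<lambda>x y. nbr x y \<and> x \<in> A \<and> y \<in> A)\<^sup>*\<^sup>*"

lemma linked_mono: "linked A p q \<Longrightarrow> A \<subseteq> A' \<Longrightarrow> linked A' p q"
  unfolding linked_def by (erule mono_rtranclp[rule_format, rotated]) auto

lemma linked_in: "linked A p z \<Longrightarrow> p \<in> A \<Longrightarrow> z \<in> A"
  unfolding linked_def by (induction rule: rtranclp_induct) auto

lemma linked_step: "linked A p y \<Longrightarrow> nbr y z \<Longrightarrow> y \<in> A \<Longrightarrow> z \<in> A \<Longrightarrow> linked A p z"
  unfolding linked_def by (erule rtranclp.rtrancl_into_rtrancl) auto

lemma linked_within_cluster: "linked A p z \<Longrightarrow> p \<in> A \<Longrightarrow> linked {y. linked A p y} p z"
  unfolding linked_def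
proof (induction rule: rtranclp_induct)
  case (step y z)
  then show ?case
    by (intro rtranclp.rtrancl_into_rtrancl[OF step.IH]) (auto intro: rtranclp.rtrancl_into_rtrancl)
qed auto

text \<open>
  Explore the minus cluster \<open>C\<close> of \<open>p\<close>. All its other neighbours in
  \<open>S\<close> are plus, so given \<open>C\<close> the rest of the configuration lives in
  the smaller region \<open>\<Theta>\<close> and is surrounded by plus spins along
  \<open>C\<close>. By \<open>ising_sum_correlation\<close> the site \<open>q\<close> is then
  minus with at most its unconditional probability. Summing over the clusters that avoid
  \<open>q\<close> gives the claim.
\<close>

lemma separated_minus_correlation:
  assumes S: "finite S" and K: "finite K" "S \<inter> K = {}" and \<beta>: "0 \<le> \<beta>"
  shows "(\<Sum>A | A \<subseteq> S \<and> p \<in> A \<and> q \<in> A \<and> \<not> linked A p q. weight \<beta> (A \<union> K))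
      * ising_sum \<beta> S K
      \<le> (\<Sum>A | A \<subseteq> S \<and> p \<in> A. weight \<beta> (A \<union> K)) * (\<Sum>A | A \<subseteq> S \<and> q \<in> A. weight \<beta> (A \<union> K))"
proof -
  define cl where "cl A = {z. linked A p z}" for A
  define X where "X = {A. A \<subseteq> S \<and> p \<in> A \<and> q \<in> A \<and> \<not> linked A p q}"
  define Y where "Y = {A. A \<subseteq> S \<and> p \<in> A}"
  define Q where "Q = (\<Sum>A | A \<subseteq> S \<and> q \<in> A. weight \<beta> (A \<union> K))"
  let ?w = "\<lambda>A. weight \<beta> (A \<union> K)"
  have fin: "finite X" "finite Y" "finite (Pow S)" using S by (auto simp: X_def Y_def)
  have clS: "cl ` X \<subseteq> Pow S" "cl ` Y \<subseteq> Pow S"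
    by (auto simp: X_def Y_def cl_def dest: linked_in)
  have main: "sum ?w {A \<in> X. cl A = C} * ising_sum \<beta> S K \<le> sum ?w {A \<in> Y. cl A = C} * Q" for C
  proof (cases "{A \<in> X. cl A = C} = {}")
    case True
    then have "sum ?w {A \<in> X. cl A = C} = 0" by (simp only: sum.empty)
    then show ?thesis by (auto intro!: mult_nonneg_nonneg sum_nonneg simp: Q_def)
  next
    case False
    then obtain A0 where A0: "A0 \<in> X" "cl A0 = C" by auto
    have pC: "p \<in> C" by (simp add: A0(2)[symmetric] cl_def linked_def)
    have qC: "q \<notin> C" using A0 by (auto simp: X_def cl_def)
    have CS: "C \<subseteq> S" using A0(1) by (auto simp: X_def A0(2)[symmetric] cl_def dest: linked_in)
    have C_self: "linked C p z" if "z \<in> C" for z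
    proof -
      have "linked A0 p z" "p \<in> A0" using that A0 by (auto simp: cl_def X_def)
      then show ?thesis using linked_within_cluster[of A0 p z] A0(2) by (simp add: cl_def)
    qed
    define \<Theta> where "\<Theta> = {z \<in> S - C. \<forall>c\<in>C. \<not> nbr c z}"
    have \<Theta>S: "\<Theta> \<subseteq> S" and \<Theta>C: "\<Theta> \<inter> C = {}" by (auto simp: \<Theta>_def)
    have Yeq: "{A \<in> Y. cl A = C} = (\<union>) C ` Pow \<Theta>"
    proof (intro set_eqI iffI)
      fix A assume "A \<in> {A \<in> Y. cl A = C}"
      then have A: "A \<subseteq> S" "p \<in> A" and clA: "cl A = C" by (auto simp: Y_def)
      have CA: "C \<subseteq> A" using A by (auto simp: clA[symmetric] cl_def dest: linked_in)
      have "A - C \<subseteq> \<Theta>"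
      proof
        fix z assume z: "z \<in> A - C"
        have "\<not> nbr c z" if "c \<in> C" for c
          using that z clA CA linked_step[of A p c z] by (auto simp: cl_def)
        then show "z \<in> \<Theta>" using z A by (auto simp: \<Theta>_def)
      qed
      moreover have "A = C \<union> (A - C)" using CA by auto
      ultimately show "A \<in> (\<union>) C ` Pow \<Theta>" by blast
    next
      fix A assume "A \<in> (\<union>) C ` Pow \<Theta>"
      then obtain A' where A': "A' \<subseteq> \<Theta>" and A: "A = C \<union> A'" by auto
      have "z \<in> C" if "linked A p z" for z
        using that unfolding linked_def
      proof (induction rule: rtranclp_induct)
        case (step y z)
        then show ?case using A A' by (auto simp: \<Theta>_def)
      qed (rule pC)
      moreover have "linked A p z" if "z \<in> C" for z
        using linked_mono[OF C_self[OF that]] A by auto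
      ultimately have "cl A = C" by (auto simp: cl_def)
      then show "A \<in> {A \<in> Y. cl A = C}" using A A' CS \<Theta>S pC by (auto simp: Y_def)
    qed
    have "{A \<in> X. cl A = C} = {A \<in> {A \<in> Y. cl A = C}. q \<in> A}"
      using qC by (auto simp: X_def Y_def cl_def)
    also have "\<dots> = (\<union>) C ` {A'. A' \<subseteq> \<Theta> \<and> q \<in> A'}"
      unfolding Yeq using qC by auto
    finally have Xeq: "{A \<in> X. cl A = C} = (\<union>) C ` {A'. A' \<subseteq> \<Theta> \<and> q \<in> A'}" .
    have inj: "inj_on ((\<union>) C) (Pow \<Theta>)" using \<Theta>C by (auto simp: inj_on_def)
    have inj': "inj_on ((\<union>) C) {A'. A' \<subseteq> \<Theta> \<and> q \<in> A'}" by (rule inj_on_subset[OF inj]) auto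
    define \<kappa> where "\<kappa> = weight \<beta> (C \<union> K) / weight \<beta> K"
    have factor: "?w (C \<union> A') = \<kappa> * ?w A'" if A': "A' \<subseteq> \<Theta>" for A'
    proof -
      have "weight \<beta> (A' \<union> K) * weight \<beta> (C \<union> K)
          = weight \<beta> ((A' \<union> K) \<union> (C \<union> K)) * weight \<beta> ((A' \<union> K) \<inter> (C \<union> K))"
      proof (rule weight_modular)
        show "finite (A' \<union> K)" "finite (C \<union> K)"
          using K(1) finite_subset[OF subset_trans[OF A' \<Theta>S] S] finite_subset[OF CS S] by simp_all
        show ns: "\<not> (fst e \<in> A' \<union> K - (C \<union> K) \<and> prev_site e \<in> C \<union> K - (A' \<union> K))"
          and "\<not> (prev_site e \<in> A' \<union> K - (C \<union> K) \<and> fst e \<in> C \<union> K - (A' \<union> K))" for e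
        proof -
          have "nbr (fst e) (prev_site e)" "nbr (prev_site e) (fst e)" for e
            unfolding nbr_def by blast+
          moreover have "\<not> nbr c z" if "c \<in> C" "z \<in> A'" for c z
            using that A' by (auto simp: \<Theta>_def)
          ultimately show "\<not> (fst e \<in> A' \<union> K - (C \<union> K) \<and> prev_site e \<in> C \<union> K - (A' \<union> K))"
            "\<not> (prev_site e \<in> A' \<union> K - (C \<union> K) \<and> fst e \<in> C \<union> K - (A' \<union> K))" by blast+
        qed
      qed
      also have "(A' \<union> K) \<inter> (C \<union> K) = K" using A' \<Theta>C by auto
      also have "(A' \<union> K) \<union> (C \<union> K) = (C \<union> A') \<union> K" by auto
      finally show ?thesis
        using weight_pos[of \<beta> K] by (simp add: \<kappa>_def field_simps del: weight_pos)
    qed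
    have "sum ?w {A \<in> X. cl A = C} = (\<Sum>A' | A' \<subseteq> \<Theta> \<and> q \<in> A'. \<kappa> * ?w A')"
      unfolding Xeq sum.reindex[OF inj'] by (rule sum.cong) (auto simp: factor)
    then have 1: "sum ?w {A \<in> X. cl A = C} = \<kappa> * (\<Sum>A' | A' \<subseteq> \<Theta> \<and> q \<in> A'. ?w A')"
      by (simp add: sum_distrib_left)
    have "sum ?w {A \<in> Y. cl A = C} = (\<Sum>A'\<in>Pow \<Theta>. \<kappa> * ?w A')"
      unfolding Yeq sum.reindex[OF inj] by (rule sum.cong) (auto simp: factor)
    then have 2: "sum ?w {A \<in> Y. cl A = C} = \<kappa> * ising_sum \<beta> \<Theta> K"
      by (simp add: sum_distrib_left ising_sum_def)
    have "(\<Sum>A' | A' \<subseteq> \<Theta> \<and> q \<in> A'. ?w A') * ising_sum \<beta> S K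
       \<le> (\<Sum>A' | A' \<subseteq> S \<and> q \<in> A'. weight \<beta> (A' \<union> (K \<union> K))) * ising_sum \<beta> \<Theta> (K \<inter> K)"
      by (rule ising_sum_correlation) (use S \<Theta>S K \<beta> in auto)
    then have "\<kappa> * ((\<Sum>A' | A' \<subseteq> \<Theta> \<and> q \<in> A'. ?w A')
        * ising_sum \<beta> S K) \<le> \<kappa> * (Q
        * ising_sum \<beta> \<Theta> K)"
      by (intro mult_left_mono) (simp_all add: Q_def \<kappa>_def)
    then show ?thesis unfolding 1 2 by (simp add: mult_ac)
  qed
  have "sum ?w X * ising_sum \<beta> S K = (\<Sum>C\<in>Pow S. sum ?w {A \<in> X. cl A = C} * ising_sum \<beta> S K)"
    unfolding sum.group[OF fin(1,3) clS(1), symmetric] by (simp add: sum_distrib_right)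
  also have "\<dots> \<le> (\<Sum>C\<in>Pow S. sum ?w {A \<in> Y. cl A = C} * Q)"
    by (intro sum_mono main)
  also have "\<dots> = sum ?w Y * Q"
    unfolding sum.group[OF fin(2,3) clS(2), symmetric] by (simp add: sum_distrib_right)
  finally show ?thesis by (simp add: X_def Y_def Q_def)
qed

text \<open>
  The difference of the two products without the prefactor is, up to normalisation, the
  covariance of the spins at \<open>p\<close> and \<open>q\<close>. By
  \<open>separated_minus_correlation\<close> only configurations in which a minus path joins
  \<open>p\<close> to \<open>q\<close> make it positive. Their weight is compared with the plus
  boundary condition, which costs \<open>exp (8 * \<beta> * card K)\<close> once for the event
  and once for the normalisation, and then, since the event is increasing, with the larger
  region \<open>T\<close>. The factor \<open>16 * exp (32 * \<beta>)\<close> comes from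
  comparing the four values of the pair of spins with each other.
\<close>

lemma ising_sum_pair_le:
  assumes \<Lambda>: "finite \<Lambda>" "p \<notin> \<Lambda>" "q \<notin> \<Lambda>" "p \<noteq> q"
    and K: "finite K" "insert p (insert q \<Lambda>) \<inter> K = {}"
    and T: "finite T" "insert p (insert q \<Lambda>) \<subseteq> T" and \<beta>: "0 \<le> \<beta>"
    and link: "(\<Sum>A | A \<subseteq> T \<and> (p \<in> A \<and> linked A p q). weight \<beta> A) \<le> \<pi> * ising_sum \<beta> T {}"
  shows "ising_sum \<beta> \<Lambda> (insert p (insert q K)) * ising_sum \<beta> \<Lambda> K
    \<le> (1 + 16 * exp (32 * \<beta>) * exp (16 * \<beta> * real (card K)) * \<pi>)
        * (ising_sum \<beta> \<Lambda> (insert p K) * ising_sum \<beta> \<Lambda> (insert q K))"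
proof -
  define S where "S = insert p (insert q \<Lambda>)"
  define a where "a = ising_sum \<beta> \<Lambda> (insert p (insert q K))"
  define b where "b = ising_sum \<beta> \<Lambda> K"
  define c where "c = ising_sum \<beta> \<Lambda> (insert p K)"
  define d where "d = ising_sum \<beta> \<Lambda> (insert q K)"
  define t where "t = ising_sum \<beta> S K"
  define a2 where "a2 = (\<Sum>A | A \<subseteq> S \<and> (p \<in> A \<and> linked A p q). weight \<beta> (A \<union> K))"
  define a1 where "a1 = (\<Sum>A | A \<subseteq> S \<and> p \<in> A \<and> q \<in> A \<and> \<not> linked A p q. weight \<beta> (A \<union> K))"
  let ?w = "\<lambda>A. weight \<beta> (A \<union> K)"
  let ?e = "exp (8 * \<beta> * real (card K))"
  have S: "finite S" and SK: "S \<inter> K = {}" and fq: "finite (insert q \<Lambda>)" "p \<notin> insert q \<Lambda>"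
    using \<Lambda> K by (auto simp: S_def)
  have pos: "0 < a" "0 < b" "0 < c" "0 < d" "0 < t"
    using \<Lambda> S by (auto simp: a_def b_def c_def d_def t_def intro!: ising_sum_pos)
  have t: "t = a + b + c + d"
    unfolding t_def S_def ising_sum_insert_region[OF fq] ising_sum_insert_region[OF \<Lambda>(1,3)]
    by (simp add: a_def b_def c_def d_def insert_commute)
  have ev: "(\<Sum>A | A \<subseteq> S \<and> P A. ?w A)
      = (\<Sum>A\<in>Pow \<Lambda>. of_bool (P A) * ?w A + of_bool (P (insert q A)) * ?w (insert q A)
         + (of_bool (P (insert p A)) * ?w (insert p A)
            + of_bool (P (insert p (insert q A))) * ?w (insert p (insert q A))))" for P
  proof -
    have "(\<Sum>A | A \<subseteq> S \<and> P A. ?w A) = (\<Sum>A\<in>Pow S. of_bool (P A) * ?w A)"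
      unfolding sum_over_event[OF S order_refl] by (rule sum.cong) auto
    then show ?thesis
      unfolding S_def sum_Pow_insert[OF fq] sum_Pow_insert[OF \<Lambda>(1,3)] sum.distrib by simp
  qed
  have ac: "(\<Sum>A | A \<subseteq> S \<and> p \<in> A. ?w A) = a + c"
  proof -
    have "(\<Sum>A | A \<subseteq> S \<and> p \<in> A. ?w A)
      = (\<Sum>A\<in>Pow \<Lambda>. weight \<beta> (A \<union> insert p (insert q K)) + weight \<beta> (A \<union> insert p K))"
      unfolding ev using \<Lambda> by (intro sum.cong refl) (auto simp: add_ac)
    then show ?thesis by (simp add: a_def c_def ising_sum_def sum.distrib)
  qed
  have ad: "(\<Sum>A | A \<subseteq> S \<and> q \<in> A. ?w A) = a + d"
  proof -
    have "(\<Sum>A | A \<subseteq> S \<and> q \<in> A. ?w A)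
      = (\<Sum>A\<in>Pow \<Lambda>. weight \<beta> (A \<union> insert p (insert q K)) + weight \<beta> (A \<union> insert q K))"
      unfolding ev using \<Lambda> by (intro sum.cong refl) (auto simp: add_ac)
    then show ?thesis by (simp add: a_def d_def ising_sum_def sum.distrib)
  qed
  have a: "a = a1 + a2"
  proof -
    have "(\<Sum>A | A \<subseteq> S \<and> (p \<in> A \<and> q \<in> A). ?w A)
      = (\<Sum>A\<in>Pow \<Lambda>. weight \<beta> (A \<union> insert p (insert q K)))"
      unfolding ev using \<Lambda> by (intro sum.cong refl) (auto simp: add_ac)
    then have "a = (\<Sum>A | A \<subseteq> S \<and> (p \<in> A \<and> q \<in> A). ?w A)" by (simp add: a_def ising_sum_def)
    also have "{A. A \<subseteq> S \<and> (p \<in> A \<and> q \<in> A)}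
        = {A. A \<subseteq> S \<and> p \<in> A \<and> q \<in> A \<and> \<not> linked A p q} \<union> {A. A \<subseteq> S \<and> (p \<in> A \<and> linked A p q)}"
      by (auto dest: linked_in)
    also have "sum ?w \<dots> = a1 + a2"
      unfolding a1_def a2_def using S by (intro sum.union_disjoint) auto
    finally show ?thesis .
  qed
  \<comment> \<open>\<open>t\<close> is the total, \<open>a + c\<close> and \<open>a + d\<close> are the weights of a minus spin at \<open>p\<close> and at \<open>q\<close>\<close>
  have "a1 * t \<le> (a + c) * (a + d)"
    using separated_minus_correlation[OF S K(1) SK \<beta>, of p q]
    by (simp only: a1_def[symmetric] t_def[symmetric] ac ad)
  then have "a * t \<le> (a + c) * (a + d) + a2 * t"
    unfolding a by (simp add: algebra_simps)
  then have cov: "a * b \<le> c * d + a2 * t"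
    unfolding t by (simp add: algebra_simps)
  define L0 where "L0 = (\<Sum>A | A \<subseteq> S \<and> (p \<in> A \<and> linked A p q). weight \<beta> A)"
  have "a2 \<le> ?e * L0"
    unfolding a2_def L0_def sum_distrib_left
    by (intro sum_mono weight_Un_bounds[THEN conjunct1]) (auto intro: finite_subset[OF _ S] K \<beta>)
  also have "L0 * ising_sum \<beta> T {} \<le> (\<pi> * ising_sum \<beta> T {}) * ising_sum \<beta> S {}"
  proof -
    have "L0
        * ising_sum \<beta> T {} \<le> (\<Sum>A | A \<subseteq> T \<and> (p \<in> A \<and> linked A p q). weight \<beta> A)
        * ising_sum \<beta> S {}"
    proof -
      have "(\<Sum>A | A \<subseteq> S \<and> (p \<in> A \<and> linked A p q). weight \<beta> (A \<union> {})) * ising_sum \<beta> T {}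
         \<le> (\<Sum>A | A \<subseteq> T \<and> (p \<in> A \<and> linked A p q). weight \<beta> (A \<union> ({} \<union> {})))
             * ising_sum \<beta> S ({} \<inter> {})"
        by (rule ising_sum_correlation) (use T \<beta> in \<open>auto simp: S_def intro: linked_mono\<close>)
      then show ?thesis by (simp add: L0_def)
    qed
    also have "\<dots> \<le> (\<pi> * ising_sum \<beta> T {}) * ising_sum \<beta> S {}"
      using S by (intro mult_right_mono link less_imp_le ising_sum_pos)
    finally show ?thesis .
  qed
  then have L0: "L0 \<le> \<pi> * ising_sum \<beta> S {}"
    using ising_sum_pos[OF T(1), of \<beta> "{}"] by (simp add: mult_ac)
  have \<pi>: "0 \<le> \<pi>"
  proof -
    have "0 \<le> L0" unfolding L0_def by (intro sum_nonneg) auto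
    then have "0 \<le> \<pi> * ising_sum \<beta> S {}" using L0 by linarith
    then show ?thesis using ising_sum_pos[OF S, of \<beta> "{}"] by (simp add: zero_le_mult_iff)
  qed
  have "ising_sum \<beta> S {} \<le> ?e * t"
    using ising_sum_Un_bounds(2)[OF S _ K(1) \<beta>, of "{}"] by (simp add: t_def)
  then have "L0 \<le> \<pi> * (?e * t)"
    using L0 \<pi> by (meson mult_left_mono order_trans)
  then have "?e * L0 \<le> ?e * (\<pi> * (?e * t))" by (intro mult_left_mono) auto
  finally have "a2 * t \<le> (?e * (\<pi> * (?e * t))) * t"
    using pos by (intro mult_right_mono) auto
  also have "\<dots> = (?e * ?e) * \<pi> * (t * t)" by (simp add: mult_ac)
  also have "?e * ?e = exp (16 * \<beta> * real (card K))" by (simp add: exp_add[symmetric])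
  also have "exp (16 * \<beta> * real (card K)) * \<pi> * (t * t)
     \<le> exp (16 * \<beta> * real (card K)) * \<pi> * ((4 * exp (16 * \<beta>) * c) * (4 * exp (16 * \<beta>) * d))"
  proof -
    let ?x = "exp (8 * \<beta>)"
    have ins: "ising_sum \<beta> \<Lambda> (insert z B) \<le> ?x
        * ising_sum \<beta> \<Lambda> B" "ising_sum \<beta> \<Lambda> B \<le> ?x
        * ising_sum \<beta> \<Lambda> (insert z B)"
      if "finite B" for z B
      using ising_sum_Un_bounds[OF \<Lambda>(1) that _ \<beta>, of "{z}"] by auto
    have xx: "exp (16 * \<beta>) = ?x * ?x" by (simp add: exp_add[symmetric])
    have "1 \<le> ?x" using \<beta> by simp
    then have x: "u \<le> ?x * u" "?x * u \<le> ?x * (?x * u)" if "0 < u" for u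
      using that by simp_all
    have 1: "a \<le> ?x * c" "a \<le> ?x * d" "b \<le> ?x * c" "b \<le> ?x * d"
      using ins[of "insert p K" q] ins[of "insert q K" p] ins[of K p] ins[of K q] K
      by (simp_all add: a_def b_def c_def d_def insert_commute)
    have 2: "c \<le> ?x * b" "d \<le> ?x * b"
      using ins[of K p] ins[of K q] K by (simp_all add: b_def c_def d_def)
    have 3: "c \<le> ?x * (?x * d)" "d \<le> ?x * (?x * c)"
      using 1(3,4) 2 by (meson exp_ge_zero mult_left_mono order_trans)+
    have "t \<le> 4 * (?x * ?x) * c" "t \<le> 4 * (?x * ?x) * d"
      unfolding t mult.assoc using 1 3 x[OF pos(3)] x[OF pos(4)] by linarith+
    then have "t * t \<le> (4 * (?x * ?x) * c) * (4 * (?x * ?x) * d)"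
      using pos by (intro mult_mono) auto
    then show ?thesis unfolding xx using \<pi> by (intro mult_left_mono) auto
  qed
  also have "\<dots> = 16 * exp (32 * \<beta>) * exp (16 * \<beta> * real (card K)) * \<pi> * (c * d)"
  proof -
    have "exp (32 * \<beta>) = exp (16 * \<beta>) * exp (16 * \<beta>)" by (simp add: exp_add[symmetric])
    then show ?thesis by (simp add: mult_ac)
  qed
  finally have "a * b \<le> c * d + 16 * exp (32 * \<beta>) * exp (16 * \<beta> * real (card K)) * \<pi> * (c * d)"
    using cov by linarith
  then show ?thesis
    unfolding a_def[symmetric] b_def[symmetric] c_def[symmetric] d_def[symmetric]
    by (simp add: algebra_simps)
qed

section \<open>Contours\<close>

text \<open>
  The four sides of the unit square with upper right corner \<open>z\<close>. Two bonds touch if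
  they are sides of a common square, that is, if the dual edges share an end.
\<close>

definition plaquette :: "int \<times> int \<Rightarrow> ((int \<times> int) \<times> bool) set" where
  "plaquette z = {(z, False), ((fst z, snd z - 1), False), (z, True), ((fst z - 1, snd z), True)}"

definition touch :: "(int \<times> int) \<times> bool \<Rightarrow> (int \<times> int) \<times> bool \<Rightarrow> bool" where
  "touch e f \<longleftrightarrow> (\<exists>z. e \<in> plaquette z \<and> f \<in> plaquette z)"

definition chained :: "((int \<times> int) \<times> bool) set \<Rightarrow> (int \<times> int) \<times> bool \<Rightarrow> (int \<times> int) \<times> bool \<Rightarrow> bool" where
  "chained K = (\<lambda>e f. touch e f \<and> e \<in> K \<and> f \<in> K)\<^sup>*\<^sup>*"

text \<open>
  Every plaquette has an even number of sides in \<open>K\<close>.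
\<close>

definition closed_contour :: "((int \<times> int) \<times> bool) set \<Rightarrow> bool" where
  "closed_contour K \<longleftrightarrow> (\<forall>u v. (((u, v), False) \<in> K \<longleftrightarrow> ((u, v - 1), False) \<in> K)
     \<longleftrightarrow> (((u, v), True) \<in> K \<longleftrightarrow> ((u - 1, v), True) \<in> K))"

lemma horizontal_in_boundary: "((u, v), False) \<in> boundary I \<longleftrightarrow> ((u, v) \<in> I) \<noteq> ((u - 1, v) \<in> I)"
  and vertical_in_boundary: "((u, v), True) \<in> boundary I \<longleftrightarrow> ((u, v) \<in> I) \<noteq> ((u, v - 1) \<in> I)"
  by (auto simp: boundary_def prev_site_def)

lemma closed_contour_boundary: "closed_contour (boundary I)"
  unfolding closed_contour_def horizontal_in_boundary vertical_in_boundary by blast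

text \<open>
  A discrete Poincare lemma. Put a site into \<open>I\<close> if the horizontal ray from the far
  left to it crosses \<open>K\<close> an odd number of times. Then \<open>I\<close> has the
  right horizontal boundary bonds by construction. For the vertical bonds of a row the parity
  condition carries correctness from the far left, where nothing happens, one column further at
  a time. To the right of \<open>K\<close> membership in \<open>I\<close> is constant along
  columns, and high rows do not meet \<open>I\<close>; hence \<open>I\<close> is bounded.
\<close>

lemma closed_contour_is_boundary:
  assumes K: "finite K" "closed_contour K"
  obtains I where "finite I" "boundary I = K"
proof -
  define M where "M = Max (insert 0 ((\<lambda>e. \<bar>fst (fst e)\<bar> + \<bar>snd (fst e)\<bar>) ` K))"
  have M: "\<bar>u\<bar> \<le> M \<and> \<bar>v\<bar> \<le> M" if "((u, v), b) \<in> K" for u v b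
  proof -
    have "\<bar>u\<bar> + \<bar>v\<bar> \<le> M"
      unfolding M_def using K that by (intro Max_ge) (auto intro!: image_eqI[of _ _ "((u, v), b)"])
    then show ?thesis by linarith
  qed
  define cnt where "cnt u v = card {k. k \<le> u \<and> ((k, v), False) \<in> K}" for u v
  define I where "I = {(u, v). odd (cnt u v)}"
  have fin: "finite {k. k \<le> u \<and> ((k, v), False) \<in> K}" for u v
    by (rule finite_subset[of _ "(\<lambda>e. fst (fst e)) ` K"]) (use K in \<open>auto intro!: image_eqI\<close>)
  have cnt_step: "cnt u v = cnt (u - 1) v + of_bool (((u, v), False) \<in> K)" for u v
  proof (cases "((u, v), False) \<in> K")
    case True
    then have "{k. k \<le> u \<and> ((k, v), False) \<in> K} = insert u {k. k \<le> u - 1 \<and> ((k, v), False) \<in> K}"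
      by auto
    then show ?thesis using True fin[of "u - 1" v] by (simp add: cnt_def)
  next
    case False
    have "k \<le> u - 1" if "k \<le> u" "((k, v), False) \<in> K" for k
      using that False by (cases "k = u") auto
    then have "{k. k \<le> u \<and> ((k, v), False) \<in> K} = {k. k \<le> u - 1 \<and> ((k, v), False) \<in> K}"
      by force
    then show ?thesis using False by (simp add: cnt_def)
  qed
  have cnt_0: "cnt u v = 0" if "u < - M \<or> M < \<bar>v\<bar>" for u v
  proof -
    have none: "\<not> (k \<le> u \<and> ((k, v), False) \<in> K)" for k
      using that M[of k v False] by linarith
    show ?thesis by (simp add: cnt_def none)
  qed
  have hor: "((u, v) \<in> I) \<noteq> ((u - 1, v) \<in> I) \<longleftrightarrow> ((u, v), False) \<in> K" for u v
    using cnt_step[of u v] by (auto simp: I_def)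
  have ver: "((u, v) \<in> I) \<noteq> ((u, v - 1) \<in> I) \<longleftrightarrow> ((u, v), True) \<in> K" for u v
  proof (cases "- M - 1 \<le> u")
    case True
    then show ?thesis
    proof (induction u rule: int_ge_induct)
      case base
      then show ?case using cnt_0[of "- M - 1"] M[of "- M - 1" v True] by (auto simp: I_def)
    next
      case (step u)
      have "(((u + 1, v), False) \<in> K \<longleftrightarrow> ((u + 1, v - 1), False) \<in> K)
        \<longleftrightarrow> (((u + 1, v), True) \<in> K \<longleftrightarrow> ((u + 1 - 1, v), True) \<in> K)"
        using K(2) unfolding closed_contour_def by blast
      then show ?case using step.IH hor[of "u + 1" v] hor[of "u + 1" "v - 1"]
        unfolding add_diff_cancel_right' by blast
    qed
  next
    case False
    then show ?thesis using cnt_0[of u] M[of u v True] by (auto simp: I_def)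
  qed
  have "boundary I = K"
  proof (rule set_eqI)
    fix e :: "(int \<times> int) \<times> bool"
    obtain u v b where e: "e = ((u, v), b)" by (metis prod.exhaust)
    show "e \<in> boundary I \<longleftrightarrow> e \<in> K"
      using hor[of u v] ver[of u v]
      by (cases b) (auto simp only: e horizontal_in_boundary vertical_in_boundary)
  qed
  moreover have "finite I"
  proof (rule finite_subset)
    show "I \<subseteq> {- M..M} \<times> {- M..M}"
    proof (rule subsetI)
      fix z assume z: "z \<in> I"
      obtain u v where uv: "z = (u, v)" by (cases z)
      have "odd (cnt u v)" using z by (simp add: uv I_def)
      then have 1: "- M \<le> u" "\<bar>v\<bar> \<le> M" using cnt_0[of u v] by force+
      have "u \<le> M"
      proof (rule ccontr)
        assume "\<not> u \<le> M"
        then have "((u, v'), True) \<notin> K" for v' using M[of u v' True] by auto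
        then have up: "(u, v') \<in> I \<longleftrightarrow> (u, v' - 1) \<in> I" for v' using ver[of u v'] by blast
        have "(u, v + int k) \<in> I" for k
        proof (induction k)
          case 0 then show ?case using z uv by simp
        next
          case (Suc k)
          have "v + int (Suc k) - 1 = v + int k" by simp
          then show ?case using Suc up[of "v + int (Suc k)"] by simp
        qed
        from this[of "nat (2 * M + 1)"] have "odd (cnt u (v + int (nat (2 * M + 1))))"
          by (simp add: I_def)
        then show False using 1 cnt_0[of u "v + int (nat (2 * M + 1))"] by auto
      qed
      then show "z \<in> {- M..M} \<times> {- M..M}" using 1 by (auto simp: uv)
    qed
  qed simp
  ultimately show thesis using that by blast
qed

lemma chained_in: "chained K e f \<Longrightarrow> e \<in> K \<Longrightarrow> f \<in> K"
  unfolding chained_def by (induction rule: rtranclp_induct) auto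

text \<open>
  The sides of one plaquette touch each other, so a component of \<open>K\<close> contains
  either all or none of the sides that belong to \<open>K\<close>.
\<close>

lemma closed_contour_component:
  assumes "closed_contour K" "e \<in> K"
  shows "closed_contour {f. chained K e f}"
  unfolding closed_contour_def
proof (intro allI)
  fix u v
  define C where "C = {f. chained K e f}"
  have CK: "C \<subseteq> K" unfolding C_def using chained_in[OF _ assms(2)] by blast
  have K: "(((u, v), False) \<in> K \<longleftrightarrow> ((u, v - 1), False) \<in> K)
        \<longleftrightarrow> (((u, v), True) \<in> K \<longleftrightarrow> ((u - 1, v), True) \<in> K)"
    using assms(1) unfolding closed_contour_def by blast
  let ?P = "{((u, v), False), ((u, v - 1), False), ((u, v), True), ((u - 1, v), True)}"
  have spread: "g \<in> C" if "f \<in> ?P" "g \<in> ?P" "f \<in> C" "g \<in> K" for f g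
  proof -
    have "touch f g" using that(1,2) unfolding touch_def plaquette_def
      by (intro exI[of _ "(u, v)"]) auto
    then show ?thesis
      using that(3,4) CK unfolding C_def chained_def
      by (auto intro: rtranclp.rtrancl_into_rtrancl)
  qed
  have "?P \<inter> C = {} \<or> ?P \<inter> C = ?P \<inter> K" using spread CK by blast
  then show "(((u, v), False) \<in> {f. chained K e f} \<longleftrightarrow> ((u, v - 1), False) \<in> {f. chained K e f})
        \<longleftrightarrow> (((u, v), True) \<in> {f. chained K e f} \<longleftrightarrow> ((u - 1, v), True) \<in> {f. chained K e f})"
    unfolding C_def[symmetric] using K by blast
qed

lemma boundary_sym_diff:
  "boundary ((A - B) \<union> (B - A)) = (boundary A - boundary B) \<union> (boundary B - boundary A)"
  unfolding boundary_def by blast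

text \<open>
  Among the finite sets around \<open>p\<close> whose boundary is contained in that of
  \<open>A\<close> take a set \<open>I\<close> with the fewest boundary bonds. If its boundary
  were not connected, one component would be the boundary of some \<open>J\<close>. Either
  \<open>J\<close> or the symmetric difference of \<open>I\<close> and \<open>J\<close> contains
  \<open>p\<close>, and both have fewer boundary bonds.
\<close>

lemma connected_contour_around:
  assumes A: "finite A" "p \<in> A"
  obtains I where "finite I" "p \<in> I" "boundary I \<subseteq> boundary A"
    "\<And>e f. e \<in> boundary I \<Longrightarrow> f \<in> boundary I \<Longrightarrow> chained (boundary I) e f"
proof -
  define P where "P I \<longleftrightarrow> finite I \<and> p \<in> I \<and> boundary I \<subseteq> boundary A" for I
  have "P A" using A by (simp add: P_def)
  then obtain I where I: "P I" and least: "\<And>J. P J \<Longrightarrow> card (boundary I) \<le> card (boundary J)"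
    using ex_has_least_nat[of P A "\<lambda>I. card (boundary I)"] by blast
  have "chained (boundary I) e f" if ef: "e \<in> boundary I" "f \<in> boundary I" for e f
  proof (rule ccontr)
    assume f: "\<not> chained (boundary I) e f"
    define C where "C = {g. chained (boundary I) e g}"
    have CI: "C \<subseteq> boundary I" unfolding C_def using chained_in[OF _ ef(1)] by blast
    have eC: "e \<in> C" by (simp add: C_def chained_def)
    have fC: "f \<notin> C" using f by (simp add: C_def)
    have finI: "finite I" "finite (boundary I)" using I by (auto simp: P_def)
    have "closed_contour C"
      unfolding C_def by (rule closed_contour_component[OF closed_contour_boundary ef(1)])
    then obtain J where J: "finite J" "boundary J = C"
      using closed_contour_is_boundary[of C] finite_subset[OF CI finI(2)] by blast
    let ?D = "(I - J) \<union> (J - I)"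
    have D: "boundary ?D = boundary I - C" unfolding boundary_sym_diff J(2) using CI by blast
    \<comment> \<open>\<open>p\<close> lies in \<open>I\<close>, hence in exactly one of \<open>J\<close> and \<open>I - J\<close>\<close>
    have "P J \<or> P ?D" using I J CI D by (auto simp: P_def)
    then have "card (boundary I) \<le> card C \<or> card (boundary I) \<le> card (boundary I - C)"
      using least[of J] least[of ?D] J(2) D by auto
    moreover have "card C < card (boundary I)"
      using CI fC ef by (intro psubset_card_mono finI) auto
    moreover have "card (boundary I - C) < card (boundary I)"
      using eC ef by (intro psubset_card_mono finI) auto
    ultimately show False by linarith
  qed
  then show thesis using that I unfolding P_def by blast
qed

text \<open>
  As long as a walk misses a bond of \<open>K\<close>, some visited bond \<open>u\<close>
  touches an unvisited bond \<open>v\<close> of \<open>K\<close>, and replacing one visit of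
  \<open>u\<close> by the detour \<open>u, v, u\<close> adds one new bond at the cost of two
  steps.
\<close>

lemma covering_walk:
  assumes K: "finite K" "e \<in> K" and con: "\<And>f. f \<in> K \<Longrightarrow> chained K e f"
  obtains w where "w \<noteq> []" "hd w = e" "set w = K" "successively touch w" "length w = 2 * card K - 1"
proof -
  have "\<exists>w. w \<noteq> [] \<and> hd w = e \<and> set w \<subseteq> K \<and> card (set w) = Suc m \<and> successively touch w
          \<and> length w = 2 * m + 1" if "Suc m \<le> card K" for m
    using that
  proof (induction m)
    case 0
    then show ?case using K by (intro exI[of _ "[e]"]) auto
  next
    case (Suc m)
    then obtain w where w: "w \<noteq> []" "hd w = e" "set w \<subseteq> K" "card (set w) = Suc m"
      "successively touch w" "length w = 2 * m + 1" by auto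
    have "set w \<noteq> K" using Suc w by auto
    then obtain f where f: "f \<in> K" "f \<notin> set w" using w by blast
    have "e \<in> set w" using w hd_in_set by blast
    have cross: "\<exists>u v. u \<in> set w \<and> v \<in> K \<and> v \<notin> set w \<and> touch u v"
      if "chained K e f" "f \<notin> set w" for f
      using that unfolding chained_def
    proof (induction rule: rtranclp_induct)
      case base
      then show ?case using \<open>e \<in> set w\<close> by blast
    next
      case (step y z)
      then show ?case by blast
    qed
    obtain u v where uv: "u \<in> set w" "v \<in> K" "v \<notin> set w" "touch u v"
      using cross[OF con[OF f(1)] f(2)] by (elim exE conjE)
    obtain xs ys where xs: "w = xs @ u # ys" using split_list[OF uv(1)] by blast
    have "touch v u" using uv(4) unfolding touch_def by blast
    define w' where "w' = xs @ u # v # u # ys"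
    have "w' \<noteq> []" by (simp add: w'_def)
    moreover have "hd w' = e" using w(2) unfolding w'_def xs by (cases xs) auto
    moreover have set: "set w' = insert v (set w)" by (auto simp: w'_def xs)
    moreover have "set w' \<subseteq> K" "card (set w') = Suc (Suc m)"
      unfolding set using w uv by auto
    moreover have "successively touch w'"
      using w(5) uv(4) \<open>touch v u\<close> unfolding w'_def xs
      by (auto simp: successively_append_iff successively_Cons)
    moreover have "length w' = 2 * Suc m + 1" using w(6) unfolding w'_def xs by simp
    ultimately show ?case by blast
  qed
  from this[of "card K - 1"]
  have "\<exists>w. w \<noteq> [] \<and> hd w = e \<and> set w \<subseteq> K \<and> card (set w) = card K \<and> successively touch w
          \<and> length w = 2 * card K - 1"
    using K card_gt_0_iff[of K] by (cases "card K") auto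
  then show thesis using that card_subset_eq[OF K(1)] by metis
qed

lemma card_touch: "finite {f. touch e f}" "card {f. touch e f} \<le> 8"
proof -
  obtain u v b where e: "e = ((u, v), b)" by (metis prod.exhaust)
  define z where "z = (if b then (u + 1, v) else (u, v + 1))"
  have sub: "{f. touch e f} \<subseteq> plaquette (u, v) \<union> plaquette z"
  proof (rule subsetI)
    fix f assume "f \<in> {f. touch e f}"
    then obtain y where y: "e \<in> plaquette y" "f \<in> plaquette y" by (auto simp: touch_def)
    obtain y1 y2 where y12: "y = (y1, y2)" by (cases y)
    have "y = (u, v) \<or> y = z"
      using y(1) unfolding e z_def plaquette_def y12 by (cases b) auto
    then show "f \<in> plaquette (u, v) \<union> plaquette z" using y(2) by blast
  qed
  have c: "finite (plaquette y)" "card (plaquette y) \<le> 4" for y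
    unfolding plaquette_def by (simp_all add: card_insert_if)
  show "finite {f. touch e f}" using sub by (rule finite_subset) (simp add: c)
  have "card {f. touch e f} \<le> card (plaquette (u, v) \<union> plaquette z)"
    using sub by (rule card_mono[rotated]) (simp add: c)
  also have "\<dots> \<le> card (plaquette (u, v)) + card (plaquette z)" by (rule card_Un_le)
  also have "\<dots> \<le> 8" using c(2)[of "(u, v)"] c(2)[of z] by linarith
  finally show "card {f. touch e f} \<le> 8" .
qed

lemma card_walks:
  "finite {w. w \<noteq> [] \<and> hd w = e \<and> successively touch w \<and> length w = Suc m} \<and>
   card {w. w \<noteq> [] \<and> hd w = e \<and> successively touch w \<and> length w = Suc m} \<le> 8 ^ m"
  (is "finite (?W e m) \<and> _")
proof (induction m arbitrary: e)
  case 0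
  have "?W e 0 \<subseteq> {[e]}" by (auto simp: length_Suc_conv)
  then show ?case using card_mono[of "{[e]}" "?W e 0"] finite_subset[of "?W e 0" "{[e]}"] by auto
next
  case (Suc m)
  have sub: "?W e (Suc m) \<subseteq> (\<Union>f\<in>{f. touch e f}. (#) e ` ?W f m)"
  proof (rule subsetI)
    fix w assume w: "w \<in> ?W e (Suc m)"
    then obtain f w' where ef: "w = e # f # w'" by (auto simp: length_Suc_conv)
    have "touch e f" "f # w' \<in> ?W f m" using w unfolding ef by simp_all
    then show "w \<in> (\<Union>f\<in>{f. touch e f}. (#) e ` ?W f m)"
      unfolding ef by blast
  qed
  have fin: "finite (\<Union>f\<in>{f. touch e f}. (#) e ` ?W f m)"
    using Suc card_touch(1)[of e] by blast
  have "card (?W e (Suc m)) \<le> card (\<Union>f\<in>{f. touch e f}. (#) e ` ?W f m)"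
    by (rule card_mono[OF fin sub])
  also have "\<dots> \<le> (\<Sum>f\<in>{f. touch e f}. card ((#) e ` ?W f m))"
    by (rule card_UN_le[OF card_touch(1)])
  also have "\<dots> \<le> (\<Sum>f\<in>{f. touch e f}. 8 ^ m)"
  proof (rule sum_mono)
    fix f
    show "card ((#) e ` ?W f m) \<le> 8 ^ m"
      using card_image_le[of "?W f m" "(#) e"] Suc[of f] by linarith
  qed
  also have "\<dots> \<le> 8 * 8 ^ m" using card_touch(2)[of e] by simp
  finally show ?case using finite_subset[OF sub fin] by simp
qed

text \<open>
  A connected set of \<open>l\<close> bonds is the range of a walk with \<open>2 * (l -
  1)\<close> steps, and every step has at most eight choices.
\<close>

lemma card_connected_contours:
  "finite {K. finite K \<and> e \<in> K \<and> (\<forall>f\<in>K. chained K e f) \<and> card K = l} \<and>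
   card {K. finite K \<and> e \<in> K \<and> (\<forall>f\<in>K. chained K e f) \<and> card K = l} \<le> 64 ^ l"
  (is "finite ?C \<and> _")
proof -
  let ?W = "{w. w \<noteq> [] \<and> hd w = e \<and> successively touch w \<and> length w = Suc (2 * (l - 1))}"
  have sub: "?C \<subseteq> set ` ?W"
  proof (rule subsetI)
    fix K assume K: "K \<in> ?C"
    then have "0 < card K" using card_gt_0_iff by blast
    moreover obtain w where "w \<noteq> []" "hd w = e" "set w = K" "successively touch w"
      "length w = 2 * card K - 1"
      using covering_walk[of K e] K by blast
    ultimately show "K \<in> set ` ?W" using K by (intro image_eqI[of _ _ w]) auto
  qed
  have W: "finite ?W" "card ?W \<le> 8 ^ (2 * (l - 1))" using card_walks[of e "2 * (l - 1)"] by auto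
  have "card ?C \<le> card (set ` ?W)" by (rule card_mono[OF finite_imageI[OF W(1)] sub])
  also have "\<dots> \<le> card ?W" by (rule card_image_le[OF W(1)])
  also have "\<dots> \<le> 8 ^ (2 * (l - 1))" by (rule W)
  also have "\<dots> \<le> (8::nat) ^ (2 * l)" by (intro power_increasing) auto
  also have "\<dots> = 64 ^ l" by (simp add: power_mult)
  finally show ?thesis using finite_subset[OF sub finite_imageI[OF W(1)]] by blast
qed

section \<open>The Peierls estimate\<close>

text \<open>
  Above the highest site of \<open>I\<close> in a column there is a boundary bond, and different
  columns give different bonds.
\<close>

lemma card_boundary_ge_columns:
  assumes I: "finite I" and U: "\<And>u. u \<in> U \<Longrightarrow> \<exists>v. (u, v) \<in> I"
  shows "card U \<le> card (boundary I)"
proof -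
  define top where "top u = Max {v. (u, v) \<in> I}" for u
  have fin: "finite {v. (u, v) \<in> I}" for u
    by (rule finite_subset[of _ "snd ` I"]) (use I in \<open>auto intro!: image_eqI\<close>)
  have "((u, top u + 1), True) \<in> boundary I" if "u \<in> U" for u
  proof -
    have "top u \<in> {v. (u, v) \<in> I}"
      unfolding top_def using U[OF that] by (intro Max_in fin) auto
    moreover have "top u + 1 \<notin> {v. (u, v) \<in> I}"
      using Max_ge[OF fin, of "top u + 1" u] unfolding top_def by auto
    ultimately show ?thesis unfolding vertical_in_boundary by simp
  qed
  then have "(\<lambda>u. ((u, top u + 1), True)) ` U \<subseteq> boundary I" by blast
  then have "card ((\<lambda>u. ((u, top u + 1), True)) ` U) \<le> card (boundary I)"
    by (intro card_mono) (simp_all add: I)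
  also have "card ((\<lambda>u. ((u, top u + 1), True)) ` U) = card U"
    by (rule card_image) (auto simp: inj_on_def)
  finally show ?thesis .
qed

text \<open>
  A bond that leaves \<open>I\<close> across an extreme row or column belongs to the boundary of
  \<open>A\<close>, so one of its ends lies in the square; then its inner end cannot lie beyond
  the square.
\<close>

lemma contour_inside_square:
  assumes I: "finite I" "boundary I \<subseteq> boundary A" and A: "A \<subseteq> square n"
  shows "I \<subseteq> square n"
proof -
  have A': "\<bar>u\<bar> \<le> int n \<and> \<bar>v\<bar> \<le> int n" if "(u, v) \<in> A" for u v
  proof -
    have "(u, v) \<in> square n" using that A by blast
    then show ?thesis by (auto simp: square_def)
  qed
  have fin: "finite (fst ` I)" "finite (snd ` I)" using I by auto
  have "\<bar>u\<bar> \<le> int n \<and> \<bar>v\<bar> \<le> int n" if uv: "(u, v) \<in> I" for u v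
  proof -
    have ne: "fst ` I \<noteq> {}" "snd ` I \<noteq> {}" using uv by auto
    have mem: "u \<in> fst ` I" "v \<in> snd ` I" using uv by force+
    have "Max (fst ` I) \<le> int n"
    proof -
      let ?m = "Max (fst ` I)"
      obtain y where y: "(?m, y) \<in> I" using Max_in[OF fin(1) ne(1)] by auto
      have "(?m + 1, y) \<notin> I" using Max_ge[OF fin(1), of "?m + 1"] by force
      then have "((?m + 1, y), False) \<in> boundary A"
        using y I(2) horizontal_in_boundary[of "?m + 1" y I] by auto
      then show ?thesis using A'[of ?m y] A'[of "?m + 1" y]
        unfolding horizontal_in_boundary by auto
    qed
    moreover have "- int n \<le> Min (fst ` I)"
    proof -
      let ?m = "Min (fst ` I)"
      obtain y where y: "(?m, y) \<in> I" using Min_in[OF fin(1) ne(1)] by auto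
      have "(?m - 1, y) \<notin> I" using Min_le[OF fin(1), of "?m - 1"] by force
      then have "((?m, y), False) \<in> boundary A"
        using y I(2) horizontal_in_boundary[of "?m" y I] by auto
      then show ?thesis using A'[of ?m y] A'[of "?m - 1" y]
        unfolding horizontal_in_boundary by auto
    qed
    moreover have "Max (snd ` I) \<le> int n"
    proof -
      let ?m = "Max (snd ` I)"
      obtain y where y: "(y, ?m) \<in> I" using Max_in[OF fin(2) ne(2)] by auto
      have "(y, ?m + 1) \<notin> I" using Max_ge[OF fin(2), of "?m + 1"] by force
      then have "((y, ?m + 1), True) \<in> boundary A"
        using y I(2) vertical_in_boundary[of y "?m + 1" I] by auto
      then show ?thesis using A'[of y ?m] A'[of y "?m + 1"]
        unfolding vertical_in_boundary by auto
    qed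
    moreover have "- int n \<le> Min (snd ` I)"
    proof -
      let ?m = "Min (snd ` I)"
      obtain y where y: "(y, ?m) \<in> I" using Min_in[OF fin(2) ne(2)] by auto
      have "(y, ?m - 1) \<notin> I" using Min_le[OF fin(2), of "?m - 1"] by force
      then have "((y, ?m), True) \<in> boundary A"
        using y I(2) vertical_in_boundary[of y "?m" I] by auto
      then show ?thesis using A'[of y ?m] A'[of y "?m - 1"]
        unfolding vertical_in_boundary by auto
    qed
    ultimately show ?thesis
      using Max_ge[OF fin(1) mem(1)] Min_le[OF fin(1) mem(1)]
        Max_ge[OF fin(2) mem(2)] Min_le[OF fin(2) mem(2)] by linarith
  qed
  then show ?thesis by (force simp: square_def)
qed

lemma inj_on_boundary: "inj_on boundary {I. finite I}"
proof (rule inj_onI)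
  fix I J :: "(int \<times> int) set"
  assume fin: "I \<in> {I. finite I}" "J \<in> {I. finite I}" and eq: "boundary I = boundary J"
  let ?D = "(I - J) \<union> (J - I)"
  have "boundary ?D = {}" unfolding boundary_sym_diff eq by simp
  then have "card (fst ` ?D) \<le> 0"
    using card_boundary_ge_columns[of ?D "fst ` ?D"] fin by force
  then have "?D = {}" using fin by simp
  then show "I = J" by blast
qed

lemma nbr_not_in_boundary:
  assumes "nbr y z" "y \<in> A" "z \<in> A" "boundary I \<subseteq> boundary A"
  shows "y \<in> I \<longleftrightarrow> z \<in> I" and "\<bar>fst y - fst z\<bar> \<le> 1"
proof -
  obtain e where e: "fst e = y \<and> prev_site e = z \<or> prev_site e = y \<and> fst e = z"
    using assms(1) unfolding nbr_def by blast
  then have "e \<notin> boundary A" using assms(2,3) by (auto simp: boundary_def)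
  then have "e \<notin> boundary I" using assms(4) by blast
  then show "y \<in> I \<longleftrightarrow> z \<in> I" using e unfolding boundary_def by blast
  show "\<bar>fst y - fst z\<bar> \<le> 1" using e by (auto simp: prev_site_def split: if_splits)
qed

text \<open>
  A path inside \<open>A\<close> crosses no bond of the boundary of \<open>A\<close>. Hence it
  never leaves \<open>I\<close>, and a path of nearest neighbours cannot skip a column.
\<close>

lemma linked_columns:
  assumes "linked A p z" "p \<in> A" "p \<in> I" "boundary I \<subseteq> boundary A"
  shows "z \<in> I \<and> (\<forall>u. (fst p \<le> u \<and> u \<le> fst z \<or> fst z \<le> u \<and> u \<le> fst p) \<longrightarrow> (\<exists>v. (u, v) \<in> I))"
  using assms(1) unfolding linked_def
proof (induction rule: rtranclp_induct)
  case base
  then show ?case using assms(3) by (metis antisym prod.collapse)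
next
  case (step y z)
  have yz: "nbr y z" "y \<in> A" "z \<in> A" using step(2) by auto
  have z: "z \<in> I" using nbr_not_in_boundary(1)[OF yz assms(4)] step.IH by simp
  have close: "\<bar>fst y - fst z\<bar> \<le> 1" by (rule nbr_not_in_boundary(2)[OF yz assms(4)])
  have "\<exists>v. (u, v) \<in> I" if "fst p \<le> u \<and> u \<le> fst z \<or> fst z \<le> u \<and> u \<le> fst p" for u
  proof (cases "u = fst z")
    case True
    then show ?thesis using z by (metis prod.collapse)
  next
    case False
    then have "fst p \<le> u \<and> u \<le> fst y \<or> fst y \<le> u \<and> u \<le> fst p" using that close by linarith
    then show ?thesis using step.IH by blast
  qed
  then show ?case using z by blast
qed

text \<open>
  The contour crosses the row of \<open>(i, 0)\<close> next to one of the \<open>l\<close> sites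
  \<open>(i - m, 0)\<close>, \<open>m < l\<close>: otherwise \<open>I\<close> would meet
  \<open>l + 1\<close> columns and have more than \<open>l\<close> boundary bonds. Through each
  of these bonds there are at most \<open>64 ^ l\<close> connected contours, and \<open>l \<le>
  2 ^ l\<close>.
\<close>

lemma card_contours_around:
  fixes i :: int
  defines "\<I> \<equiv> \<lambda>l. {I. finite I \<and> (i, 0) \<in> I \<and> card (boundary I) = l \<and>
     (\<forall>e\<in>boundary I. \<forall>f\<in>boundary I. chained (boundary I) e f)}"
  shows "finite (\<I> l) \<and> card (\<I> l) \<le> 128 ^ l"
proof -
  define \<K> where "\<K> e = {K. finite K \<and> e \<in> K \<and> (\<forall>f\<in>K. chained K e f) \<and> card K = l}" for e
  define X where "X = (\<Union>m<l. \<K> ((i - int m, 0), False))"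
  have \<K>: "finite (\<K> e)" "card (\<K> e) \<le> 64 ^ l" for e
    using card_connected_contours[of e l] by (auto simp: \<K>_def)
  have sub: "boundary ` \<I> l \<subseteq> X"
  proof (rule subsetI)
    fix K assume "K \<in> boundary ` \<I> l"
    then obtain I where I: "finite I" "(i, 0) \<in> I" "card K = l" and K: "K = boundary I"
      and ch: "\<And>e f. e \<in> K \<Longrightarrow> f \<in> K \<Longrightarrow> chained K e f"
      unfolding \<I>_def by blast
    have "\<exists>m<l. ((i - int m, 0), False) \<in> K"
    proof (rule ccontr)
      assume none: "\<not> (\<exists>m<l. ((i - int m, 0), False) \<in> K)"
      have "m \<le> l \<Longrightarrow> (i - int m, 0) \<in> I" for m
      proof (induction m)
        case (Suc m)
        have e: "i - int m - 1 = i - int (Suc m)" by simp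
        have "(i - int m, 0) \<in> I \<longleftrightarrow> (i - int m - 1, 0) \<in> I"
          using none Suc.prems unfolding K horizontal_in_boundary by auto
        then show ?case using Suc unfolding e by simp
      qed (simp add: I)
      then have "\<exists>v. (u, v) \<in> I" if "u \<in> {i - int l..i}" for u
        using that spec[of "\<lambda>m. m \<le> l \<longrightarrow> (i - int m, 0) \<in> I" "nat (i - u)"] by auto
      then have "card {i - int l..i} \<le> card (boundary I)"
        by (rule card_boundary_ge_columns[OF I(1)])
      then show False using I(3) by (simp add: K)
    qed
    then show "K \<in> X" unfolding X_def \<K>_def using I ch finite_boundary[OF I(1)] K by blast
  qed
  have X: "finite X" unfolding X_def using \<K> by blast
  have inj: "inj_on boundary (\<I> l)"
    by (rule inj_on_subset[OF inj_on_boundary]) (auto simp: \<I>_def)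
  have "card (\<I> l) = card (boundary ` \<I> l)" by (rule card_image[OF inj, symmetric])
  also have "\<dots> \<le> card X" by (rule card_mono[OF X sub])
  also have "\<dots> \<le> (\<Sum>m<l. card (\<K> ((i - int m, 0), False)))"
    unfolding X_def by (rule card_UN_le) simp
  also have "\<dots> \<le> (\<Sum>m<l. 64 ^ l)" by (rule sum_mono) (rule \<K>)
  also have "\<dots> = l * 64 ^ l" by simp
  also have "\<dots> \<le> 2 ^ l * 64 ^ l" by (intro mult_right_mono) (simp_all add: less_imp_le)
  also have "\<dots> = (2 * 64) ^ l" by (rule power_mult_distrib[symmetric])
  finally have "card (\<I> l) \<le> 128 ^ l" by simp
  moreover have "finite (\<I> l)"
    using finite_subset[OF sub X] inj by (rule finite_imageD)
  ultimately show ?thesis by blast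
qed

lemma flip_contour:
  assumes A: "finite A" and I: "finite I" "boundary I \<subseteq> boundary A"
  shows "weight \<beta> A = exp (- 2 * \<beta> * real (card (boundary I))) * weight \<beta> ((A - I) \<union> (I - A))"
proof -
  have "boundary ((A - I) \<union> (I - A)) = boundary A - boundary I"
    unfolding boundary_sym_diff using I by blast
  then have "card (boundary A) = card (boundary I) + card (boundary ((A - I) \<union> (I - A)))"
    using card_Diff_subset[OF finite_boundary[OF I(1)] I(2)] card_mono[OF finite_boundary[OF A] I(2)]
    by simp
  then show ?thesis unfolding weight_def by (simp add: exp_add[symmetric] algebra_simps)
qed

lemma finite_square [simp]: "finite (square n)"
  by (simp add: square_def)

lemma sum_UN_le:
  fixes f :: "'b \<Rightarrow> real"
  assumes "finite C" "\<And>i. i \<in> C \<Longrightarrow> finite (F i)" "\<And>x. 0 \<le> f x"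
  shows "sum f (\<Union>i\<in>C. F i) \<le> (\<Sum>i\<in>C. sum f (F i))"
  using assms(1,2)
proof (induction C rule: finite_induct)
  case (insert i C)
  have "sum f (F i \<union> (\<Union>j\<in>C. F j)) \<le> sum f (F i) + sum f (\<Union>j\<in>C. F j)"
    using insert by (subst sum_Un) (auto simp: assms(3) sum_nonneg)
  also have "\<dots> \<le> sum f (F i) + (\<Sum>j\<in>C. sum f (F j))" using insert by simp
  finally show ?case using insert(1,2) by simp
qed simp

text \<open>
  A single connected contour in the boundary of \<open>A\<close> surrounds the whole minus path
  from \<open>(i, 0)\<close> to \<open>(j, 0)\<close>, hence has a bond above each of the
  \<open>\<bar>i - j\<bar> + 1\<close> columns in between. Flipping the spins inside it is
  injective and gains a factor \<open>exp (2 * \<beta>)\<close> per bond, while there are at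
  most \<open>128 ^ l\<close> contours with \<open>l\<close> bonds. The hypothesis makes the
  ratio of the resulting geometric series at most one half.
\<close>

lemma peierls:
  assumes \<beta>: "256 * exp (- 2 * \<beta>) \<le> 1"
  shows "(\<Sum>A | A \<subseteq> square n \<and> ((i, 0) \<in> A \<and> linked A (i, 0) (j, 0)). weight \<beta> A)
     \<le> (128 * exp (- 2 * \<beta>)) ^ nat \<bar>i - j\<bar> * ising_sum \<beta> (square n) {}"
proof -
  define d where "d = nat \<bar>i - j\<bar>"
  define x where "x = 128 * exp (- 2 * \<beta>)"
  define \<I> where "\<I> l = {I. finite I \<and> (i, 0) \<in> I \<and> card (boundary I) = l \<and>
     (\<forall>e\<in>boundary I. \<forall>f\<in>boundary I. chained (boundary I) e f)}" for l
  have \<I>: "finite (\<I> l)" "card (\<I> l) \<le> 128 ^ l" for l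
    using card_contours_around[of i l] by (auto simp: \<I>_def)
  define \<C> where "\<C> = {I. I \<subseteq> square n \<and> (\<exists>l>d. I \<in> \<I> l)}"
  have fin\<C>: "finite \<C>" by (rule finite_subset[of _ "Pow (square n)"]) (auto simp: \<C>_def)
  define L where "L = Suc (d + (\<Sum>I\<in>\<C>. card (boundary I)))"
  define E where "E = {A. A \<subseteq> square n \<and> ((i, 0) \<in> A \<and> linked A (i, 0) (j, 0))}"
  define F where "F I = {A. A \<subseteq> square n \<and> boundary I \<subseteq> boundary A}" for I
  have finE: "finite E" and finF: "finite (F I)" for I
    by (auto simp: E_def F_def intro: finite_subset[of _ "Pow (square n)"])
  have sub: "E \<subseteq> (\<Union>I\<in>\<C>. F I)"
  proof (rule subsetI)
    fix A assume "A \<in> E"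
    then have A: "A \<subseteq> square n" "(i, 0) \<in> A" "linked A (i, 0) (j, 0)" by (auto simp: E_def)
    have finA: "finite A" using finite_subset[OF A(1)] by simp
    obtain I where I: "finite I" "(i, 0) \<in> I" "boundary I \<subseteq> boundary A"
      "\<And>e f. e \<in> boundary I \<Longrightarrow> f \<in> boundary I \<Longrightarrow> chained (boundary I) e f"
      using connected_contour_around[OF finA A(2)] by blast
    have cols: "\<exists>v. (u, v) \<in> I" if "u \<in> {min i j..max i j}" for u
    proof -
      have "i \<le> u \<and> u \<le> j \<or> j \<le> u \<and> u \<le> i" using that by auto
      then show ?thesis using linked_columns[OF A(3,2) I(2,3)] unfolding fst_conv by blast
    qed
    have "d < card {min i j..max i j}" by (auto simp: d_def)
    also have "\<dots> \<le> card (boundary I)" by (rule card_boundary_ge_columns[OF I(1) cols])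
    finally have "I \<in> \<C>"
      unfolding \<C>_def \<I>_def using I contour_inside_square[OF I(1,3) A(1)] by blast
    then show "A \<in> (\<Union>I\<in>\<C>. F I)" using I(3) A(1) by (auto simp: F_def)
  qed
  \<comment> \<open>the flip of the spins in \<open>I\<close> maps \<open>F I\<close> injectively into the configurations on the square\<close>
  have one: "sum (weight \<beta>) (F I) \<le> exp (- 2 * \<beta> * real (card (boundary I))) * ising_sum \<beta> (square n) {}"
    if I: "I \<in> \<C>" for I
  proof -
    let ?flip = "\<lambda>A. (A - I) \<union> (I - A)"
    have I': "I \<subseteq> square n" "finite I" using I by (auto simp: \<C>_def \<I>_def)
    have "sum (weight \<beta>) (F I)
        = (\<Sum>A\<in>F I. exp (- 2 * \<beta> * real (card (boundary I))) * weight \<beta> (?flip A))"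
    proof (rule sum.cong[OF refl])
      fix A assume "A \<in> F I"
      then have "finite A" "boundary I \<subseteq> boundary A"
        by (auto simp: F_def intro: finite_subset[OF _ finite_square])
      then show "weight \<beta> A = exp (- 2 * \<beta> * real (card (boundary I))) * weight \<beta> (?flip A)"
        by (rule flip_contour[OF _ I'(2)])
    qed
    also have "\<dots> = exp (- 2 * \<beta> * real (card (boundary I))) * (\<Sum>A\<in>?flip ` F I. weight \<beta> A)"
    proof -
      have "inj_on ?flip (F I)" by (rule inj_onI) blast
      then show ?thesis by (simp add: sum.reindex sum_distrib_left)
    qed
    also have "(\<Sum>A\<in>?flip ` F I. weight \<beta> A) \<le> (\<Sum>A\<in>Pow (square n). weight \<beta> A)"
      using I' by (intro sum_mono2) (auto simp: F_def)
    finally show ?thesis by (simp add: ising_sum_def mult_left_mono)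
  qed
  have "sum (weight \<beta>) E \<le> sum (weight \<beta>) (\<Union>I\<in>\<C>. F I)"
    using sub fin\<C> finF by (intro sum_mono2) auto
  also have "\<dots> \<le> (\<Sum>I\<in>\<C>. sum (weight \<beta>) (F I))"
    by (rule sum_UN_le) (use fin\<C> finF in auto)
  also have "\<dots> \<le> (\<Sum>I\<in>\<C>. exp (- 2 * \<beta> * real (card (boundary I))) * ising_sum \<beta> (square n) {})"
    by (rule sum_mono) (rule one)
  also have "\<dots> = (\<Sum>I\<in>\<C>. exp (- 2 * \<beta>) ^ card (boundary I)) * ising_sum \<beta> (square n) {}"
    unfolding sum_distrib_right
    by (intro sum.cong refl) (simp add: exp_of_nat_mult[symmetric] mult_ac)
  also have "\<dots> \<le> x ^ d * ising_sum \<beta> (square n) {}"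
  proof (rule mult_right_mono)
    have card_in: "card (boundary I) \<in> {Suc d..L}" if "I \<in> \<C>" for I
    proof -
      have "card (boundary I) \<le> (\<Sum>I\<in>\<C>. card (boundary I))"
        by (rule member_le_sum[OF that]) (use fin\<C> in auto)
      then show ?thesis using that by (auto simp: \<C>_def \<I>_def L_def)
    qed
    have "(\<Sum>I\<in>\<C>. exp (- 2 * \<beta>) ^ card (boundary I))
        = (\<Sum>l=Suc d..L. \<Sum>I | I \<in> \<C> \<and> card (boundary I) = l. exp (- 2 * \<beta>) ^ card (boundary I))"
      by (rule sum.group[symmetric]) (use fin\<C> card_in in auto)
    also have "\<dots> \<le> (\<Sum>l=Suc d..L. x ^ l)"
    proof (rule sum_mono)
      fix l
      have "(\<Sum>I | I \<in> \<C> \<and> card (boundary I) = l. exp (- 2 * \<beta>) ^ card (boundary I))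
          = real (card {I \<in> \<C>. card (boundary I) = l}) * exp (- 2 * \<beta>) ^ l"
        by simp
      also have "card {I \<in> \<C>. card (boundary I) = l} \<le> card (\<I> l)"
        by (rule card_mono[OF \<I>(1)]) (auto simp: \<C>_def \<I>_def)
      then have "real (card {I \<in> \<C>. card (boundary I) = l}) \<le> 128 ^ l"
        using \<I>(2)[of l] by (metis (mono_tags) of_nat_le_iff of_nat_numeral of_nat_power order_trans)
      then have "real (card {I \<in> \<C>. card (boundary I) = l}) * exp (- 2 * \<beta>) ^ l \<le> 128 ^ l * exp (- 2 * \<beta>) ^ l"
        by (intro mult_right_mono) auto
      finally show "(\<Sum>I | I \<in> \<C> \<and> card (boundary I) = l. exp (- 2 * \<beta>) ^ card (boundary I)) \<le> x ^ l"
        by (simp add: x_def power_mult_distrib)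
    qed
    also have "\<dots> \<le> x ^ d"
    proof -
      have x: "0 \<le> x" "2 * x \<le> 1" using \<beta> by (auto simp: x_def)
      \<comment> \<open>for \<open>2 * x \<le> 1\<close> each term is at most half of the previous one, so the last term is left over\<close>
      have "(\<Sum>l=Suc d..m. x ^ l) + x ^ max d m \<le> x ^ d" for m
      proof (induction m)
        case (Suc m)
        show ?case
        proof (cases "d \<le> m")
          case True
          have "2 * x * x ^ m \<le> 1 * x ^ m" using x by (intro mult_right_mono) auto
          then show ?thesis using Suc True by (simp add: max_def)
        next
          case False
          then show ?thesis by (cases "d = Suc m") (auto simp: max_def)
        qed
      qed simp
      from this[of L] show ?thesis using zero_le_power[OF x(1), of "max d L"] by linarith
    qed
    finally show "(\<Sum>I\<in>\<C>. exp (- 2 * \<beta>) ^ card (boundary I)) \<le> x ^ d" .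
  qed (simp add: less_imp_le ising_sum_pos)
  finally show ?thesis by (simp add: E_def x_def d_def)
qed

section \<open>Infinite-volume weights on the layer\<close>

definition on_layer :: "int set \<Rightarrow> (int \<times> int) set" where
  "on_layer I = (\<lambda>i. (i, 0)) ` I"

text \<open>
  The spins off the layer. Minus spins on the layer enter as prescribed spins.
\<close>

definition bulk :: "nat \<Rightarrow> (int \<times> int) set" where
  "bulk n = {z \<in> square n. snd z \<noteq> 0}"

definition layer_weight_in :: "real \<Rightarrow> (int \<times> int) set \<Rightarrow> int set \<Rightarrow> real" where
  "layer_weight_in \<beta> \<Lambda> I = ising_sum \<beta> \<Lambda> (on_layer I) / ising_sum \<beta> \<Lambda> {}"

definition layer_weight :: "real \<Rightarrow> int set \<Rightarrow> real" where
  "layer_weight \<beta> I = lim (\<lambda>n. layer_weight_in \<beta> (bulk n) I)"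

lemma on_layer_simps [simp]:
  "on_layer {} = {}" "on_layer (insert i I) = insert (i, 0) (on_layer I)"
  "on_layer (I \<union> J) = on_layer I \<union> on_layer J" "(i, 0) \<in> on_layer I \<longleftrightarrow> i \<in> I"
  by (auto simp: on_layer_def)

lemma on_layer_Int: "on_layer (I \<inter> J) = on_layer I \<inter> on_layer J"
  by (auto simp: on_layer_def)

lemma finite_on_layer [simp]: "finite I \<Longrightarrow> finite (on_layer I)"
  by (simp add: on_layer_def)

lemma card_on_layer [simp]: "card (on_layer I) = card I"
  unfolding on_layer_def by (rule card_image) (auto simp: inj_on_def)

lemma finite_bulk [simp]: "finite (bulk n)"
  by (simp add: bulk_def)

lemma bulk_on_layer: "bulk n \<inter> on_layer I = {}"
  by (auto simp: bulk_def on_layer_def)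

lemma bulk_mono: "m \<le> n \<Longrightarrow> bulk m \<subseteq> bulk n"
  by (auto simp: bulk_def square_def)

lemma layer_weight_in_pos: "finite \<Lambda> \<Longrightarrow> 0 < layer_weight_in \<beta> \<Lambda> I"
  unfolding layer_weight_in_def by (intro divide_pos_pos ising_sum_pos)

text \<open>
  Enlarging the region turns plus spins into free ones, which favours minus spins on the layer.
  So the infinite-volume limit exists by monotonicity, without passing to subsequences.
\<close>

lemma layer_weight_in_mono:
  assumes "finite T" "S \<subseteq> T" "T \<inter> on_layer I = {}" "finite I" "0 \<le> \<beta>"
  shows "layer_weight_in \<beta> S I \<le> layer_weight_in \<beta> T I"
proof -
  have "ising_sum \<beta> S (on_layer I)
      * ising_sum \<beta> T {} \<le> ising_sum \<beta> T (on_layer I \<union> {})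
      * ising_sum \<beta> S (on_layer I \<inter> {})"
    by (rule ising_sum_correlation_plain) (use assms in auto)
  moreover have "0 < ising_sum \<beta> S {}" "0 < ising_sum \<beta> T {}"
    using assms finite_subset[of S T] by (auto intro!: ising_sum_pos)
  ultimately show ?thesis by (simp add: layer_weight_in_def divide_simps mult_ac)
qed

lemma layer_weight_in_le:
  assumes "finite \<Lambda>" "finite I" "0 \<le> \<beta>"
  shows "layer_weight_in \<beta> \<Lambda> I \<le> exp (8 * \<beta> * real (card I))"
proof -
  have p: "0 < ising_sum \<beta> \<Lambda> {}" using assms by (intro ising_sum_pos)
  have b: "ising_sum \<beta> \<Lambda> (on_layer I) \<le> exp (8 * \<beta> * real (card I)) * ising_sum \<beta> \<Lambda> {}"
    "ising_sum \<beta> \<Lambda> {} \<le> exp (8 * \<beta> * real (card I)) * ising_sum \<beta> \<Lambda> (on_layer I)"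
    using ising_sum_Un_bounds[OF assms(1) _ finite_on_layer[OF assms(2)] assms(3), of "{}"] by simp_all
  show "layer_weight_in \<beta> \<Lambda> I \<le> exp (8 * \<beta> * real (card I))"
    using b(1) p by (simp add: layer_weight_in_def divide_simps)
qed

lemma layer_weight_limit:
  assumes "finite I" "0 \<le> \<beta>"
  shows "(\<lambda>n. layer_weight_in \<beta> (bulk n) I) \<longlonglongrightarrow> layer_weight \<beta> I"
proof -
  have "incseq (\<lambda>n. layer_weight_in \<beta> (bulk n) I)"
    by (intro incseq_SucI layer_weight_in_mono bulk_mono finite_bulk bulk_on_layer assms) simp
  then obtain L where "(\<lambda>n. layer_weight_in \<beta> (bulk n) I) \<longlonglongrightarrow> L"
    using incseq_convergent layer_weight_in_le[OF finite_bulk assms] by metis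
  then show ?thesis unfolding layer_weight_def by (simp add: limI)
qed

lemma layer_weight_in_le_limit:
  assumes "finite I" "0 \<le> \<beta>"
  shows "layer_weight_in \<beta> (bulk n) I \<le> layer_weight \<beta> I"
  by (rule incseq_le[OF incseq_SucI layer_weight_limit[OF assms]])
     (intro layer_weight_in_mono bulk_mono finite_bulk bulk_on_layer assms, simp)

lemma layer_weight_pos: "finite I \<Longrightarrow> 0 \<le> \<beta> \<Longrightarrow> 0 < layer_weight \<beta> I"
  using layer_weight_in_le_limit[of I \<beta> 0] layer_weight_in_pos[OF finite_bulk, of \<beta> 0 I] by linarith

lemma layer_weight_empty [simp]: "layer_weight \<beta> {} = 1"
proof -
  have "layer_weight_in \<beta> (bulk n) {} = 1" for n
    using ising_sum_pos[OF finite_bulk, of \<beta> n "{}"] by (simp add: layer_weight_in_def)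
  then show ?thesis by (simp add: layer_weight_def)
qed

lemma layer_weight_le: "finite I \<Longrightarrow> 0 \<le> \<beta> \<Longrightarrow> layer_weight \<beta> I \<le> exp (8 * \<beta> * real (card I))"
  by (rule LIMSEQ_le_const2[OF layer_weight_limit]) (auto intro!: exI[of _ 0] layer_weight_in_le)

lemma layer_weight_insert:
  assumes "finite I" "0 \<le> \<beta>"
  shows "layer_weight \<beta> (insert m I) \<le> exp (8 * \<beta>) * layer_weight \<beta> I"
    and "layer_weight \<beta> I \<le> exp (8 * \<beta>) * layer_weight \<beta> (insert m I)"
proof -
  have b: "layer_weight_in \<beta> (bulk n) (insert m I) \<le> exp (8 * \<beta>) * layer_weight_in \<beta> (bulk n) I"
    "layer_weight_in \<beta> (bulk n) I \<le> exp (8 * \<beta>) * layer_weight_in \<beta> (bulk n) (insert m I)" for n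
  proof -
    have p: "0 < ising_sum \<beta> (bulk n) {}" by (intro ising_sum_pos) simp
    note ising_sum_Un_bounds[OF finite_bulk finite_on_layer[OF assms(1)] _ assms(2), of "{(m, 0)}" n]
    then show "layer_weight_in \<beta> (bulk n) (insert m I) \<le> exp (8 * \<beta>) * layer_weight_in \<beta> (bulk n) I"
      "layer_weight_in \<beta> (bulk n) I \<le> exp (8 * \<beta>) * layer_weight_in \<beta> (bulk n) (insert m I)"
      using p by (simp_all add: layer_weight_in_def divide_simps)
  qed
  note lim = layer_weight_limit[OF assms] layer_weight_limit[OF finite.insertI[OF assms(1)] assms(2)]
  show "layer_weight \<beta> (insert m I) \<le> exp (8 * \<beta>) * layer_weight \<beta> I"
    by (rule LIMSEQ_le[OF lim(2) tendsto_mult_left[OF lim(1)]]) (use b in auto)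
  show "layer_weight \<beta> I \<le> exp (8 * \<beta>) * layer_weight \<beta> (insert m I)"
    by (rule LIMSEQ_le[OF lim(1) tendsto_mult_left[OF lim(2)]]) (use b in auto)
qed

text \<open>
  Attractiveness survives the summation over the bulk.
\<close>

lemma layer_weight_supermodular:
  assumes "finite I" "finite J" "0 \<le> \<beta>"
  shows "layer_weight \<beta> I * layer_weight \<beta> J \<le> layer_weight \<beta> (I \<union> J) * layer_weight \<beta> (I \<inter> J)"
proof -
  have fin: "finite (I \<union> J)" "finite (I \<inter> J)" using assms by auto
  have "layer_weight_in \<beta> (bulk n) I * layer_weight_in \<beta> (bulk n) J
      \<le> layer_weight_in \<beta> (bulk n) (I \<union> J) * layer_weight_in \<beta> (bulk n) (I \<inter> J)" for n
  proof -
    have "0 < ising_sum \<beta> (bulk n) {}" by (intro ising_sum_pos) simp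
    moreover have "ising_sum \<beta> (bulk n) (on_layer I) * ising_sum \<beta> (bulk n) (on_layer J)
       \<le> ising_sum \<beta> (bulk n) (on_layer I \<union> on_layer J) * ising_sum \<beta> (bulk n) (on_layer I \<inter> on_layer J)"
      by (rule ising_sum_correlation_plain) (use assms bulk_on_layer[of n "I \<union> J"] in auto)
    ultimately show ?thesis unfolding layer_weight_in_def on_layer_Int
      by (simp add: divide_right_mono)
  qed
  then show ?thesis
    by (intro LIMSEQ_le[OF tendsto_mult[OF layer_weight_limit layer_weight_limit]
          tendsto_mult[OF layer_weight_limit layer_weight_limit]])
       (use assms fin in auto)
qed

definition shift :: "int \<Rightarrow> int \<times> int \<Rightarrow> int \<times> int" where
  "shift k z = (fst z + k, snd z)"

lemma inj_shift: "inj (shift k)"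
  by (auto simp: inj_def shift_def prod_eq_iff)

lemma in_shift_image: "z \<in> shift k ` A \<longleftrightarrow> (fst z - k, snd z) \<in> A"
  by (force simp: shift_def image_iff)

lemma weight_shift: "weight \<beta> (shift k ` A) = weight \<beta> A"
proof -
  let ?s = "\<lambda>e :: (int \<times> int) \<times> bool. (shift k (fst e), snd e)"
  have diff_right: "u - k - 1 = u - 1 - k" for u by simp
  have "boundary (shift k ` A) = ?s ` boundary A"
  proof (rule set_eqI)
    fix e :: "(int \<times> int) \<times> bool"
    obtain u v b where e: "e = ((u, v), b)" by (metis prod.exhaust)
    have "e \<in> ?s ` boundary A \<longleftrightarrow> ((u - k, v), b) \<in> boundary A"
      unfolding e by (force simp: shift_def image_iff)
    also have "\<dots> \<longleftrightarrow> e \<in> boundary (shift k ` A)"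
      using diff_right unfolding e by (cases b) (simp_all only: horizontal_in_boundary vertical_in_boundary
          in_shift_image fst_conv snd_conv)
    finally show "e \<in> boundary (shift k ` A) \<longleftrightarrow> e \<in> ?s ` boundary A" by simp
  qed
  moreover have "inj_on ?s (boundary A)" by (auto simp: inj_on_def shift_def)
  ultimately show ?thesis by (simp add: weight_def card_image)
qed

lemma ising_sum_shift: "ising_sum \<beta> (shift k ` \<Lambda>) (shift k ` B) = ising_sum \<beta> \<Lambda> B"
proof -
  have "Pow (shift k ` \<Lambda>) = (`) (shift k) ` Pow \<Lambda>"
    by (rule image_Pow_surj[symmetric]) simp
  moreover have "inj_on ((`) (shift k)) (Pow \<Lambda>)"
    using inj_shift by (auto simp: inj_on_def inj_image_eq_iff)
  ultimately show ?thesis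
    unfolding ising_sum_def by (simp add: sum.reindex image_Un[symmetric] weight_shift)
qed

text \<open>
  A shifted square is contained in a larger centred one, so monotonicity in the region gives one
  inequality, and the opposite shift gives the other.
\<close>

lemma layer_weight_shift:
  assumes "finite I" "0 \<le> \<beta>"
  shows "layer_weight \<beta> ((\<lambda>i. i + k) ` I) = layer_weight \<beta> I"
proof -
  have le: "layer_weight \<beta> ((\<lambda>i. i + k) ` I) \<le> layer_weight \<beta> I" if I: "finite I" for I k
  proof (rule LIMSEQ_le_const2[OF layer_weight_limit[OF finite_imageI[OF I] assms(2)]],
      intro exI allI impI)
    fix n :: nat
    let ?S = "shift (- k) ` bulk n"
    have S: "?S \<subseteq> bulk (n + nat \<bar>k\<bar>)"
      by (auto simp: bulk_def square_def shift_def)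
    have "on_layer ((\<lambda>i. i + k) ` I) = shift k ` on_layer I"
      by (auto simp: on_layer_def shift_def image_iff)
    moreover have "bulk n = shift k ` ?S"
      unfolding image_image by (simp add: shift_def)
    ultimately have "layer_weight_in \<beta> (bulk n) ((\<lambda>i. i + k) ` I) = layer_weight_in \<beta> ?S I"
      using ising_sum_shift[of \<beta> k ?S "on_layer I"] ising_sum_shift[of \<beta> k ?S "{}"]
      by (simp add: layer_weight_in_def)
    also have "\<dots> \<le> layer_weight_in \<beta> (bulk (n + nat \<bar>k\<bar>)) I"
      by (intro layer_weight_in_mono S finite_bulk bulk_on_layer I assms)
    also have "\<dots> \<le> layer_weight \<beta> I" by (intro layer_weight_in_le_limit I assms)
    finally show "layer_weight_in \<beta> (bulk n) ((\<lambda>i. i + k) ` I) \<le> layer_weight \<beta> I" .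
  qed
  have "layer_weight \<beta> ((\<lambda>i. i + - k) ` ((\<lambda>i. i + k) ` I)) \<le> layer_weight \<beta> ((\<lambda>i. i + k) ` I)"
    by (intro le finite_imageI assms)
  then show ?thesis using le[OF assms(1), of k] by (simp add: image_image)
qed

section \<open>Decay of correlations along the layer\<close>

text \<open>
  The spins in \<open>F\<close> are summed over, those in \<open>K\<close> are minus, and all
  others on the layer are plus.
\<close>

definition free_weight :: "real \<Rightarrow> int set \<Rightarrow> int set \<Rightarrow> real" where
  "free_weight \<beta> F K = (\<Sum>J\<in>Pow F. layer_weight \<beta> (J \<union> K))"

lemma free_weight_empty [simp]: "free_weight \<beta> {} K = layer_weight \<beta> K"
  by (simp add: free_weight_def)

lemma free_weight_insert:
  "finite F \<Longrightarrow> v \<notin> F \<Longrightarrow> free_weight \<beta> (insert v F) K = free_weight \<beta> F K + free_weight \<beta> F (insert v K)"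
  unfolding free_weight_def sum_Pow_insert by (simp add: sum.distrib)

lemma free_weight_pos: "finite F \<Longrightarrow> finite K \<Longrightarrow> 0 \<le> \<beta> \<Longrightarrow> 0 < free_weight \<beta> F K"
  unfolding free_weight_def
  by (intro sum_pos layer_weight_pos) (auto intro: finite_subset)

lemma ising_sum_free_layer:
  assumes "finite F" "finite \<Lambda>" "\<Lambda> \<inter> on_layer UNIV = {}"
  shows "ising_sum \<beta> (\<Lambda> \<union> on_layer F) B = (\<Sum>J\<in>Pow F. ising_sum \<beta> \<Lambda> (on_layer J \<union> B))"
  using assms(1)
proof (induction F arbitrary: B rule: finite_induct)
  case (insert v F)
  have "(v, 0) \<notin> \<Lambda> \<union> on_layer F"
    using assms(3) insert(2) by (auto simp: on_layer_def)
  then have "ising_sum \<beta> (insert (v, 0) (\<Lambda> \<union> on_layer F)) B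
     = ising_sum \<beta> (\<Lambda> \<union> on_layer F) B + ising_sum \<beta> (\<Lambda> \<union> on_layer F) (insert (v, 0) B)"
    using assms insert(1) by (intro ising_sum_insert_region) auto
  then show ?case
    unfolding sum_Pow_insert[OF insert(1,2)] using insert.IH by (simp add: sum.distrib)
qed simp

lemma free_weight_limit:
  assumes "finite F" "finite K" "0 \<le> \<beta>"
  shows "(\<lambda>n. ising_sum \<beta> (bulk n \<union> on_layer F) (on_layer K) / ising_sum \<beta> (bulk n) {}) \<longlonglongrightarrow> free_weight \<beta> F K"
proof -
  have "ising_sum \<beta> (bulk n \<union> on_layer F) (on_layer K) / ising_sum \<beta> (bulk n) {}
      = (\<Sum>J\<in>Pow F. layer_weight_in \<beta> (bulk n) (J \<union> K))" for n
    unfolding ising_sum_free_layer[OF assms(1) finite_bulk bulk_on_layer]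
    by (simp add: layer_weight_in_def sum_divide_distrib)
  moreover have "(\<lambda>n. \<Sum>J\<in>Pow F. layer_weight_in \<beta> (bulk n) (J \<union> K)) \<longlonglongrightarrow> free_weight \<beta> F K"
    unfolding free_weight_def
    by (intro tendsto_sum layer_weight_limit) (use assms finite_subset in auto)
  ultimately show ?thesis by simp
qed

text \<open>
  Decay of correlations along the layer; this is where low temperature enters. At distance
  \<open>d\<close> the prescribed minus spins cost at most \<open>exp (16 * \<beta> * d /
  9)\<close>, and by \<open>peierls\<close> a minus path between the sites has probability at
  most \<open>(128 * exp (- 2 * \<beta>)) ^ d\<close>. Since \<open>16 / 9 < 2\<close>, the
  product is \<open>(128 * exp (- 2 * \<beta> / 9)) ^ d\<close>, which is at most \<open>(1 / 2)
  ^ d\<close> once \<open>exp (2 * \<beta> / 9) \<ge> 256\<close>.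
\<close>

lemma free_weight_pair_le:
  assumes \<beta>: "36 \<le> \<beta>" and fin: "finite F" "finite K"
    and disj: "F \<inter> K = {}" "i \<notin> F \<union> K" "j \<notin> F \<union> K" "i \<noteq> j"
    and few: "9 * card K \<le> nat \<bar>i - j\<bar>"
  shows "free_weight \<beta> F (insert i (insert j K)) * free_weight \<beta> F K
     \<le> (1 + 16 * exp (32 * \<beta>) * (1 / 2) ^ nat \<bar>i - j\<bar>)
         * (free_weight \<beta> F (insert i K)
         * free_weight \<beta> F (insert j K))"
proof -
  define d where "d = nat \<bar>i - j\<bar>"
  define C where "C = 16 * exp (32 * \<beta>)"
  \<comment> \<open>\<open>\<beta> \<ge> 36\<close> gives \<open>exp (2 * \<beta> / 9) \<ge> exp 8 \<ge> 2 ^ 8\<close>\<close>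
  have e8: "256 \<le> exp (2 * \<beta> / 9)"
  proof -
    have "(2::real) ^ 8 \<le> exp 1 ^ 8"
      using exp_ge_add_one_self[of 1] by (intro power_mono) auto
    also have "\<dots> = exp 8" by (simp add: exp_of_nat_mult[symmetric])
    also have "\<dots> \<le> exp (2 * \<beta> / 9)" using \<beta> by simp
    finally show ?thesis by simp
  qed
  have small: "128 * exp (- 2 * \<beta>) * exp (16 * \<beta> / 9) \<le> 1 / 2"
  proof -
    have "exp (- 2 * \<beta>) * exp (16 * \<beta> / 9) = inverse (exp (2 * \<beta> / 9))"
      by (simp add: exp_add[symmetric] exp_minus[symmetric] algebra_simps)
    also have "\<dots> \<le> 1 / 256" using e8 by (simp add: inverse_eq_divide divide_simps)
    finally show ?thesis by simp
  qed
  have p256: "256 * exp (- 2 * \<beta>) \<le> 1"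
  proof -
    have "exp (2 * \<beta> / 9) \<le> exp (2 * \<beta>)" using \<beta> by simp
    then have "256 \<le> exp (2 * \<beta>)" using e8 by linarith
    then show ?thesis by (simp add: exp_minus divide_simps)
  qed
  have bound: "ising_sum \<beta> (bulk n \<union> on_layer F) (on_layer (insert i (insert j K)))
      * ising_sum \<beta> (bulk n \<union> on_layer F) (on_layer K)
     \<le> (1 + C * (1 / 2) ^ d)
         * (ising_sum \<beta> (bulk n \<union> on_layer F) (on_layer (insert i K))
         * ising_sum \<beta> (bulk n \<union> on_layer F) (on_layer (insert j K)))"
    if n: "\<forall>v\<in>insert i (insert j F). \<bar>v\<bar> \<le> int n" for n
  proof -
    let ?\<Lambda> = "bulk n \<union> on_layer F" and ?\<pi> = "(128 * exp (- 2 * \<beta>)) ^ d"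
    have notin: "(v, 0) \<notin> bulk n" for v by (simp add: bulk_def)
    have sq: "insert (i, 0) (insert (j, 0) ?\<Lambda>) \<subseteq> square n"
      using n by (auto simp: bulk_def square_def on_layer_def abs_le_iff)
    have d: "insert (i, 0) (insert (j, 0) ?\<Lambda>) \<inter> on_layer K = {}"
      using disj bulk_on_layer[of n K] by (auto simp: on_layer_def)
    have "ising_sum \<beta> ?\<Lambda> (insert (i, 0) (insert (j, 0) (on_layer K))) * ising_sum \<beta> ?\<Lambda> (on_layer K)
      \<le> (1 + 16 * exp (32 * \<beta>) * exp (16 * \<beta> * real (card (on_layer K))) * ?\<pi>)
        * (ising_sum \<beta> ?\<Lambda> (insert (i, 0) (on_layer K)) * ising_sum \<beta> ?\<Lambda> (insert (j, 0) (on_layer K)))"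
      by (rule ising_sum_pair_le[OF _ _ _ _ _ d finite_square sq])
         (use fin disj notin \<beta> peierls[OF p256, of n i j] in \<open>auto simp: d_def\<close>)
    also have "\<dots> \<le> (1 + C * (1 / 2) ^ d)
        * (ising_sum \<beta> ?\<Lambda> (insert (i, 0) (on_layer K))
        * ising_sum \<beta> ?\<Lambda> (insert (j, 0) (on_layer K)))"
    proof (intro mult_right_mono add_left_mono)
      have "16 * \<beta> * real (card K) \<le> real d * (16 * \<beta> / 9)"
      proof -
        have "9 * real (card K) \<le> real d" using few unfolding d_def by linarith
        then have "16 * \<beta> / 9 * (9 * real (card K)) \<le> 16 * \<beta> / 9 * real d"
          using \<beta> by (intro mult_left_mono) auto
        then show ?thesis by (simp add: mult_ac)
      qed
      then have "exp (16 * \<beta> * real (card K)) \<le> exp (16 * \<beta> / 9) ^ d"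
        by (simp add: exp_of_nat_mult[symmetric])
      then have "exp (16 * \<beta> * real (card K)) * ?\<pi> \<le> exp (16 * \<beta> / 9) ^ d * ?\<pi>"
        by (intro mult_right_mono) auto
      also have "\<dots> = (128 * exp (- 2 * \<beta>) * exp (16 * \<beta> / 9)) ^ d"
        by (simp add: power_mult_distrib mult_ac)
      also have "\<dots> \<le> (1 / 2) ^ d" by (rule power_mono[OF small]) simp
      finally show "16 * exp (32 * \<beta>) * exp (16 * \<beta> * real (card (on_layer K))) * ?\<pi> \<le> C * (1 / 2) ^ d"
        by (simp add: C_def mult.assoc)
    qed (use fin in \<open>auto intro!: mult_nonneg_nonneg less_imp_le[OF ising_sum_pos] simp del: zero_le_mult_iff\<close>)
    finally show ?thesis by simp
  qed
  let ?r = "\<lambda>n B. ising_sum \<beta> (bulk n \<union> on_layer F) (on_layer B) / ising_sum \<beta> (bulk n) {}"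
  define N where "N = nat (Max (insert 0 (abs ` insert i (insert j F))))"
  have N: "\<forall>v\<in>insert i (insert j F). \<bar>v\<bar> \<le> int n" if "N \<le> n" for n
  proof
    fix v assume "v \<in> insert i (insert j F)"
    then have "\<bar>v\<bar> \<le> Max (insert 0 (abs ` insert i (insert j F)))"
      using fin by (intro Max_ge) auto
    then show "\<bar>v\<bar> \<le> int n" using that unfolding N_def by linarith
  qed
  have lim: "(\<lambda>n. ?r n B) \<longlonglongrightarrow> free_weight \<beta> F B" if "finite B" for B
    using free_weight_limit[OF fin(1) that] \<beta> by simp
  show ?thesis
    unfolding d_def[symmetric] C_def[symmetric]
  proof (rule LIMSEQ_le[OF tendsto_mult[OF lim lim] tendsto_mult_left[OF tendsto_mult[OF lim lim]]])
    show "\<exists>N. \<forall>n\<ge>N. ?r n (insert i (insert j K)) * ?r n K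
        \<le> (1 + C * (1 / 2) ^ d) * (?r n (insert i K) * ?r n (insert j K))"
    proof (intro exI[of _ N] allI impI)
      fix n assume "N \<le> n"
      from bound[OF N[OF this]] have "ising_sum \<beta> (bulk n \<union> on_layer F) (on_layer (insert i (insert j K)))
          * ising_sum \<beta> (bulk n \<union> on_layer F) (on_layer K) / (ising_sum \<beta> (bulk n) {}
          * ising_sum \<beta> (bulk n) {})
       \<le> (1 + C * (1 / 2) ^ d)
           * (ising_sum \<beta> (bulk n \<union> on_layer F) (on_layer (insert i K))
           * ising_sum \<beta> (bulk n \<union> on_layer F) (on_layer (insert j K))) / (ising_sum \<beta> (bulk n) {}
           * ising_sum \<beta> (bulk n) {})"
        by (rule divide_right_mono) (auto intro!: mult_nonneg_nonneg less_imp_le ising_sum_pos)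
      then show "?r n (insert i (insert j K)) * ?r n K
        \<le> (1 + C * (1 / 2) ^ d) * (?r n (insert i K) * ?r n (insert j K))"
        by simp
    qed
  qed (use fin in auto)
qed

lemma sum_half_powers_le:
  assumes "finite S" "\<And>v. v \<in> S \<Longrightarrow> D \<le> nat \<bar>m - v\<bar>"
  shows "(\<Sum>v\<in>S. (1 / 2 :: real) ^ nat \<bar>m - v\<bar>) \<le> 4 * (1 / 2) ^ D"
proof -
  have geo: "(\<Sum>k\<in>X. (1 / 2 :: real) ^ k) \<le> 2 * (1 / 2) ^ D" if "finite X" "\<And>k. k \<in> X \<Longrightarrow> D \<le> k" for X
  proof -
    have "(\<Sum>k\<in>X. (1 / 2 :: real) ^ k) \<le> (\<Sum>k=D..D + Max (insert 0 X). (1 / 2) ^ k)"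
    proof (rule sum_mono2)
      show "X \<subseteq> {D..D + Max (insert 0 X)}"
        using that Max_ge[of "insert 0 X"] by (auto simp: trans_le_add2)
    qed auto
    also have "\<dots> \<le> 2 * (1 / 2) ^ D"
    proof -
      have "(\<Sum>k=D..D + n. (1 / 2 :: real) ^ k) + (1 / 2) ^ (D + n) = 2 * (1 / 2) ^ D" for n
        by (induction n) auto
      then show ?thesis by (metis add_le_cancel_left add.right_neutral le_add_same_cancel1 zero_le_divide_1_iff zero_le_numeral zero_le_power)
    qed
    finally show ?thesis .
  qed
  have half: "(\<Sum>v\<in>X. (1 / 2 :: real) ^ nat \<bar>m - v\<bar>) \<le> 2 * (1 / 2) ^ D"
    if "X \<subseteq> S" "inj_on (\<lambda>v. nat \<bar>m - v\<bar>) X" for X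
  proof -
    have "(\<Sum>v\<in>X. (1 / 2 :: real) ^ nat \<bar>m - v\<bar>) = (\<Sum>k\<in>(\<lambda>v. nat \<bar>m - v\<bar>) ` X. (1 / 2) ^ k)"
      by (simp add: sum.reindex[OF that(2)])
    also have "\<dots> \<le> 2 * (1 / 2) ^ D"
      using that assms finite_subset[OF that(1) assms(1)] by (intro geo) auto
    finally show ?thesis .
  qed
  have "S = {v \<in> S. v \<le> m} \<union> {v \<in> S. m < v}" by auto
  then have "(\<Sum>v\<in>S. (1 / 2 :: real) ^ nat \<bar>m - v\<bar>)
     = (\<Sum>v\<in>{v \<in> S. v \<le> m} \<union> {v \<in> S. m < v}. (1 / 2) ^ nat \<bar>m - v\<bar>)" by simp
  also have "\<dots> = (\<Sum>v | v \<in> S \<and> v \<le> m. (1 / 2) ^ nat \<bar>m - v\<bar>) + (\<Sum>v | v \<in> S \<and> m < v. (1 / 2) ^ nat \<bar>m - v\<bar>)"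
    using assms by (intro sum.union_disjoint) auto
  also have "\<dots> \<le> 2 * (1 / 2) ^ D + 2 * (1 / 2) ^ D"
    by (intro add_mono half) (auto simp: inj_on_def)
  finally show ?thesis by simp
qed

text \<open>
  The relative weight of a minus spin at \<open>m\<close> when the spins in \<open>F\<close> are
  free is compared with the one when they are plus. Free them one at a time: by
  \<open>free_weight_pair_le\<close> a spin at \<open>v\<close> changes the relative weight by a
  factor of at most \<open>1 + C * (1 / 2) ^ \<bar>m - v\<bar>\<close>.
\<close>

lemma free_layer_influence:
  assumes \<beta>: "36 \<le> \<beta>" and fin: "finite F" "finite K"
    and disj: "F \<inter> K = {}" "m \<notin> F \<union> K"
    and few: "\<And>v. v \<in> F \<Longrightarrow> 9 * card K \<le> nat \<bar>m - v\<bar>"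
  shows "free_weight \<beta> F (insert m K) * layer_weight \<beta> K
    \<le> exp (16 * exp (32 * \<beta>) * (\<Sum>v\<in>F. (1 / 2) ^ nat \<bar>m - v\<bar>))
        * (free_weight \<beta> F K * layer_weight \<beta> (insert m K))"
  using fin(1) disj few
proof (induction F rule: finite_induct)
  case (insert v F)
  define C where "C = 16 * exp (32 * \<beta>)"
  define e where "e = C * (1 / 2) ^ nat \<bar>m - v\<bar>"
  define S where "S = C * (\<Sum>v\<in>F. (1 / 2) ^ nat \<bar>m - v\<bar>)"
  let ?G = "free_weight \<beta> F K" and ?Gm = "free_weight \<beta> F (insert m K)"
  let ?Gv = "free_weight \<beta> F (insert v K)" and ?Gmv = "free_weight \<beta> F (insert m (insert v K))"
  let ?g = "layer_weight \<beta> K" and ?gm = "layer_weight \<beta> (insert m K)"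
  have \<beta>0: "0 \<le> \<beta>" using \<beta> by simp
  have pos: "0 < ?G" "0 < ?Gm" "0 < ?Gv" "0 < ?Gmv" "0 < ?g" "0 < ?gm"
    using insert.hyps fin \<beta>0 by (auto intro!: free_weight_pos layer_weight_pos)
  have e: "0 \<le> e" by (simp add: e_def C_def)
  have IH: "?Gm * ?g \<le> exp S * (?G * ?gm)"
    using insert by (simp add: S_def C_def)
  have pair: "?Gmv * ?G \<le> (1 + e) * (?Gm * ?Gv)"
    using free_weight_pair_le[OF \<beta> insert.hyps(1) fin(2), of m v] insert by (auto simp: e_def C_def)
  have "(?Gmv * ?g) * ?G = (?Gmv * ?G) * ?g" by (simp only: mult_ac)
  also have "\<dots> \<le> ((1 + e) * (?Gm * ?Gv)) * ?g"
    using pair pos by (intro mult_right_mono) auto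
  also have "\<dots> = (1 + e) * ?Gv * (?Gm * ?g)" by (simp only: mult_ac)
  also have "\<dots> \<le> (1 + e) * ?Gv * (exp S * (?G * ?gm))"
    using IH pos e by (intro mult_left_mono) auto
  also have "\<dots> = ((1 + e) * exp S * (?Gv * ?gm)) * ?G" by (simp only: mult_ac)
  finally have A: "?Gmv * ?g \<le> (1 + e) * exp S * (?Gv * ?gm)"
    using pos(1) by (simp only: mult_le_cancel_right_pos)
  have "1 * (exp S * (?G * ?gm)) \<le> (1 + e) * (exp S * (?G * ?gm))"
    using pos e by (intro mult_right_mono) auto
  then have B: "?Gm * ?g \<le> (1 + e) * exp S * (?G * ?gm)"
    using IH unfolding mult.assoc[of "1 + e" "exp S"] mult_1 by (rule order_trans[rotated])
  have "(?Gm + ?Gmv) * ?g \<le> (1 + e) * exp S * ((?G + ?Gv) * ?gm)"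
    using A B by (simp add: algebra_simps)
  also have "\<dots> \<le> exp e * exp S * ((?G + ?Gv) * ?gm)"
    using pos exp_ge_add_one_self[of e] by (intro mult_right_mono) auto
  also have "exp e * exp S = exp (C * (\<Sum>v\<in>insert v F. (1 / 2) ^ nat \<bar>m - v\<bar>))"
    using insert.hyps by (simp add: e_def S_def exp_add[symmetric] distrib_left)
  finally show ?case
    using insert.hyps by (simp add: free_weight_insert C_def insert_commute)
qed simp

text \<open>
  The same comparison when the spins in \<open>T\<close> are minus instead of plus, again one
  spin at a time.
\<close>

lemma boundary_influence:
  assumes \<beta>: "36 \<le> \<beta>" and fin: "finite T" "finite K"
    and disj: "T \<inter> K = {}" "m \<notin> T \<union> K"
    and few: "\<And>v. v \<in> T \<Longrightarrow> 9 * card (T \<union> K) \<le> nat \<bar>m - v\<bar>"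
  shows "layer_weight \<beta> (insert m (T \<union> K)) * layer_weight \<beta> K
    \<le> exp (16 * exp (32 * \<beta>) * (\<Sum>v\<in>T. (1 / 2) ^ nat \<bar>m - v\<bar>)) * (layer_weight \<beta> (T \<union> K) * layer_weight \<beta> (insert m K))"
  using fin(1) disj few
proof (induction T rule: finite_induct)
  case (insert v T)
  define C where "C = 16 * exp (32 * \<beta>)"
  define e where "e = C * (1 / 2) ^ nat \<bar>m - v\<bar>"
  define S where "S = C * (\<Sum>v\<in>T. (1 / 2) ^ nat \<bar>m - v\<bar>)"
  let ?g = "layer_weight \<beta>"
  let ?L = "T \<union> K"
  have \<beta>0: "0 \<le> \<beta>" using \<beta> by simp
  have fL: "finite ?L" using insert.hyps fin by simp
  have le: "card ?L \<le> card (insert v T \<union> K)" using insert.hyps fin by (intro card_mono) auto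
  have pos: "0 < ?g ?L" "0 < ?g (insert m ?L)" "0 < ?g (insert v ?L)" "0 < ?g K" "0 < ?g (insert m K)"
    using fL fin \<beta>0 by (auto intro!: layer_weight_pos)
  have IH: "?g (insert m ?L) * ?g K \<le> exp S * (?g ?L * ?g (insert m K))"
    unfolding S_def C_def
  proof (rule insert.IH)
    show "9 * card (T \<union> K) \<le> nat \<bar>m - v\<bar>" if "v \<in> T" for v
      using insert.prems(3)[of v] that le by simp
  qed (use insert.prems in auto)
  have "9 * card ?L \<le> nat \<bar>m - v\<bar>" using insert.prems(3)[of v] le by simp
  then have pair: "?g (insert m (insert v ?L)) * ?g ?L \<le> (1 + e) * (?g (insert m ?L) * ?g (insert v ?L))"
    using free_weight_pair_le[OF \<beta> finite.emptyI fL, of m v] insert by (auto simp: e_def C_def)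
  have "(?g (insert m (insert v ?L)) * ?g K) * ?g ?L = (?g (insert m (insert v ?L)) * ?g ?L) * ?g K"
    by (simp only: mult_ac)
  also have "\<dots> \<le> ((1 + e) * (?g (insert m ?L) * ?g (insert v ?L))) * ?g K"
    using pair pos by (intro mult_right_mono) auto
  also have "\<dots> = (1 + e) * ?g (insert v ?L) * (?g (insert m ?L) * ?g K)" by (simp only: mult_ac)
  also have "\<dots> \<le> (1 + e) * ?g (insert v ?L) * (exp S * (?g ?L * ?g (insert m K)))"
    using IH pos by (intro mult_left_mono) (auto simp: e_def C_def)
  also have "\<dots> = ((1 + e) * exp S * (?g (insert v ?L) * ?g (insert m K))) * ?g ?L" by (simp only: mult_ac)
  finally have "?g (insert m (insert v ?L)) * ?g K \<le> (1 + e) * exp S * (?g (insert v ?L) * ?g (insert m K))"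
    using pos(1) by (simp only: mult_le_cancel_right_pos)
  also have "\<dots> \<le> exp e * exp S * (?g (insert v ?L) * ?g (insert m K))"
    using pos exp_ge_add_one_self[of e] by (intro mult_right_mono) auto
  also have "exp e * exp S = exp (C * (\<Sum>v\<in>insert v T. (1 / 2) ^ nat \<bar>m - v\<bar>))"
    using insert.hyps by (simp add: e_def S_def exp_add[symmetric] distrib_left)
  finally show ?case by (simp add: C_def)
qed (simp add: mult.commute)

section \<open>The telescoping potential in terms of layer weights\<close>

definition spins :: "'a set \<Rightarrow> 'a set \<Rightarrow> 'a \<Rightarrow> real" where
  "spins V A = (\<lambda>x\<in>V. if x \<in> A then - 1 else 1)"

lemma sum_configs:
  fixes V :: "'a set"
  shows "(\<Sum>\<sigma> | \<sigma> \<in> configs V \<and> R \<sigma>. f \<sigma>) = (\<Sum>A | A \<subseteq> V \<and> R (spins V A). f (spins V A))"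
proof (rule sum.reindex_bij_witness[of _ "spins V" "\<lambda>\<sigma>. {x \<in> V. \<sigma> x = - 1}"])
  fix \<sigma> :: "'a \<Rightarrow> real" assume "\<sigma> \<in> {\<sigma>. \<sigma> \<in> configs V \<and> R \<sigma>}"
  then have \<sigma>: "\<sigma> \<in> V \<rightarrow>\<^sub>E {-1, 1}" "R \<sigma>" by (auto simp: configs_def)
  have "spins V {x \<in> V. \<sigma> x = - 1} x = \<sigma> x" for x
  proof (cases "x \<in> V")
    case True
    then have "\<sigma> x = - 1 \<or> \<sigma> x = 1" using PiE_mem[OF \<sigma>(1) True] by simp
    then show ?thesis using True unfolding spins_def by (elim disjE) simp_all
  next
    case False
    then show ?thesis using PiE_arb[OF \<sigma>(1) False] by (simp add: spins_def)
  qed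
  then have e: "spins V {x \<in> V. \<sigma> x = - 1} = \<sigma>" by (rule ext)
  then show "spins V {x \<in> V. \<sigma> x = - 1} = \<sigma>" .
  show "{x \<in> V. \<sigma> x = - 1} \<in> {A. A \<subseteq> V \<and> R (spins V A)}" using e \<sigma> by auto
  show "f (spins V {x \<in> V. \<sigma> x = - 1}) = f \<sigma>" by (simp add: e)
next
  fix A assume "A \<in> {A. A \<subseteq> V \<and> R (spins V A)}"
  then show "spins V A \<in> {\<sigma>. \<sigma> \<in> configs V \<and> R \<sigma>}" "{x \<in> V. spins V A x = - 1} = A"
    by (auto simp: configs_def spins_def split: if_splits)
qed

lemma finite_configs [simp]: "finite V \<Longrightarrow> finite (configs V)"
  unfolding configs_def by (rule finite_PiE) auto

lemma bonds_meeting_eq: "bonds_meeting \<Lambda> = (\<lambda>e. {fst e, prev_site e}) ` (\<Union>z\<in>\<Lambda>. star z)"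
proof (intro equalityI subsetI)
  fix b assume "b \<in> bonds_meeting \<Lambda>"
  then obtain x y where b: "b = {x, y}" and xy: "\<bar>fst x - fst y\<bar> + \<bar>snd x - snd y\<bar> = 1"
    and meets: "x \<in> \<Lambda> \<or> y \<in> \<Lambda>"
    unfolding bonds_meeting_def by blast
  have "\<exists>e. fst e = x \<and> prev_site e = y \<or> prev_site e = x \<and> fst e = y"
  proof -
    have "fst x = fst y + 1 \<and> snd x = snd y \<or> fst y = fst x + 1 \<and> snd x = snd y \<or>
       fst x = fst y \<and> snd x = snd y + 1 \<or> fst x = fst y \<and> snd y = snd x + 1"
      using xy by linarith
    then have "prev_site (x, False) = y \<or> prev_site (y, False) = x \<or> prev_site (x, True) = y \<or> prev_site (y, True) = x"
      by (auto simp: prev_site_def prod_eq_iff)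
    then show ?thesis by (metis fst_conv)
  qed
  then obtain e where e: "fst e = x \<and> prev_site e = y \<or> prev_site e = x \<and> fst e = y" ..
  have "e \<in> (\<Union>z\<in>\<Lambda>. star z)" using e meets by (auto simp: star_def)
  moreover have "b = {fst e, prev_site e}" using e b by auto
  ultimately show "b \<in> (\<lambda>e. {fst e, prev_site e}) ` (\<Union>z\<in>\<Lambda>. star z)" by blast
next
  fix b assume "b \<in> (\<lambda>e. {fst e, prev_site e}) ` (\<Union>z\<in>\<Lambda>. star z)"
  then obtain z e where z: "z \<in> \<Lambda>" "e \<in> star z" and b: "b = {fst e, prev_site e}" by blast
  then have e: "b = {fst e, prev_site e}" "fst e \<in> \<Lambda> \<or> prev_site e \<in> \<Lambda>"
    by (auto simp: star_def)
  have "\<bar>fst (fst e) - fst (prev_site e)\<bar> + \<bar>snd (fst e) - snd (prev_site e)\<bar> = 1"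
    by (auto simp: prev_site_def)
  then show "b \<in> bonds_meeting \<Lambda>" unfolding bonds_meeting_def using e by blast
qed

lemma inj_bond: "inj (\<lambda>e. {fst e, prev_site e})"
proof (rule injI)
  fix e f assume "{fst e, prev_site e} = {fst f, prev_site f}"
  moreover obtain u v b where e: "e = ((u, v), b)" by (metis prod.exhaust)
  moreover obtain u' v' b' where f: "f = ((u', v'), b')" by (metis prod.exhaust)
  ultimately show "e = f"
    by (cases b; cases b') (auto simp: prev_site_def doubleton_eq_iff)
qed

lemma ising_weight_spins:
  assumes "finite \<Lambda>" "A \<subseteq> \<Lambda>"
  shows "ising_weight \<beta> \<Lambda> (spins \<Lambda> A) = weight \<beta> A"
proof -
  define E where "E = (\<Union>z\<in>\<Lambda>. star z)"
  have finE: "finite E" using assms by (simp add: E_def)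
  let ?\<sigma> = "plus_off \<Lambda> (spins \<Lambda> A)"
  have \<sigma>: "?\<sigma> x = (if x \<in> A then - 1 else 1)" for x
    using assms(2) by (auto simp: override_on_def spins_def)
  have ne: "fst e \<noteq> prev_site e" for e by (auto simp: prev_site_def prod_eq_iff)
  have "(\<Sum>b\<in>bonds_meeting \<Lambda>. (\<Prod>x\<in>b. ?\<sigma> x) - 1) = (\<Sum>e\<in>E. (\<Prod>x\<in>{fst e, prev_site e}. ?\<sigma> x) - 1)"
    unfolding bonds_meeting_eq E_def[symmetric]
    by (rule sum.reindex[OF inj_on_subset[OF inj_bond], unfolded comp_def]) simp
  also have "\<dots> = (\<Sum>e\<in>E. - 2 * of_bool (e \<in> boundary A))"
    by (rule sum.cong) (auto simp: ne \<sigma> boundary_def)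
  also have "\<dots> = - 2 * real (card (boundary A))"
  proof -
    have "boundary A \<subseteq> E" using boundary_subset_star[of A] assms(2) unfolding E_def by blast
    then show ?thesis using finE by (simp add: sum_distrib_left[symmetric] sum_negf Int_absorb1)
  qed
  finally show ?thesis by (simp add: ising_weight_def weight_def mult_ac)
qed

lemma measure_ising_plus:
  assumes "finite \<Lambda>"
  shows "measure (ising_plus \<beta> \<Lambda>) {\<sigma> \<in> space (ising_plus \<beta> \<Lambda>). R \<sigma>}
    = (\<Sum>A | A \<subseteq> \<Lambda> \<and> R (spins \<Lambda> A). weight \<beta> A) / (\<Sum>\<tau>\<in>configs \<Lambda>. ising_weight \<beta> \<Lambda> \<tau>)"
proof -
  define Z where "Z = (\<Sum>\<tau>\<in>configs \<Lambda>. ising_weight \<beta> \<Lambda> \<tau>)"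
  have Z: "0 \<le> Z" unfolding Z_def by (intro sum_nonneg) (simp add: ising_weight_def)
  have w: "0 \<le> ising_weight \<beta> \<Lambda> \<sigma> / Z" for \<sigma> using Z by (simp add: ising_weight_def)
  have sp: "space (ising_plus \<beta> \<Lambda>) = configs \<Lambda>" by (simp add: ising_plus_def space_point_measure)
  have "emeasure (ising_plus \<beta> \<Lambda>) {\<sigma> \<in> configs \<Lambda>. R \<sigma>}
      = (\<Sum>\<sigma> | \<sigma> \<in> configs \<Lambda> \<and> R \<sigma>. ennreal (ising_weight \<beta> \<Lambda> \<sigma> / Z))"
    unfolding ising_plus_def Z_def[symmetric]
    by (rule emeasure_point_measure_finite) (use assms in auto)
  also have "\<dots> = ennreal (\<Sum>\<sigma> | \<sigma> \<in> configs \<Lambda> \<and> R \<sigma>. ising_weight \<beta> \<Lambda> \<sigma> / Z)"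
    using w by (intro sum_ennreal) auto
  finally have "measure (ising_plus \<beta> \<Lambda>) {\<sigma> \<in> configs \<Lambda>. R \<sigma>}
      = (\<Sum>\<sigma> | \<sigma> \<in> configs \<Lambda> \<and> R \<sigma>. ising_weight \<beta> \<Lambda> \<sigma> / Z)"
    using w by (simp add: measure_def sum_nonneg)
  also have "\<dots> = (\<Sum>\<sigma> | \<sigma> \<in> configs \<Lambda> \<and> R \<sigma>. ising_weight \<beta> \<Lambda> \<sigma>) / Z"
    by (simp add: sum_divide_distrib)
  also have "(\<Sum>\<sigma> | \<sigma> \<in> configs \<Lambda> \<and> R \<sigma>. ising_weight \<beta> \<Lambda> \<sigma>) = (\<Sum>A | A \<subseteq> \<Lambda> \<and> R (spins \<Lambda> A). weight \<beta> A)"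
    unfolding sum_configs by (rule sum.cong) (auto simp: ising_weight_spins assms)
  finally show ?thesis by (simp add: sp Z_def)
qed

text \<open>
  Given plus spins on the layer off \<open>V\<close>, the minus set is a subset of the bulk and
  \<open>V\<close>; prescribing the spins in \<open>V\<close> as well leaves an arbitrary subset
  of the bulk.
\<close>

lemma ising_plus_conditional:
  assumes V: "V \<subseteq> {- int n..int n}" and \<sigma>: "\<And>i. i \<in> V \<Longrightarrow> \<sigma> i = - 1 \<or> \<sigma> i = 1"
  shows "\<P>(X in ising_plus \<beta> (square n). (\<forall>i\<in>V. X (i, 0) = \<sigma> i) \<bar>
        (\<forall>i\<in>{- int n..int n} - V. X (i, 0) = all_plus i))
    = ising_sum \<beta> (bulk n) (on_layer {i \<in> V. \<sigma> i = - 1}) / ising_sum \<beta> (bulk n \<union> on_layer V) {}"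
proof -
  define I where "I = {i \<in> V. \<sigma> i = - 1}"
  let ?P = "\<lambda>X :: int \<times> int \<Rightarrow> real. \<forall>i\<in>V. X (i, 0) = \<sigma> i"
  let ?Q = "\<lambda>X :: int \<times> int \<Rightarrow> real. \<forall>i\<in>{- int n..int n} - V. X (i, 0) = all_plus i"
  have finV: "finite V" using V finite_subset by blast
  have sp: "spins (square n) A (i, 0) = (if (i, 0) \<in> A then - 1 else 1)" if "i \<in> {- int n..int n}" for A i
    using that by (auto simp: spins_def square_def)
  have Q: "?Q (spins (square n) A) \<longleftrightarrow> A \<subseteq> bulk n \<union> on_layer V" if A: "A \<subseteq> square n" for A
  proof -
    have "?Q (spins (square n) A) \<longleftrightarrow> (\<forall>i\<in>{- int n..int n} - V. (i, 0) \<notin> A)"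
      by (intro ball_cong refl) (auto simp: sp)
    also have "\<dots> \<longleftrightarrow> A \<subseteq> bulk n \<union> on_layer V"
      using A by (fastforce simp: bulk_def on_layer_def square_def)
    finally show ?thesis .
  qed
  have P: "?P (spins (square n) A) \<longleftrightarrow> (\<forall>i\<in>V. (i, 0) \<in> A \<longleftrightarrow> i \<in> I)" for A
  proof (intro ball_cong refl)
    fix i assume i: "i \<in> V"
    then have "spins (square n) A (i, 0) = (if (i, 0) \<in> A then - 1 else 1)" using V by (intro sp) auto
    then show "spins (square n) A (i, 0) = \<sigma> i \<longleftrightarrow> ((i, 0) \<in> A \<longleftrightarrow> i \<in> I)"
      using \<sigma>[OF i] i by (auto simp: I_def)
  qed
  have sub: "bulk n \<union> on_layer V \<subseteq> square n"
    using V by (auto simp: bulk_def on_layer_def square_def)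
  have "{A. A \<subseteq> square n \<and> ?Q (spins (square n) A)} = Pow (bulk n \<union> on_layer V)"
    using Q sub by auto
  then have 1: "(\<Sum>A | A \<subseteq> square n \<and> ?Q (spins (square n) A). weight \<beta> A) = ising_sum \<beta> (bulk n \<union> on_layer V) {}"
    by (simp add: ising_sum_def)
  have "{A. A \<subseteq> square n \<and> (?P (spins (square n) A) \<and> ?Q (spins (square n) A))}
      = (\<lambda>A. A \<union> on_layer I) ` Pow (bulk n)"
  proof (intro equalityI subsetI)
    fix A assume "A \<in> {A. A \<subseteq> square n \<and> (?P (spins (square n) A) \<and> ?Q (spins (square n) A))}"
    then have A: "A \<subseteq> bulk n \<union> on_layer V" "\<forall>i\<in>V. (i, 0) \<in> A \<longleftrightarrow> i \<in> I" using P Q by blast+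
    have "A = (A \<inter> bulk n) \<union> on_layer I"
    proof (intro equalityI subsetI)
      fix z assume z: "z \<in> A"
      then show "z \<in> (A \<inter> bulk n) \<union> on_layer I"
        using A by (auto simp: on_layer_def)
    next
      fix z assume "z \<in> (A \<inter> bulk n) \<union> on_layer I"
      then show "z \<in> A" using A(2) by (auto simp: on_layer_def I_def)
    qed
    then show "A \<in> (\<lambda>A. A \<union> on_layer I) ` Pow (bulk n)" by blast
  next
    fix A assume "A \<in> (\<lambda>A. A \<union> on_layer I) ` Pow (bulk n)"
    then obtain A' where A': "A' \<subseteq> bulk n" "A = A' \<union> on_layer I" by auto
    have IV: "on_layer I \<subseteq> on_layer V" by (auto simp: I_def on_layer_def)
    then have A: "A \<subseteq> bulk n \<union> on_layer V" using A' by blast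
    moreover have "(i, 0) \<in> A \<longleftrightarrow> i \<in> I" for i using A' by (auto simp: bulk_def)
    ultimately show "A \<in> {A. A \<subseteq> square n \<and> (?P (spins (square n) A) \<and> ?Q (spins (square n) A))}"
      using P[of A] Q[of A] sub by blast
  qed
  moreover have "inj_on (\<lambda>A. A \<union> on_layer I) (Pow (bulk n))"
    using bulk_on_layer[of n I] by (auto simp: inj_on_def)
  ultimately have 2: "(\<Sum>A | A \<subseteq> square n \<and> (?P (spins (square n) A) \<and> ?Q (spins (square n) A)). weight \<beta> A)
      = ising_sum \<beta> (bulk n) (on_layer I)"
    by (simp add: ising_sum_def sum.reindex)
  have Z: "(\<Sum>\<tau>\<in>configs (square n). ising_weight \<beta> (square n) \<tau>) \<noteq> 0"
  proof -
    have "spins (square n) {} \<in> configs (square n)" by (auto simp: configs_def spins_def)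
    then have "0 < (\<Sum>\<tau>\<in>configs (square n). ising_weight \<beta> (square n) \<tau>)"
      by (intro sum_pos2[of _ "spins (square n) {}"]) (auto simp: ising_weight_def)
    then show ?thesis by simp
  qed
  show ?thesis
    unfolding cond_prob_def measure_ising_plus[OF finite_square] 1 2 I_def[symmetric] using Z by simp
qed

lemma layer_spec_plus:
  assumes V: "finite V" and \<sigma>: "\<And>i. i \<in> V \<Longrightarrow> \<sigma> i = - 1 \<or> \<sigma> i = 1" and \<beta>: "0 \<le> \<beta>"
  shows "layer_spec \<beta> V \<sigma> all_plus = layer_weight \<beta> {i \<in> V. \<sigma> i = - 1} / free_weight \<beta> V {}"
proof -
  define I where "I = {i \<in> V. \<sigma> i = - 1}"
  have I: "finite I" using V by (simp add: I_def)
  have "(\<lambda>n. layer_weight_in \<beta> (bulk n) I / (ising_sum \<beta> (bulk n \<union> on_layer V) (on_layer {}) / ising_sum \<beta> (bulk n) {}))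
      \<longlonglongrightarrow> layer_weight \<beta> I / free_weight \<beta> V {}"
    using free_weight_pos[OF V finite.emptyI \<beta>]
    by (intro tendsto_divide layer_weight_limit[OF I \<beta>] free_weight_limit[OF V finite.emptyI \<beta>]) simp
  moreover have "\<forall>\<^sub>F n in sequentially.
      layer_weight_in \<beta> (bulk n) I / (ising_sum \<beta> (bulk n \<union> on_layer V) (on_layer {}) / ising_sum \<beta> (bulk n) {})
      = \<P>(X in ising_plus \<beta> (square n). (\<forall>i\<in>V. X (i, 0) = \<sigma> i) \<bar>
        (\<forall>i\<in>{- int n..int n} - V. X (i, 0) = all_plus i))"
  proof (rule eventually_sequentiallyI[of "nat (Max (insert 0 (abs ` V)))"])
    fix n assume n: "nat (Max (insert 0 (abs ` V))) \<le> n"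
    have VV: "V \<subseteq> {- int n..int n}"
    proof
      fix v assume "v \<in> V"
      then have "\<bar>v\<bar> \<le> Max (insert 0 (abs ` V))" using V by (intro Max_ge) auto
      then have "\<bar>v\<bar> \<le> int n" using n by linarith
      then show "v \<in> {- int n..int n}" by auto
    qed
    have "ising_sum \<beta> (bulk n) {} \<noteq> 0" using ising_sum_pos[OF finite_bulk, of \<beta> n "{}"] by simp
    then show "layer_weight_in \<beta> (bulk n) I / (ising_sum \<beta> (bulk n \<union> on_layer V) (on_layer {}) / ising_sum \<beta> (bulk n) {})
      = \<P>(X in ising_plus \<beta> (square n). (\<forall>i\<in>V. X (i, 0) = \<sigma> i) \<bar>
        (\<forall>i\<in>{- int n..int n} - V. X (i, 0) = all_plus i))"
      by (subst ising_plus_conditional[OF VV \<sigma>]) (simp_all add: I_def layer_weight_in_def)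
  qed
  ultimately have "(\<lambda>n. \<P>(X in ising_plus \<beta> (square n). (\<forall>i\<in>V. X (i, 0) = \<sigma> i) \<bar>
        (\<forall>i\<in>{- int n..int n} - V. X (i, 0) = all_plus i))) \<longlonglongrightarrow> layer_weight \<beta> I / free_weight \<beta> V {}"
    by (rule Lim_transform_eventually)
  then show ?thesis unfolding layer_spec_def I_def by (rule limI)
qed

text \<open>
  For \<open>j < i\<close> and for \<open>j = i\<close> alike this is the potential of the
  interval from \<open>j\<close> to \<open>i\<close>. It is written as a difference whose second
  part is the first one with \<open>j + 1\<close> in place of \<open>j\<close>.
\<close>

definition interval_energy :: "real \<Rightarrow> int set \<Rightarrow> int \<Rightarrow> int \<Rightarrow> real" where
  "interval_energy \<beta> M j i =
     (ln (layer_weight \<beta> (M \<inter> {j..<i})) - ln (layer_weight \<beta> (M \<inter> {j..i})))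
     - (ln (layer_weight \<beta> (M \<inter> {j<..<i})) - ln (layer_weight \<beta> (M \<inter> {j<..i})))"

lemma telescoping_interval:
  assumes ji: "j \<le> i" and \<xi>: "\<And>k. k \<in> {j..i} \<Longrightarrow> \<xi> k = - 1 \<or> \<xi> k = 1" and \<beta>: "0 \<le> \<beta>"
  shows "telescoping \<beta> {j..i} \<xi> = interval_energy \<beta> {k. \<xi> k = - 1} j i"
proof -
  let ?M = "{k. \<xi> k = - 1}"
  define z where "z = free_weight \<beta> {j..i} {}"
  have z: "0 < z" unfolding z_def using \<beta> by (intro free_weight_pos) auto
  have spec: "layer_spec \<beta> {j..i} (plus_off X \<xi>) all_plus = layer_weight \<beta> (?M \<inter> X) / z"
    if "X \<subseteq> {j..i}" for X
  proof -
    have "{k \<in> {j..i}. plus_off X \<xi> k = - 1} = ?M \<inter> X"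
      using that by (auto simp: override_on_def)
    moreover have "plus_off X \<xi> k = - 1 \<or> plus_off X \<xi> k = 1" if "k \<in> {j..i}" for k
      using \<xi>[OF that] by (auto simp: override_on_def)
    ultimately show ?thesis unfolding z_def
      using layer_spec_plus[of "{j..i}" "plus_off X \<xi>" \<beta>] \<beta> by simp
  qed
  have pos: "0 < layer_weight \<beta> (?M \<inter> X)" if "X \<subseteq> {j..i}" for X
    using \<beta> finite_subset[OF that] by (intro layer_weight_pos) auto
  have sub: "{j<..i} \<subseteq> {j..i}" "{j..<i} \<subseteq> {j..i}" "{j<..<i} \<subseteq> {j..i}" "{j..i} \<subseteq> {j..i}" by auto
  have T: "telescoping \<beta> {j..i} \<xi> =
     (if j = i then ln (layer_spec \<beta> {j..i} all_plus all_plus / layer_spec \<beta> {j..i} (plus_off {i} \<xi>) all_plus)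
      else ln (layer_spec \<beta> {j..i} (plus_off {j<..i} \<xi>) all_plus * layer_spec \<beta> {j..i} (plus_off {j..<i} \<xi>) all_plus
        / (layer_spec \<beta> {j..i} (plus_off {j<..<i} \<xi>) all_plus * layer_spec \<beta> {j..i} (plus_off {j..i} \<xi>) all_plus)))"
  proof -
    have "Min {j..i} = j" "Max {j..i} = i" using ji by (auto intro!: Min_eqI Max_eqI)
    then show ?thesis using ji by (simp add: telescoping_def Let_def)
  qed
  show ?thesis
  proof (cases "j = i")
    case True
    have "all_plus = plus_off {} \<xi>" by simp
    moreover have "layer_spec \<beta> {j..i} (plus_off {} \<xi>) all_plus = 1 / z" using spec[of "{}"] by simp
    moreover have "layer_spec \<beta> {j..i} (plus_off {i} \<xi>) all_plus = layer_weight \<beta> (?M \<inter> {i}) / z"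
      using spec[of "{i}"] True by simp
    ultimately have "telescoping \<beta> {j..i} \<xi> = ln (1 / layer_weight \<beta> (?M \<inter> {i}))"
      unfolding T using True z by simp
    then show ?thesis using True pos[of "{i}"] by (simp add: interval_energy_def ln_div)
  next
    case False
    have "telescoping \<beta> {j..i} \<xi> = ln (layer_weight \<beta> (?M \<inter> {j<..i}) * layer_weight \<beta> (?M \<inter> {j..<i})
        / (layer_weight \<beta> (?M \<inter> {j<..<i}) * layer_weight \<beta> (?M \<inter> {j..i})))"
      unfolding T spec[OF sub(1)] spec[OF sub(2)] spec[OF sub(3)] spec[OF sub(4)] using False z by simp
    then show ?thesis
      using pos[OF sub(1)] pos[OF sub(2)] pos[OF sub(3)] pos[OF sub(4)]
      by (simp add: interval_energy_def ln_div ln_mult)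
  qed
qed

lemma telescoping_not_interval:
  "(\<And>j i. j \<le> i \<Longrightarrow> A \<noteq> {j..i}) \<Longrightarrow> telescoping \<beta> A \<xi> = 0"
  unfolding telescoping_def
  by (metis Min_le_iff Max_ge_iff Min_in Max_in Max_ge)

lemma sum_int_telescope:
  fixes f :: "int \<Rightarrow> real"
  assumes "a \<le> b + 1"
  shows "(\<Sum>j=a..b. f j - f (j + 1)) = f a - f (b + 1)"
proof -
  have "(\<Sum>j=a..c - 1. f j - f (j + 1)) = f a - f c" if "a \<le> c" for c
    using that
  proof (induction c rule: int_ge_induct)
    case (step c)
    have "{a..c + 1 - 1} = insert c {a..c - 1}" using step by auto
    then show ?case using step by simp
  qed simp
  from this[of "b + 1"] show ?thesis using assms by simp
qed

text \<open>
  The sum telescopes first in the left end \<open>j\<close> and then in the right end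
  \<open>i\<close>.
\<close>

lemma sum_interval_energy:
  "(\<Sum>i=a..b. \<Sum>j=a..i. interval_energy \<beta> M j i) = - ln (layer_weight \<beta> (M \<inter> {a..b}))"
proof (cases "a \<le> b")
  case True
  have "(\<Sum>j=a..i. interval_energy \<beta> M j i)
      = ln (layer_weight \<beta> (M \<inter> {a..i - 1})) - ln (layer_weight \<beta> (M \<inter> {a..i + 1 - 1}))" if "a \<le> i" for i
  proof -
    let ?f = "\<lambda>j. ln (layer_weight \<beta> (M \<inter> {j..<i})) - ln (layer_weight \<beta> (M \<inter> {j..i}))"
    have "{j<..<i} = {j + 1..<i}" "{j<..i} = {j + 1..i}" for j by auto
    then have "(\<Sum>j=a..i. interval_energy \<beta> M j i) = (\<Sum>j=a..i. ?f j - ?f (j + 1))"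
      by (simp add: interval_energy_def)
    also have "\<dots> = ?f a - ?f (i + 1)" using that by (intro sum_int_telescope) simp
    also have "{a..<i} = {a..i - 1}" by auto
    finally show ?thesis by simp
  qed
  then have "(\<Sum>i=a..b. \<Sum>j=a..i. interval_energy \<beta> M j i)
      = (\<Sum>i=a..b. ln (layer_weight \<beta> (M \<inter> {a..i - 1})) - ln (layer_weight \<beta> (M \<inter> {a..i + 1 - 1})))"
    by (intro sum.cong) auto
  also have "\<dots> = ln (layer_weight \<beta> (M \<inter> {a..a - 1})) - ln (layer_weight \<beta> (M \<inter> {a..b + 1 - 1}))"
    using True by (intro sum_int_telescope) simp
  finally show ?thesis by simp
qed simp

lemma sum_telescoping:
  assumes \<xi>: "\<And>k. k \<in> {a..b} \<Longrightarrow> \<xi> k = - 1 \<or> \<xi> k = 1" and \<beta>: "0 \<le> \<beta>"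
  shows "(\<Sum>A\<in>Pow {a..b}. telescoping \<beta> A \<xi>) = - ln (layer_weight \<beta> ({k. \<xi> k = - 1} \<inter> {a..b}))"
proof -
  define P where "P = (SIGMA i:{a..b}. {a..i})"
  let ?I = "\<lambda>(i, j). {j..i::int}"
  have inj: "inj_on ?I P" by (auto simp: inj_on_def P_def)
  have sub: "?I ` P \<subseteq> Pow {a..b}" by (auto simp: P_def)
  have "telescoping \<beta> A \<xi> = 0" if "A \<in> Pow {a..b} - ?I ` P" for A
  proof (rule telescoping_not_interval)
    fix j i :: int assume "j \<le> i"
    show "A \<noteq> {j..i}"
    proof
      assume A: "A = {j..i}"
      then have "(i, j) \<in> P" using that \<open>j \<le> i\<close> by (auto simp: P_def)
      then have "A \<in> ?I ` P" using A by (auto intro!: image_eqI[of _ _ "(i, j)"])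
      then show False using that by blast
    qed
  qed
  then have "(\<Sum>A\<in>Pow {a..b}. telescoping \<beta> A \<xi>) = (\<Sum>A\<in>?I ` P. telescoping \<beta> A \<xi>)"
    using sub by (intro sum.mono_neutral_right) auto
  also have "\<dots> = (\<Sum>(i, j)\<in>P. telescoping \<beta> {j..i} \<xi>)"
    by (subst sum.reindex[OF inj]) (simp add: case_prod_unfold)
  also have "\<dots> = (\<Sum>(i, j)\<in>P. interval_energy \<beta> {k. \<xi> k = - 1} j i)"
    by (rule sum.cong) (auto simp: P_def intro!: telescoping_interval \<xi> \<beta>)
  also have "\<dots> = (\<Sum>i=a..b. \<Sum>j=a..i. interval_energy \<beta> {k. \<xi> k = - 1} j i)"
    unfolding P_def by (rule sum.Sigma[symmetric]) auto
  finally show ?thesis by (simp only: sum_interval_energy)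
qed

lemma free_partition_telescoping:
  assumes "0 \<le> \<beta>"
  shows "free_partition (telescoping \<beta>) {a..b} = free_weight \<beta> {a..b} {}"
proof -
  let ?V = "{a..b}"
  have "free_partition (telescoping \<beta>) ?V
      = (\<Sum>J | J \<subseteq> ?V \<and> True. exp (- (\<Sum>A\<in>Pow ?V. telescoping \<beta> A (spins ?V J))))"
    unfolding free_partition_def using sum_configs[where V = ?V and R = "\<lambda>_. True"] by simp
  also have "\<dots> = (\<Sum>J | J \<subseteq> ?V \<and> True. layer_weight \<beta> (J \<union> {}))"
  proof (rule sum.cong[OF refl])
    fix J assume J: "J \<in> {J. J \<subseteq> ?V \<and> True}"
    have "{k. spins ?V J k = - 1} \<inter> ?V = J" using J by (auto simp: spins_def split: if_splits)
    moreover have "finite J" using J finite_subset by auto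
    ultimately show "exp (- (\<Sum>A\<in>Pow ?V. telescoping \<beta> A (spins ?V J))) = layer_weight \<beta> (J \<union> {})"
      using sum_telescoping[of a b "spins ?V J" \<beta>] assms layer_weight_pos[of J \<beta>]
      by (simp add: spins_def)
  qed
  also have "\<dots> = free_weight \<beta> ?V {}" unfolding free_weight_def by (rule sum.cong) auto
  finally show ?thesis .
qed

text \<open>
  The energy vanishes unless both ends are minus. If they are, its negative is the logarithm of
  the ratio bounded in \<open>free_weight_pair_le\<close>, and this ratio is at least
  \<open>1\<close> by supermodularity.
\<close>

lemma interval_energy_bound:
  assumes \<beta>: "36 \<le> \<beta>" and ji: "j < i" and few: "9 * card (M \<inter> {j<..<i}) \<le> nat (i - j)"
  shows "\<bar>interval_energy \<beta> M j i\<bar> \<le> 16 * exp (32 * \<beta>) * (1 / 2) ^ nat (i - j)"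
proof (cases "j \<in> M \<and> i \<in> M")
  case True
  define K where "K = M \<inter> {j<..<i}"
  let ?g = "layer_weight \<beta>"
  define e where "e = 16 * exp (32 * \<beta>) * (1 / 2) ^ nat (i - j)"
  have e: "0 \<le> e" by (simp add: e_def)
  have \<beta>0: "0 \<le> \<beta>" using \<beta> by simp
  have K: "finite K" "i \<notin> K" "j \<notin> K" by (auto simp: K_def)
  have sets: "M \<inter> {j..<i} = insert j K" "M \<inter> {j<..i} = insert i K" "M \<inter> {j..i} = insert i (insert j K)"
    using True ji by (auto simp: K_def)
  have pos: "0 < ?g K" "0 < ?g (insert i K)" "0 < ?g (insert j K)" "0 < ?g (insert i (insert j K))"
    using K \<beta>0 by (auto intro!: layer_weight_pos)
  have eq: "- interval_energy \<beta> M j i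
      = ln ((?g (insert i (insert j K)) * ?g K) / (?g (insert i K) * ?g (insert j K)))"
    unfolding interval_energy_def sets K_def[symmetric] using pos by (simp add: ln_div ln_mult)
  have "insert i K \<union> insert j K = insert i (insert j K)" "insert i K \<inter> insert j K = K"
    using K ji by auto
  then have "?g (insert i K) * ?g (insert j K) \<le> ?g (insert i (insert j K)) * ?g K"
    using layer_weight_supermodular[of "insert i K" "insert j K" \<beta>] K \<beta>0 by simp
  then have lower: "1 \<le> (?g (insert i (insert j K)) * ?g K) / (?g (insert i K) * ?g (insert j K))"
    using pos by simp
  have "?g (insert i (insert j K)) * ?g K \<le> (1 + e) * (?g (insert i K) * ?g (insert j K))"
    using free_weight_pair_le[OF \<beta> finite.emptyI K(1), of i j] K ji few
    by (auto simp: e_def K_def)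
  then have upper: "(?g (insert i (insert j K)) * ?g K) / (?g (insert i K) * ?g (insert j K)) \<le> 1 + e"
    using pos by (simp add: divide_simps)
  have "0 \<le> - interval_energy \<beta> M j i" unfolding eq using lower by simp
  moreover have "- interval_energy \<beta> M j i \<le> e"
  proof -
    have "- interval_energy \<beta> M j i \<le> ln (1 + e)"
      unfolding eq using lower upper by (subst ln_le_cancel_iff) auto
    also have "\<dots> \<le> e" using ln_add_one_self_le_self[OF e] .
    finally show ?thesis .
  qed
  ultimately show ?thesis by (simp add: e_def)
next
  case False
  have "interval_energy \<beta> M j i = 0"
  proof (cases "j \<in> M")
    case True
    then have "i \<notin> M" using False by blast
    then have "M \<inter> {j..<i} = M \<inter> {j..i}" "M \<inter> {j<..<i} = M \<inter> {j<..i}" by (auto simp: order_le_less)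
    then show ?thesis by (simp add: interval_energy_def)
  next
    case False
    then have "M \<inter> {j..<i} = M \<inter> {j<..<i}" "M \<inter> {j..i} = M \<inter> {j<..i}" by (auto simp: order_le_less)
    then show ?thesis by (simp add: interval_energy_def)
  qed
  then show ?thesis by simp
qed

section \<open>The free pressure\<close>

text \<open>
  Fekete's lemma. The limit is the supremum of the averages: choose \<open>k\<close> whose
  average nearly attains it and divide \<open>m\<close> by \<open>k\<close> with remainder.
\<close>

lemma superadditive_average_converges:
  fixes z :: "nat \<Rightarrow> real"
  assumes zero: "z 0 = 0" and super: "\<And>m n. z m + z n \<le> z (m + n)" and upper: "\<And>m. z m \<le> C * real m"
  obtains L where "(\<lambda>m. z m / real m) \<longlonglongrightarrow> L"
proof -
  define L where "L = (SUP m\<in>{1..}. z m / real m)"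
  have bdd: "bdd_above ((\<lambda>m. z m / real m) ` {1..})"
    by (rule bdd_aboveI2[of _ _ C]) (use upper in \<open>auto simp: divide_simps\<close>)
  have le_L: "z m / real m \<le> L" if "1 \<le> m" for m
    unfolding L_def by (rule cSUP_upper[OF _ bdd]) (use that in auto)
  have mult: "real q * z k \<le> z (q * k)" for q k
  proof (induction q)
    case 0
    show ?case by (simp add: zero)
  next
    case (Suc q)
    then show ?case using super[of k "q * k"] by (simp add: algebra_simps)
  qed
  have "(\<lambda>m. z m / real m) \<longlonglongrightarrow> L"
  proof (rule LIMSEQ_I)
    fix e :: real assume e: "0 < e"
    have "\<exists>k\<in>{1..}. L - e / 2 < z k / real k"
      using less_cSUP_iff[OF _ bdd, of "L - e / 2"] e by (simp add: L_def)
    then obtain k where k: "1 \<le> k" "L - e / 2 < z k / real k" by auto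
    define B where "B = (\<Sum>r<k. \<bar>z r\<bar>) + \<bar>L - e / 2\<bar> * real k"
    have lower: "(L - e / 2) * real m - B \<le> z m" for m
    proof -
      define q where "q = m div k"
      define r where "r = m mod k"
      have m: "m = q * k + r" and r: "r < k" using k by (simp_all add: q_def r_def)
      have "(L - e / 2) * real k \<le> z k" using k by (simp add: field_simps)
      then have "real q * ((L - e / 2) * real k) \<le> real q * z k" by (intro mult_left_mono) auto
      also have "\<dots> \<le> z (q * k)" by (rule mult)
      finally have "real q * ((L - e / 2) * real k) + z r \<le> z m"
        using super[of "q * k" r] unfolding m by linarith
      moreover have "\<bar>z r\<bar> \<le> (\<Sum>r<k. \<bar>z r\<bar>)"
        using r by (intro member_le_sum) auto
      moreover have "(L - e / 2) * real r \<le> \<bar>L - e / 2\<bar> * real k"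
      proof -
        have "(L - e / 2) * real r \<le> \<bar>L - e / 2\<bar> * real r" by (intro mult_right_mono) auto
        also have "\<dots> \<le> \<bar>L - e / 2\<bar> * real k" using r by (intro mult_left_mono) auto
        finally show ?thesis .
      qed
      moreover have "(L - e / 2) * real m = real q * ((L - e / 2) * real k) + (L - e / 2) * real r"
        unfolding m by (simp add: algebra_simps)
      ultimately show ?thesis unfolding B_def by linarith
    qed
    obtain N :: nat where N: "2 * B / e < real N" using reals_Archimedean2 by blast
    show "\<exists>no. \<forall>n\<ge>no. norm (z n / real n - L) < e"
    proof (intro exI[of _ "Suc N"] allI impI)
      fix m assume m: "Suc N \<le> m"
      have "2 * B / e < real m" using N m by linarith
      then have "B < e / 2 * real m" using e by (simp add: field_simps)
      then have "(L - e) * real m < z m" using lower[of m] by (simp add: algebra_simps)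
      then have "L - e < z m / real m" using m by (simp add: pos_less_divide_eq)
      then show "norm (z m / real m - L) < e" using le_L[of m] m e by (simp add: abs_if)
    qed
  qed
  then show thesis using that by blast
qed

lemma free_weight_Un:
  assumes "finite F" "finite G" "F \<inter> G = {}"
  shows "free_weight \<beta> (F \<union> G) K = (\<Sum>J\<in>Pow F. free_weight \<beta> G (J \<union> K))"
  using assms(1,3)
proof (induction F arbitrary: K rule: finite_induct)
  case (insert v F)
  have "free_weight \<beta> (insert v (F \<union> G)) K = free_weight \<beta> (F \<union> G) K + free_weight \<beta> (F \<union> G) (insert v K)"
    using insert assms(2) by (intro free_weight_insert) auto
  then show ?case using insert by (simp add: sum_Pow_insert sum.distrib)
qed simp

lemma free_weight_supermultiplicative:
  assumes "finite F" "finite G" "F \<inter> G = {}" "0 \<le> \<beta>"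
  shows "free_weight \<beta> F {} * free_weight \<beta> G {} \<le> free_weight \<beta> (F \<union> G) {}"
proof -
  have "layer_weight \<beta> I * layer_weight \<beta> J \<le> layer_weight \<beta> (J \<union> I)" if "I \<subseteq> F" "J \<subseteq> G" for I J
  proof -
    have "I \<inter> J = {}" using that assms by blast
    then show ?thesis
      using layer_weight_supermodular[of I J \<beta>] that assms finite_subset[of I F] finite_subset[of J G]
      by (simp add: Un_commute)
  qed
  then show ?thesis
    unfolding free_weight_Un[OF assms(1-3)] unfolding free_weight_def sum_product
    by (intro sum_mono) auto
qed

lemma free_weight_shift:
  assumes "finite F" "0 \<le> \<beta>"
  shows "free_weight \<beta> ((\<lambda>i. i + k) ` F) {} = free_weight \<beta> F {}"
proof -
  let ?s = "\<lambda>i :: int. i + k"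
  have "Pow (?s ` F) = (`) ?s ` Pow F" by (rule image_Pow_surj[symmetric]) simp
  moreover have "inj_on ((`) ?s) (Pow F)"
    by (auto simp: inj_on_def inj_image_eq_iff)
  ultimately have "free_weight \<beta> (?s ` F) {} = (\<Sum>J\<in>Pow F. layer_weight \<beta> (?s ` J))"
    unfolding free_weight_def by (simp add: sum.reindex)
  also have "\<dots> = free_weight \<beta> F {}"
    unfolding free_weight_def
    by (intro sum.cong refl) (auto intro!: layer_weight_shift assms finite_subset[OF _ assms(1)])
  finally show ?thesis .
qed

lemma free_weight_le:
  assumes "finite F" "0 \<le> \<beta>"
  shows "free_weight \<beta> F {} \<le> exp ((ln 2 + 8 * \<beta>) * real (card F))"
proof -
  have "free_weight \<beta> F {} \<le> (\<Sum>J\<in>Pow F. exp (8 * \<beta> * real (card F)))"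
    unfolding free_weight_def
  proof (rule sum_mono)
    fix J assume J: "J \<in> Pow F"
    have "layer_weight \<beta> (J \<union> {}) \<le> exp (8 * \<beta> * real (card J))"
      using J assms finite_subset[of J F] by (simp add: layer_weight_le)
    also have "\<dots> \<le> exp (8 * \<beta> * real (card F))"
      using J assms card_mono[of F J] by (simp add: mult_left_mono)
    finally show "layer_weight \<beta> (J \<union> {}) \<le> exp (8 * \<beta> * real (card F))" .
  qed
  also have "\<dots> = exp (ln 2) ^ card F * exp (8 * \<beta> * real (card F))"
    using assms by (simp add: card_Pow)
  also have "\<dots> = exp ((ln 2 + 8 * \<beta>) * real (card F))"
    unfolding exp_of_nat_mult[symmetric] exp_add[symmetric] by (simp add: algebra_simps)
  finally show ?thesis .
qed

lemma interval_free_weight: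
  assumes "0 \<le> \<beta>"
  shows "free_weight \<beta> {a..b} {} = free_weight \<beta> {1..int (card {a..b})} {}"
proof (cases "a \<le> b")
  case True
  have "{a..b} = (\<lambda>i. i + (a - 1)) ` {1..int (card {a..b})}"
  proof (intro equalityI subsetI)
    fix x assume "x \<in> {a..b}"
    then show "x \<in> (\<lambda>i. i + (a - 1)) ` {1..int (card {a..b})}"
      by (intro image_eqI[of _ _ "x - (a - 1)"]) auto
  qed (use True in auto)
  then have "free_weight \<beta> {a..b} {} = free_weight \<beta> ((\<lambda>i. i + (a - 1)) ` {1..int (card {a..b})}) {}"
    by (rule arg_cong)
  also have "\<dots> = free_weight \<beta> {1..int (card {a..b})} {}" by (rule free_weight_shift) (simp_all add: assms)
  finally show ?thesis .
qed simp

lemma eventually_thermodynamic: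
  assumes "\<And>a b. a \<le> - N \<Longrightarrow> N \<le> b \<Longrightarrow> P {a..b}"
  shows "eventually P thermodynamic"
  unfolding thermodynamic_def eventually_filtermap eventually_prod_filter
  using assms eventually_le_at_bot[of "- N"] eventually_ge_at_top[of N]
  by (intro exI[of _ "\<lambda>a. a \<le> - N"] exI[of _ "\<lambda>b. N \<le> b"]) auto

lemma thermodynamic_nontrivial: "thermodynamic \<noteq> bot"
  by (simp add: thermodynamic_def filtermap_bot_iff prod_filter_eq_bot)

lemma card_thermodynamic: "filterlim card at_top thermodynamic"
  unfolding filterlim_at_top
proof
  fix n :: nat
  show "\<forall>\<^sub>F V in thermodynamic. n \<le> card V"
    by (rule eventually_thermodynamic[of "int n"]) auto
qed

text \<open>
  The free partition function of an interval depends only on its length, and its logarithm is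
  superadditive because minus spins attract each other.
\<close>

lemma pressure_exists:
  assumes "0 \<le> \<beta>"
  shows "((\<lambda>V. ln (free_partition (telescoping \<beta>) V) / real (card V))
       \<longlongrightarrow> pressure (telescoping \<beta>)) thermodynamic"
proof -
  define z where "z m = ln (free_weight \<beta> {1..int m} {})" for m
  have super: "z m + z n \<le> z (m + n)" for m n
  proof -
    have "{1..int (m + n)} = {1..int m} \<union> {int m + 1..int (m + n)}" by auto
    moreover have "card {int m + 1..int (m + n)} = n" by simp
    then have "free_weight \<beta> {int m + 1..int (m + n)} {} = free_weight \<beta> {1..int n} {}"
      using interval_free_weight[OF assms, of "int m + 1" "int (m + n)"] by simp
    ultimately have "free_weight \<beta> {1..int m} {} * free_weight \<beta> {1..int n} {} \<le> free_weight \<beta> {1..int (m + n)} {}"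
      using free_weight_supermultiplicative[of "{1..int m}" "{int m + 1..int (m + n)}" \<beta>] assms by simp
    moreover have p: "0 < free_weight \<beta> {1..int k} {}" for k using assms by (intro free_weight_pos) auto
    ultimately have "ln (free_weight \<beta> {1..int m} {} * free_weight \<beta> {1..int n} {}) \<le> z (m + n)"
      unfolding z_def by (intro ln_mono) (auto intro: mult_pos_pos)
    moreover have "ln (free_weight \<beta> {1..int m} {} * free_weight \<beta> {1..int n} {}) = z m + z n"
      unfolding z_def using p[of m] p[of n] by (intro ln_mult_pos)
    ultimately show ?thesis by simp
  qed
  have upper: "z m \<le> (ln 2 + 8 * \<beta>) * real m" for m
  proof -
    have "z m \<le> ln (exp ((ln 2 + 8 * \<beta>) * real (card {1..int m})))"
      unfolding z_def using free_weight_le[of "{1..int m}" \<beta>] free_weight_pos[of "{1..int m}" "{}" \<beta>] assms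
      by (intro ln_mono) auto
    then show ?thesis by simp
  qed
  obtain L where L: "(\<lambda>m. z m / real m) \<longlonglongrightarrow> L"
    using superadditive_average_converges[of z, OF _ super upper] by (auto simp: z_def)
  have "((\<lambda>V. z (card V) / real (card V)) \<longlongrightarrow> L) thermodynamic"
    by (rule filterlim_compose[OF L card_thermodynamic])
  moreover have "\<forall>\<^sub>F V in thermodynamic. z (card V) / real (card V)
      = ln (free_partition (telescoping \<beta>) V) / real (card V)"
    by (rule eventually_thermodynamic)
      (simp add: z_def free_partition_telescoping[OF assms] interval_free_weight[OF assms, symmetric]
         del: card_atLeastAtMost_int)
  ultimately have "((\<lambda>V. ln (free_partition (telescoping \<beta>) V) / real (card V)) \<longlongrightarrow> L) thermodynamic"
    by (rule Lim_transform_eventually)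
  moreover from this have "pressure (telescoping \<beta>) = L"
    unfolding pressure_def by (rule tendsto_Lim[OF thermodynamic_nontrivial])
  ultimately show ?thesis by simp
qed

section \<open>Good boundary conditions\<close>

lemma scale_attained:
  assumes "Inf (enat ` S) \<le> enat k"
  shows "\<exists>n\<in>S. n \<le> k"
proof -
  have ne: "enat ` S \<noteq> {}"
  proof
    assume "enat ` S = {}"
    then have "Inf (enat ` S) = \<infinity>" by (simp add: Inf_enat_def)
    then show False using assms by simp
  qed
  then have "Inf (enat ` S) \<in> enat ` S"
    unfolding Inf_enat_def by (auto intro: LeastI)
  then show ?thesis using assms by auto
qed

text \<open>
  With \<open>c\<close> minus spins among \<open>k\<close> the sum is \<open>k - 2 * c\<close>,
  and \<open>k - 2 * c \<ge> 8 / 9 * k\<close> means \<open>18 * c \<le> k\<close>.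
\<close>

lemma few_minus_of_average:
  fixes s :: "nat \<Rightarrow> real"
  assumes s: "\<And>j. s j = - 1 \<or> s j = 1" and \<alpha>: "1 < \<alpha>" and k: "1 \<le> k"
    and avg: "8 / 9 * \<alpha> \<le> 1 / real k * (\<Sum>j<k. s j)"
  shows "18 * card {j. j < k \<and> s j = - 1} \<le> k"
proof -
  have "(\<Sum>j<k. s j) = (\<Sum>j<k. 1 - 2 * of_bool (s j = - 1))"
  proof (rule sum.cong[OF refl])
    show "s j = 1 - 2 * of_bool (s j = - 1)" for j using s[of j] by auto
  qed
  also have "\<dots> = real k - 2 * real (card ({..<k} \<inter> {j. s j = - 1}))"
    by (simp add: sum_subtractf sum_distrib_left[symmetric])
  also have "{..<k} \<inter> {j. s j = - 1} = {j. j < k \<and> s j = - 1}" by auto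
  finally have sum: "(\<Sum>j<k. s j) = real k - 2 * real (card {j. j < k \<and> s j = - 1})" .
  have "8 / 9 * real k \<le> 8 / 9 * \<alpha> * real k" using \<alpha> k by simp
  also have "\<dots> \<le> (\<Sum>j<k. s j)" using avg k by (simp add: field_simps)
  finally have "18 * real (card {j. j < k \<and> s j = - 1}) \<le> real k" unfolding sum by simp
  then show ?thesis by linarith
qed

text \<open>
  The scale at a far site \<open>i\<close> is at most \<open>\<bar>i\<bar> powr (1 / 3)\<close>,
  hence at most \<open>k\<close> as soon as \<open>\<bar>i\<bar> \<le> k ^ 3\<close>.
\<close>

lemma good_config_density:
  assumes \<omega>: "\<omega> \<in> good_configs \<alpha>" and \<alpha>: "1 < \<alpha>"
  obtains N :: int where "1 \<le> N"
    "\<And>i k. N \<le> \<bar>i\<bar> \<Longrightarrow> \<bar>i\<bar> \<le> int k ^ 3 \<Longrightarrow> 18 * card ({m. \<omega> m = - 1} \<inter> {i..<i + int k}) \<le> k"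
    "\<And>i k. N \<le> \<bar>i\<bar> \<Longrightarrow> \<bar>i\<bar> \<le> int k ^ 3 \<Longrightarrow> 18 * card ({m. \<omega> m = - 1} \<inter> {i - int k<..i}) \<le> k"
proof -
  obtain \<epsilon> :: real and N where \<epsilon>: "0 < \<epsilon>" and N: "1 \<le> N" and \<omega>c: "\<omega> \<in> configs UNIV"
    and scales: "\<And>i. int N \<le> \<bar>i\<bar> \<Longrightarrow>
     ereal_of_enat (right_scale \<alpha> i \<omega>) \<le> ereal (real_of_int \<bar>i\<bar> powr (1 / (3 + \<epsilon>))) \<and>
     ereal_of_enat (left_scale \<alpha> i \<omega>) \<le> ereal (real_of_int \<bar>i\<bar> powr (1 / (3 + \<epsilon>)))"
    using \<omega> unfolding good_configs_def by blast
  have pm: "\<omega> j = - 1 \<or> \<omega> j = 1" for j using \<omega>c by (auto simp: configs_def PiE_iff)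
  have small: "x \<le> enat k" if "int N \<le> \<bar>i\<bar>" "\<bar>i\<bar> \<le> int k ^ 3"
    "ereal_of_enat x \<le> ereal (real_of_int \<bar>i\<bar> powr (1 / (3 + \<epsilon>)))" for x i k
  proof -
    have i1: "1 \<le> real_of_int \<bar>i\<bar>" using that(1) N by linarith
    have k1: "0 < real k" using that(1,2) N by (cases k) auto
    have "real_of_int \<bar>i\<bar> \<le> real_of_int (int k ^ 3)" using that(2) by (simp only: of_int_le_iff)
    then have i3: "real_of_int \<bar>i\<bar> \<le> real k powr 3" using k1 by (simp add: powr_numeral)
    have "real_of_int \<bar>i\<bar> powr (1 / (3 + \<epsilon>)) \<le> real_of_int \<bar>i\<bar> powr (1 / 3)"
      using i1 \<epsilon> by (intro powr_mono) (auto simp: field_simps)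
    also have "\<dots> \<le> (real k powr 3) powr (1 / 3)" using i1 i3 by (intro powr_mono2) auto
    also have "\<dots> = real k" unfolding powr_powr using k1 by simp
    finally have "ereal_of_enat x \<le> ereal (real k)"
      using that(3) by (meson ereal_less_eq(3) order_trans)
    then show ?thesis by (cases x) auto
  qed
  show thesis
  proof (rule that[of "int N"])
    show "1 \<le> int N" using N by simp
  next
    fix i k assume i: "int N \<le> \<bar>i\<bar>" "\<bar>i\<bar> \<le> int k ^ 3"
    then have k: "1 \<le> k" using N by (cases k) auto
    have "right_scale \<alpha> i \<omega> \<le> enat k" using small[OF i] scales[OF i(1)] by blast
    then obtain n where "n \<le> k" "\<forall>k\<ge>n. 8 / 9 * \<alpha> \<le> 1 / real k * (\<Sum>j<k. \<omega> (i + int j))"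
      unfolding right_scale_def using scale_attained by blast
    then have "8 / 9 * \<alpha> \<le> 1 / real k * (\<Sum>j<k. \<omega> (i + int j))" by blast
    from few_minus_of_average[OF pm \<alpha> k this]
    have "18 * card {j. j < k \<and> \<omega> (i + int j) = - 1} \<le> k" .
    moreover have "{m. \<omega> m = - 1} \<inter> {i..<i + int k} = (\<lambda>j. i + int j) ` {j. j < k \<and> \<omega> (i + int j) = - 1}"
    proof (intro equalityI subsetI)
      fix m assume "m \<in> {m. \<omega> m = - 1} \<inter> {i..<i + int k}"
      then show "m \<in> (\<lambda>j. i + int j) ` {j. j < k \<and> \<omega> (i + int j) = - 1}"
        by (intro image_eqI[of _ _ "nat (m - i)"]) auto
    qed auto
    ultimately show "18 * card ({m. \<omega> m = - 1} \<inter> {i..<i + int k}) \<le> k"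
      by (simp add: card_image inj_on_def)
  next
    fix i k assume i: "int N \<le> \<bar>i\<bar>" "\<bar>i\<bar> \<le> int k ^ 3"
    then have k: "1 \<le> k" using N by (cases k) auto
    have "left_scale \<alpha> i \<omega> \<le> enat k" using small[OF i] scales[OF i(1)] by blast
    then obtain n where "n \<le> k" "\<forall>k\<ge>n. 8 / 9 * \<alpha> \<le> 1 / real k * (\<Sum>j<k. \<omega> (i - int j))"
      unfolding left_scale_def using scale_attained by blast
    then have "8 / 9 * \<alpha> \<le> 1 / real k * (\<Sum>j<k. \<omega> (i - int j))" by blast
    from few_minus_of_average[OF pm \<alpha> k this]
    have "18 * card {j. j < k \<and> \<omega> (i - int j) = - 1} \<le> k" .
    moreover have "{m. \<omega> m = - 1} \<inter> {i - int k<..i} = (\<lambda>j. i - int j) ` {j. j < k \<and> \<omega> (i - int j) = - 1}"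
    proof (intro equalityI subsetI)
      fix m assume "m \<in> {m. \<omega> m = - 1} \<inter> {i - int k<..i}"
      then show "m \<in> (\<lambda>j. i - int j) ` {j. j < k \<and> \<omega> (i - int j) = - 1}"
        by (intro image_eqI[of _ _ "nat (i - m)"]) auto
    qed auto
    ultimately show "18 * card ({m. \<omega> m = - 1} \<inter> {i - int k<..i}) \<le> k"
      by (simp add: card_image inj_on_def)
  qed
qed

lemma le_cube: "2 \<le> k \<Longrightarrow> i \<le> 2 * int k \<Longrightarrow> i \<le> int k ^ 3"
proof -
  assume k: "2 \<le> k" and i: "i \<le> 2 * int k"
  have "int k * 2 \<le> int k * (int k * int k)"
  proof (rule mult_left_mono)
    have "2 * 1 \<le> int k * int k" using k by (intro mult_mono) auto
    then show "2 \<le> int k * int k" by simp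
  qed simp
  then show ?thesis using i by (simp add: power3_eq_cube mult_ac)
qed

text \<open>
  For \<open>j \<le> R\<close> and \<open>- R \<le> i\<close> the length splits as \<open>i - j
  = (R - j) + (i + R) - 2 * R\<close>, so the terms factorise.
\<close>

lemma two_sided_geometric_summable:
  assumes R: "0 \<le> R"
  shows "(\<lambda>(j, i). (1 / 2 :: real) ^ nat (i - j)) summable_on {(j, i). j \<le> R \<and> - R \<le> i \<and> j \<le> i}"
proof (rule nonneg_bdd_above_summable_on)
  let ?P = "{(j, i). j \<le> R \<and> - R \<le> i \<and> j \<le> (i :: int)}"
  let ?f = "\<lambda>(j, i). (1 / 2 :: real) ^ nat (i - j)"
  have eq: "?f (j, i) = 2 ^ nat (2 * R) * ((1 / 2) ^ nat \<bar>R - j\<bar> * (1 / 2) ^ nat \<bar>- R - i\<bar>)"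
    if "(j, i) \<in> ?P" for j i
  proof -
    have "nat \<bar>R - j\<bar> + nat \<bar>- R - i\<bar> = nat (2 * R) + nat (i - j)" using that R by auto
    then have "(1 / 2 :: real) ^ nat \<bar>R - j\<bar> * (1 / 2) ^ nat \<bar>- R - i\<bar> = (1 / 2) ^ nat (2 * R) * (1 / 2) ^ nat (i - j)"
      by (simp only: power_add[symmetric])
    then show ?thesis by (simp add: power_divide)
  qed
  show "bdd_above (sum ?f ` {F. F \<subseteq> ?P \<and> finite F})"
  proof (rule bdd_aboveI2)
    fix F assume F: "F \<in> {F. F \<subseteq> ?P \<and> finite F}"
    let ?h = "\<lambda>(j, i). 2 ^ nat (2 * R) * ((1 / 2 :: real) ^ nat \<bar>R - j\<bar> * (1 / 2) ^ nat \<bar>- R - i\<bar>)"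
    have "sum ?f F = sum ?h F"
      by (rule sum.cong[OF refl]) (use F eq in auto)
    also have "\<dots> \<le> sum ?h (fst ` F \<times> snd ` F)"
      by (rule sum_mono2) (use F in \<open>auto intro: rev_image_eqI\<close>)
    also have "\<dots> = 2 ^ nat (2 * R) * ((\<Sum>j\<in>fst ` F. (1 / 2) ^ nat \<bar>R - j\<bar>) * (\<Sum>i\<in>snd ` F. (1 / 2) ^ nat \<bar>- R - i\<bar>))"
      unfolding sum.cartesian_product[symmetric] sum_product by (simp only: sum_distrib_left)
    also have "\<dots> \<le> 2 ^ nat (2 * R) * ((4 * (1 / 2) ^ 0) * (4 * (1 / 2) ^ 0))"
      using F by (intro mult_left_mono mult_mono sum_half_powers_le sum_nonneg) auto
    finally show "sum ?f F \<le> 2 ^ nat (2 * R) * ((4 * (1 / 2) ^ 0) * (4 * (1 / 2) ^ 0))" .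
  qed
qed auto

text \<open>
  Outside finitely many intervals the energy decays geometrically in the length. Indeed an
  interval that meets \<open>V\<close> and has an end far away is at least half as long as that
  end is far, so \<open>good_config_density\<close> applies to it from this end, and the spins
  in \<open>V\<close> add a bounded number of minus sites. The slack between \<open>1 /
  18\<close> there and \<open>1 / 9\<close> in \<open>interval_energy_bound\<close> absorbs
  them.
\<close>

lemma telescoping_summable:
  assumes \<beta>: "36 \<le> \<beta>" and \<omega>: "\<omega> \<in> good_configs \<alpha>" and \<alpha>: "1 < \<alpha>"
    and V: "finite V" and \<sigma>: "\<sigma> \<in> configs V"
  shows "(\<lambda>A. telescoping \<beta> A (glue V \<sigma> \<omega>)) summable_on finite_meeting V"
proof -
  define \<xi> where "\<xi> = glue V \<sigma> \<omega>"
  define M where "M = {k. \<xi> k = - 1}"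
  have \<beta>0: "0 \<le> \<beta>" using \<beta> by simp
  have "\<omega> k = - 1 \<or> \<omega> k = 1" for k using \<omega> by (auto simp: good_configs_def configs_def PiE_iff)
  then have \<xi>: "\<xi> k = - 1 \<or> \<xi> k = 1" for k
    using \<sigma> by (auto simp: \<xi>_def override_on_def configs_def PiE_iff)
  obtain N where N: "1 \<le> N"
    and right: "\<And>i k. N \<le> \<bar>i\<bar> \<Longrightarrow> \<bar>i\<bar> \<le> int k ^ 3 \<Longrightarrow> 18 * card ({m. \<omega> m = - 1} \<inter> {i..<i + int k}) \<le> k"
    and left: "\<And>i k. N \<le> \<bar>i\<bar> \<Longrightarrow> \<bar>i\<bar> \<le> int k ^ 3 \<Longrightarrow> 18 * card ({m. \<omega> m = - 1} \<inter> {i - int k<..i}) \<le> k"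
    using good_config_density[OF \<omega> \<alpha>] by blast
  define R where "R = Max (insert 0 (abs ` V))"
  have R: "0 \<le> R" "\<bar>v\<bar> \<le> R" if "v \<in> V \<or> v = 0" for v
    using V that by (auto simp: R_def intro!: Max_ge)
  have R0: "0 \<le> R" using R(1)[of 0] by simp
  \<comment> \<open>an interval that meets \<open>V\<close> and leaves \<open>{- N'..N'}\<close> has length at least \<open>18 * card V\<close> and at least half the distance of its far end from \<open>0\<close>\<close>
  define N' where "N' = 2 * R + N + 18 * int (card V) + 4"
  define P where "P = {(j, i). j \<le> i \<and> {j..i} \<inter> V \<noteq> {}}"
  let ?I = "\<lambda>(j, i). {j..i::int}"
  let ?f = "\<lambda>(j, i). interval_energy \<beta> M j i"
  have PR: "j \<le> R \<and> - R \<le> i \<and> j \<le> i" if ji: "(j, i) \<in> P" for j i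
  proof -
    obtain v where "v \<in> V" "j \<le> v" "v \<le> i" using ji by (auto simp: P_def)
    then show ?thesis using R(2)[of v] by linarith
  qed
  have M_bound: "9 * card (M \<inter> {j<..<i}) \<le> k"
    if "M \<inter> {j<..<i} \<subseteq> ({m. \<omega> m = - 1} \<inter> X) \<union> V" "finite X" "18 * card ({m. \<omega> m = - 1} \<inter> X) \<le> k" "18 * card V \<le> k"
    for i j k X
  proof -
    have "card (M \<inter> {j<..<i}) \<le> card (({m. \<omega> m = - 1} \<inter> X) \<union> V)"
      using that(1) by (rule card_mono[rotated]) (use that V in auto)
    also have "\<dots> \<le> card ({m. \<omega> m = - 1} \<inter> X) + card V" by (rule card_Un_le)
    finally show ?thesis using that(3,4) by linarith
  qed
  have M_sub: "M \<subseteq> {m. \<omega> m = - 1} \<union> V" by (auto simp: M_def \<xi>_def override_on_def)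
  have far: "\<bar>interval_energy \<beta> M j i\<bar> \<le> 16 * exp (32 * \<beta>) * (1 / 2) ^ nat (i - j)"
    if ji: "(j, i) \<in> P" and out: "\<not> (\<bar>j\<bar> \<le> N' \<and> \<bar>i\<bar> \<le> N')" for j i
  proof -
    define k where "k = nat (i - j)"
    note PR[OF ji]
    have k: "2 \<le> k" "18 * card V \<le> k" "j < i" "int k = i - j"
      and cases: "N \<le> \<bar>j\<bar> \<and> \<bar>j\<bar> \<le> 2 * int k \<or> N \<le> \<bar>i\<bar> \<and> \<bar>i\<bar> \<le> 2 * int k"
      using PR[OF ji] out N R0 unfolding k_def N'_def by linarith+
    have "9 * card (M \<inter> {j<..<i}) \<le> k"
      using cases
    proof (elim disjE conjE)
      assume *: "N \<le> \<bar>j\<bar>" "\<bar>j\<bar> \<le> 2 * int k"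
      show ?thesis
        by (rule M_bound[OF _ _ right[OF *(1) le_cube[OF k(1) *(2)]] k(2)]) (use M_sub k in auto)
    next
      assume *: "N \<le> \<bar>i\<bar>" "\<bar>i\<bar> \<le> 2 * int k"
      show ?thesis
        by (rule M_bound[OF _ _ left[OF *(1) le_cube[OF k(1) *(2)]] k(2)]) (use M_sub k in auto)
    qed
    then show ?thesis by (intro interval_energy_bound \<beta> k) (simp add: k_def)
  qed
  define P0 where "P0 = P \<inter> {- N'..N'} \<times> {- N'..N'}"
  have "?f summable_on P0" by (rule summable_on_finite) (simp add: P0_def)
  moreover have "?f summable_on (P - P0)"
  proof -
    have "(\<lambda>(j, i). 16 * exp (32 * \<beta>) * (1 / 2) ^ nat (i - j)) summable_on {(j, i). j \<le> R \<and> - R \<le> i \<and> j \<le> i}"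
      using summable_on_cmult_right[OF two_sided_geometric_summable[OF R0], of "16 * exp (32 * \<beta>)"]
      by (simp add: case_prod_unfold)
    then have "(\<lambda>(j, i). 16 * exp (32 * \<beta>) * (1 / 2) ^ nat (i - j)) summable_on (P - P0)"
      by (rule summable_on_subset) (use PR in auto)
    then have "(\<lambda>x. norm (?f x)) summable_on (P - P0)"
    proof (rule summable_on_comparison_test)
      fix x assume x: "x \<in> P - P0"
      obtain j i where ji: "x = (j, i)" by (cases x)
      have "(j, i) \<in> P" "\<not> (\<bar>j\<bar> \<le> N' \<and> \<bar>i\<bar> \<le> N')" using x by (auto simp: ji P0_def)
      from far[OF this] show "norm (?f x) \<le> (case x of (j, i) \<Rightarrow> 16 * exp (32 * \<beta>) * (1 / 2) ^ nat (i - j))"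
        by (simp add: ji)
    qed simp
    then show ?thesis by (rule abs_summable_summable)
  qed
  ultimately have "?f summable_on (P0 \<union> (P - P0))" by (rule summable_on_union)
  moreover have "P0 \<union> (P - P0) = P" by (auto simp: P0_def)
  ultimately have "?f summable_on P" by simp
  then have "((\<lambda>A. telescoping \<beta> A \<xi>) \<circ> ?I) summable_on P"
    by (rule summable_on_cong[THEN iffD1, rotated])
       (auto simp: P_def M_def telescoping_interval[OF _ \<xi> \<beta>0])
  moreover have "inj_on ?I P" by (auto simp: inj_on_def P_def)
  ultimately have "(\<lambda>A. telescoping \<beta> A \<xi>) summable_on (?I ` P)"
    by (subst summable_on_reindex)
  then have "(\<lambda>A. telescoping \<beta> A \<xi>) summable_on finite_meeting V"
  proof (rule summable_on_cong_neutral[THEN iffD1, rotated -1])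
    fix A assume A: "A \<in> finite_meeting V - ?I ` P"
    show "telescoping \<beta> A \<xi> = 0"
    proof (rule telescoping_not_interval)
      fix j i :: int assume "j \<le> i"
      show "A \<noteq> {j..i}"
      proof
        assume "A = {j..i}"
        moreover from this have "(j, i) \<in> P"
          using A \<open>j \<le> i\<close> by (auto simp: P_def finite_meeting_def)
        ultimately have "A \<in> ?I ` P" by (auto intro!: image_eqI[of _ _ "(j, i)"])
        then show False using A by blast
      qed
    qed
  next
    fix A assume "A \<in> ?I ` P - finite_meeting V"
    then show "telescoping \<beta> A \<xi> = 0" by (auto simp: P_def finite_meeting_def)
  qed simp
  then show ?thesis by (simp add: \<xi>_def)
qed

section \<open>The pressure with a good boundary condition\<close>

definition left_minus :: "int set \<Rightarrow> int \<Rightarrow> nat \<Rightarrow> int set" where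
  "left_minus M a D = M \<inter> {a - int D..<a}"

definition right_minus :: "int set \<Rightarrow> int \<Rightarrow> nat \<Rightarrow> int set" where
  "right_minus M b D = M \<inter> {b<..b + int D}"

lemma finite_side_minus [simp]: "finite (left_minus M a D)" "finite (right_minus M b D)"
  by (simp_all add: left_minus_def right_minus_def)

lemma left_minus_0 [simp]: "left_minus M a 0 = {}" and right_minus_0 [simp]: "right_minus M b 0 = {}"
  by (auto simp: left_minus_def right_minus_def)

lemma side_minus_Suc:
  "left_minus M a (Suc D) = (if a - int (Suc D) \<in> M then insert (a - int (Suc D)) (left_minus M a D) else left_minus M a D)"
  "right_minus M b (Suc D) = (if b + int (Suc D) \<in> M then insert (b + int (Suc D)) (right_minus M b D) else right_minus M b D)"
proof -
  have "{a - int (Suc D)..<a} = insert (a - int (Suc D)) {a - int D..<a}"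
    "{b<..b + int (Suc D)} = insert (b + int (Suc D)) {b<..b + int D}" by auto
  then show "left_minus M a (Suc D) = (if a - int (Suc D) \<in> M then insert (a - int (Suc D)) (left_minus M a D) else left_minus M a D)"
    "right_minus M b (Suc D) = (if b + int (Suc D) \<in> M then insert (b + int (Suc D)) (right_minus M b D) else right_minus M b D)"
    unfolding left_minus_def right_minus_def by auto
qed

text \<open>
  The partition function of \<open>{a..b}\<close> with boundary spins minus on \<open>M\<close>,
  when only the energies of intervals within distance \<open>D\<close> of \<open>{a..b}\<close>
  are taken into account.
\<close>

definition window_ratio :: "real \<Rightarrow> int set \<Rightarrow> int \<Rightarrow> int \<Rightarrow> nat \<Rightarrow> real" where
  "window_ratio \<beta> M a b D = free_weight \<beta> {a..b} (left_minus M a D \<union> right_minus M b D)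
     / (layer_weight \<beta> (left_minus M a D) * layer_weight \<beta> (right_minus M b D))"

text \<open>
  An interval in the window that misses \<open>{a..b}\<close> lies on one side of it. So the
  energies of the intervals that meet \<open>{a..b}\<close> are those of the whole window minus
  those of its two sides, and all three sums are logarithms of layer weights. Summability makes
  these partial sums converge to the infinite sum.
\<close>

lemma bc_partition_window_limit:
  assumes \<beta>: "36 \<le> \<beta>" and \<omega>: "\<omega> \<in> good_configs \<alpha>" and \<alpha>: "1 < \<alpha>" and ab: "a \<le> b"
  shows "window_ratio \<beta> {m. \<omega> m = - 1} a b \<longlonglongrightarrow> bc_partition (telescoping \<beta>) \<omega> {a..b}"
proof -
  let ?V = "{a..b}"
  define M where "M = {m. \<omega> m = - 1}"
  define l where "l = left_minus M a"
  define r where "r = right_minus M b"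
  define W where "W D = {a - int D..b + int D}" for D
  define F where "F D = {A \<in> Pow (W D). A \<inter> ?V \<noteq> {}}" for D
  have \<beta>0: "0 \<le> \<beta>" using \<beta> by simp
  have pm: "\<omega> k = - 1 \<or> \<omega> k = 1" for k using \<omega> by (auto simp: good_configs_def configs_def PiE_iff)
  have term_limit: "(\<lambda>D. layer_weight \<beta> (J \<union> (l D \<union> r D)) / (layer_weight \<beta> (l D) * layer_weight \<beta> (r D)))
     \<longlonglongrightarrow> exp (- (\<Sum>\<^sub>\<infinity>A\<in>finite_meeting ?V. telescoping \<beta> A (glue ?V (spins ?V J) \<omega>)))"
    if J: "J \<subseteq> ?V" for J
  proof -
    define \<xi> where "\<xi> = glue ?V (spins ?V J) \<omega>"
    have \<xi>: "\<xi> k = - 1 \<or> \<xi> k = 1" for k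
      using pm[of k] by (auto simp: \<xi>_def override_on_def spins_def)
    have \<sigma>: "spins ?V J \<in> configs ?V" by (auto simp: configs_def spins_def)
    have minus: "{k. \<xi> k = - 1} = J \<union> (M - ?V)"
      using J by (auto simp: \<xi>_def override_on_def spins_def M_def split: if_splits)
    let ?U = "\<lambda>A. telescoping \<beta> A \<xi>"
    have sum_F: "sum ?U (F D) = - ln (layer_weight \<beta> (J \<union> (l D \<union> r D)))
        + ln (layer_weight \<beta> (l D)) + ln (layer_weight \<beta> (r D))" for D
    proof -
      let ?L = "{a - int D..a - 1}" and ?R = "{b + 1..b + int D}"
      have U0: "?U {} = 0" by (simp add: telescoping_def)
      have "sum ?U (Pow (W D)) = sum ?U (F D) + sum ?U (Pow (?L \<union> ?R))"
      proof -
        have "W D - ?V = ?L \<union> ?R" using ab by (auto simp: W_def)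
        then have split: "Pow (W D) = F D \<union> Pow (?L \<union> ?R)" and disj: "F D \<inter> Pow (?L \<union> ?R) = {}"
          unfolding F_def W_def by auto
        show ?thesis
          unfolding split by (rule sum.union_disjoint[OF _ _ disj]) (simp_all add: F_def W_def)
      qed
      moreover have "sum ?U (Pow (?L \<union> ?R)) = sum ?U (Pow ?L \<union> Pow ?R)"
      proof (rule sum.mono_neutral_right)
        show "\<forall>A\<in>Pow (?L \<union> ?R) - (Pow ?L \<union> Pow ?R). ?U A = 0"
        proof
          fix A assume A: "A \<in> Pow (?L \<union> ?R) - (Pow ?L \<union> Pow ?R)"
          then obtain x y where mem: "x \<in> A" "y \<in> A" and "x \<in> ?R" "y \<in> ?L" by blast
          moreover have "a \<notin> ?L \<union> ?R" using ab by simp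
          then have "a \<notin> A" using A by blast
          ultimately have xy: "x \<in> A" "b < x" "y \<in> A" "y < a" "a \<notin> A" by simp_all
          show "?U A = 0"
          proof (rule telescoping_not_interval)
            show "A \<noteq> {j..i}" for j i using xy ab by auto
          qed
        qed
      qed auto
      moreover have "sum ?U (Pow ?L \<union> Pow ?R) + sum ?U (Pow ?L \<inter> Pow ?R) = sum ?U (Pow ?L) + sum ?U (Pow ?R)"
        by (rule sum.union_inter) auto
      moreover have "sum ?U (Pow ?L \<inter> Pow ?R) = 0"
      proof -
        have "Pow ?L \<inter> Pow ?R = {{}}" using ab by fastforce
        then show ?thesis by (simp add: U0)
      qed
      moreover have "{k. \<xi> k = - 1} \<inter> W D = J \<union> (l D \<union> r D)" "{k. \<xi> k = - 1} \<inter> ?L = l D" "{k. \<xi> k = - 1} \<inter> ?R = r D"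
      proof -
        have L: "?L = {a - int D..<a}" "?R = {b<..b + int D}" by auto
        have W: "W D = ?V \<union> ({a - int D..<a} \<union> {b<..b + int D})"
          unfolding W_def using ab by (intro set_eqI) (simp, linarith)
        have d: "?V \<inter> {a - int D..<a} = {}" "?V \<inter> {b<..b + int D} = {}" by auto
        show "{k. \<xi> k = - 1} \<inter> W D = J \<union> (l D \<union> r D)" "{k. \<xi> k = - 1} \<inter> ?L = l D" "{k. \<xi> k = - 1} \<inter> ?R = r D"
          unfolding minus l_def r_def left_minus_def right_minus_def W L using J d by blast+
      qed
      then have "sum ?U (Pow (W D)) = - ln (layer_weight \<beta> (J \<union> (l D \<union> r D)))"
        "sum ?U (Pow ?L) = - ln (layer_weight \<beta> (l D))" "sum ?U (Pow ?R) = - ln (layer_weight \<beta> (r D))"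
        unfolding W_def using sum_telescoping[of _ _ \<xi> \<beta>] \<xi> \<beta>0 by simp_all
      ultimately show ?thesis by linarith
    qed
    have "filterlim F (finite_subsets_at_top (finite_meeting ?V)) sequentially"
      unfolding filterlim_finite_subsets_at_top
    proof (intro allI impI)
      fix X assume X: "finite X \<and> X \<subseteq> finite_meeting ?V"
      define B where "B = Max (insert 0 (abs ` \<Union>X)) + \<bar>a\<bar> + \<bar>b\<bar>"
      have finX: "finite (\<Union>X)" using X by (auto simp: finite_meeting_def)
      show "\<forall>\<^sub>F D in sequentially. finite (F D) \<and> X \<subseteq> F D \<and> F D \<subseteq> finite_meeting ?V"
      proof (rule eventually_sequentiallyI[of "nat B"], intro conjI)
        fix D assume D: "nat B \<le> D"
        show "finite (F D)" by (simp add: F_def W_def)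
        show "F D \<subseteq> finite_meeting ?V"
          by (auto simp: F_def W_def finite_meeting_def intro: finite_subset)
        show "X \<subseteq> F D"
        proof
          fix A assume A: "A \<in> X"
          have "A \<subseteq> W D"
          proof
            fix k assume "k \<in> A"
            then have "\<bar>k\<bar> \<le> Max (insert 0 (abs ` \<Union>X))" using A finX by (intro Max_ge) auto
            then have "\<bar>k\<bar> + \<bar>a\<bar> + \<bar>b\<bar> \<le> int D" using D unfolding B_def by linarith
            then show "k \<in> W D" unfolding W_def by auto
          qed
          then show "A \<in> F D" using A X by (auto simp: F_def finite_meeting_def)
        qed
      qed
    qed
    moreover have "?U summable_on finite_meeting ?V"
      unfolding \<xi>_def by (rule telescoping_summable[OF \<beta> \<omega> \<alpha> _ \<sigma>]) simp
    ultimately have "(\<lambda>D. sum ?U (F D)) \<longlonglongrightarrow> infsum ?U (finite_meeting ?V)"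
      using filterlim_compose[OF infsum_tendsto] by blast
    then have "(\<lambda>D. exp (- sum ?U (F D))) \<longlonglongrightarrow> exp (- infsum ?U (finite_meeting ?V))"
      by (intro tendsto_exp tendsto_minus)
    moreover have "exp (- sum ?U (F D))
        = layer_weight \<beta> (J \<union> (l D \<union> r D)) / (layer_weight \<beta> (l D) * layer_weight \<beta> (r D))" for D
    proof -
      have "finite J" using J finite_subset by blast
      then have "0 < layer_weight \<beta> (J \<union> (l D \<union> r D))" "0 < layer_weight \<beta> (l D)" "0 < layer_weight \<beta> (r D)"
        using \<beta>0 by (auto simp: l_def r_def intro!: layer_weight_pos)
      then show ?thesis unfolding sum_F by (simp add: exp_diff exp_minus field_simps exp_add)
    qed
    ultimately show ?thesis by (simp add: \<xi>_def)
  qed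
  have "(\<lambda>D. \<Sum>J\<in>Pow ?V. layer_weight \<beta> (J \<union> (l D \<union> r D)) / (layer_weight \<beta> (l D) * layer_weight \<beta> (r D)))
     \<longlonglongrightarrow> (\<Sum>J\<in>Pow ?V. exp (- (\<Sum>\<^sub>\<infinity>A\<in>finite_meeting ?V. telescoping \<beta> A (glue ?V (spins ?V J) \<omega>))))"
    by (intro tendsto_sum term_limit) auto
  moreover have "(\<Sum>J\<in>Pow ?V. layer_weight \<beta> (J \<union> (l D \<union> r D)) / (layer_weight \<beta> (l D) * layer_weight \<beta> (r D)))
      = window_ratio \<beta> M a b D" for D
    by (simp add: window_ratio_def free_weight_def l_def r_def sum_divide_distrib)
  moreover have "bc_partition (telescoping \<beta>) \<omega> ?V
      = (\<Sum>J\<in>Pow ?V. exp (- (\<Sum>\<^sub>\<infinity>A\<in>finite_meeting ?V. telescoping \<beta> A (glue ?V (spins ?V J) \<omega>))))"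
  proof -
    have "bc_partition (telescoping \<beta>) \<omega> ?V
      = (\<Sum>J | J \<subseteq> ?V \<and> True. exp (- (\<Sum>\<^sub>\<infinity>A\<in>finite_meeting ?V. telescoping \<beta> A (glue ?V (spins ?V J) \<omega>))))"
      unfolding bc_partition_def using sum_configs[where V = ?V and R = "\<lambda>_. True"] by simp
    then show ?thesis by (simp add: Pow_def)
  qed
  ultimately show ?thesis by (simp add: M_def)
qed

text \<open>
  Minus spins inside, to the left and to the right attract each other.
\<close>

lemma window_ratio_ge:
  assumes "0 \<le> \<beta>" and ab: "a \<le> b"
  shows "free_weight \<beta> {a..b} {} \<le> window_ratio \<beta> M a b D"
proof -
  let ?l = "left_minus M a D" and ?r = "right_minus M b D"
  have pos: "0 < layer_weight \<beta> ?l" "0 < layer_weight \<beta> ?r"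
    using assms by (auto intro!: layer_weight_pos)
  have "layer_weight \<beta> (J \<union> {}) * (layer_weight \<beta> ?l * layer_weight \<beta> ?r) \<le> layer_weight \<beta> (J \<union> (?l \<union> ?r))"
    if J: "J \<subseteq> {a..b}" for J
  proof -
    have fin: "finite J" using J finite_subset by blast
    have d: "?l \<inter> ?r = {}" "J \<inter> (?l \<union> ?r) = {}"
      using J ab by (auto simp: left_minus_def right_minus_def)
    have "layer_weight \<beta> ?l * layer_weight \<beta> ?r \<le> layer_weight \<beta> (?l \<union> ?r)"
      using layer_weight_supermodular[of ?l ?r \<beta>] d assms(1) by simp
    then have "layer_weight \<beta> J * (layer_weight \<beta> ?l * layer_weight \<beta> ?r)
        \<le> layer_weight \<beta> J * layer_weight \<beta> (?l \<union> ?r)"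
      using layer_weight_pos[OF fin assms(1)] by (intro mult_left_mono) auto
    also have "\<dots> \<le> layer_weight \<beta> (J \<union> (?l \<union> ?r))"
      using layer_weight_supermodular[of J "?l \<union> ?r" \<beta>] d fin assms(1) by simp
    finally show ?thesis by simp
  qed
  then have "free_weight \<beta> {a..b} {} * (layer_weight \<beta> ?l * layer_weight \<beta> ?r) \<le> free_weight \<beta> {a..b} (?l \<union> ?r)"
    unfolding free_weight_def sum_distrib_right by (intro sum_mono) auto
  then show ?thesis
    unfolding window_ratio_def using pos by (simp add: pos_le_divide_eq)
qed

text \<open>
  The effect of a new minus spin at \<open>m\<close> in the presence of free spins in
  \<open>V\<close> and minus spins in \<open>T\<close> is compared with its effect when
  \<open>V\<close> and \<open>T\<close> are plus. The first bound holds since the effect of one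
  spin is bounded; the second one uses that all of \<open>V\<close> and \<open>T\<close> is far
  from \<open>m\<close>.
\<close>

lemma add_minus_site:
  assumes \<beta>: "36 \<le> \<beta>" and fin: "finite V" "finite T" "finite K"
    and disj: "V \<inter> (T \<union> K) = {}" "T \<inter> K = {}" "m \<notin> V \<union> (T \<union> K)"
    and far: "\<And>v. v \<in> V \<union> T \<Longrightarrow> D \<le> nat \<bar>m - v\<bar>"
  shows "free_weight \<beta> V (insert m (T \<union> K)) * layer_weight \<beta> K
      \<le> exp (16 * \<beta>) * (free_weight \<beta> V (T \<union> K) * layer_weight \<beta> (insert m K))"
    and "9 * card (T \<union> K) \<le> D \<Longrightarrow> free_weight \<beta> V (insert m (T \<union> K)) * layer_weight \<beta> K
      \<le> exp (16 * exp (32 * \<beta>) * (4 * (1 / 2) ^ D)) * (free_weight \<beta> V (T \<union> K) * layer_weight \<beta> (insert m K))"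
proof -
  let ?g = "layer_weight \<beta>" and ?L = "T \<union> K"
  have \<beta>0: "0 \<le> \<beta>" using \<beta> by simp
  have pos: "0 < free_weight \<beta> V ?L" "0 < free_weight \<beta> V (insert m ?L)" "0 < ?g K" "0 < ?g (insert m K)"
    "0 < ?g ?L" "0 < ?g (insert m ?L)"
    using fin \<beta>0 by (auto intro!: free_weight_pos layer_weight_pos)
  have "free_weight \<beta> V (insert m ?L) \<le> exp (8 * \<beta>) * free_weight \<beta> V ?L"
    unfolding free_weight_def sum_distrib_left
  proof (rule sum_mono)
    fix J assume "J \<in> Pow V"
    then have "finite (J \<union> ?L)" using fin finite_subset[of J V] by auto
    from layer_weight_insert(1)[OF this \<beta>0, of m]
    show "?g (J \<union> insert m ?L) \<le> exp (8 * \<beta>) * ?g (J \<union> ?L)" by simp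
  qed
  moreover have "?g K \<le> exp (8 * \<beta>) * ?g (insert m K)" by (rule layer_weight_insert(2)[OF fin(3) \<beta>0])
  ultimately have "free_weight \<beta> V (insert m ?L) * ?g K
      \<le> (exp (8 * \<beta>) * free_weight \<beta> V ?L) * (exp (8 * \<beta>) * ?g (insert m K))"
    using pos by (intro mult_mono) auto
  also have "\<dots> = (exp (8 * \<beta>) * exp (8 * \<beta>)) * (free_weight \<beta> V ?L * ?g (insert m K))" by (simp only: mult_ac)
  also have "exp (8 * \<beta>) * exp (8 * \<beta>) = exp (16 * \<beta>)" by (simp add: exp_add[symmetric])
  finally show "free_weight \<beta> V (insert m ?L) * ?g K \<le> exp (16 * \<beta>) * (free_weight \<beta> V ?L * ?g (insert m K))" .
  assume few: "9 * card ?L \<le> D"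
  define C where "C = 16 * exp (32 * \<beta>)"
  have few': "9 * card ?L \<le> nat \<bar>m - v\<bar>" if "v \<in> V \<union> T" for v
    using far[OF that] few by linarith
  let ?S = "\<lambda>X. \<Sum>v\<in>X. (1 / 2 :: real) ^ nat \<bar>m - v\<bar>"
  have A: "free_weight \<beta> V (insert m ?L) * ?g ?L \<le> exp (C * ?S V) * (free_weight \<beta> V ?L * ?g (insert m ?L))"
    unfolding C_def using fin disj few' by (intro free_layer_influence \<beta>) auto
  have B: "?g (insert m ?L) * ?g K \<le> exp (C * ?S T) * (?g ?L * ?g (insert m K))"
    unfolding C_def using fin disj few' by (intro boundary_influence \<beta>) auto
  have "V \<inter> T = {}" using disj by auto
  then have "?S V + ?S T = ?S (V \<union> T)" using fin by (simp add: sum.union_disjoint)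
  also have "\<dots> \<le> 4 * (1 / 2) ^ D" using fin by (intro sum_half_powers_le far) auto
  finally have "C * (?S V + ?S T) \<le> C * (4 * (1 / 2) ^ D)" by (intro mult_left_mono) (simp_all add: C_def)
  then have S: "exp (C * ?S V) * exp (C * ?S T) \<le> exp (C * (4 * (1 / 2) ^ D))"
    by (simp add: exp_add[symmetric] distrib_left)
  have "(free_weight \<beta> V (insert m ?L) * ?g K) * ?g ?L = (free_weight \<beta> V (insert m ?L) * ?g ?L) * ?g K"
    by (simp only: mult_ac)
  also have "\<dots> \<le> (exp (C * ?S V) * (free_weight \<beta> V ?L * ?g (insert m ?L))) * ?g K"
    using A pos by (intro mult_right_mono) auto
  also have "\<dots> = (exp (C * ?S V) * free_weight \<beta> V ?L) * (?g (insert m ?L) * ?g K)" by (simp only: mult_ac)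
  also have "\<dots> \<le> (exp (C * ?S V) * free_weight \<beta> V ?L) * (exp (C * ?S T) * (?g ?L * ?g (insert m K)))"
    using B pos by (intro mult_left_mono) auto
  also have "\<dots> = (exp (C * ?S V) * exp (C * ?S T) * (free_weight \<beta> V ?L * ?g (insert m K))) * ?g ?L"
    by (simp only: mult_ac)
  finally have "free_weight \<beta> V (insert m ?L) * ?g K
      \<le> exp (C * ?S V) * exp (C * ?S T) * (free_weight \<beta> V ?L * ?g (insert m K))"
    using pos(5) by (simp only: mult_le_cancel_right_pos)
  also have "\<dots> \<le> exp (C * (4 * (1 / 2) ^ D)) * (free_weight \<beta> V ?L * ?g (insert m K))"
    using S pos by (intro mult_right_mono) auto
  finally show "free_weight \<beta> V (insert m ?L) * ?g K
      \<le> exp (16 * exp (32 * \<beta>) * (4 * (1 / 2) ^ D)) * (free_weight \<beta> V ?L * ?g (insert m K))"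
    by (simp add: C_def)
qed

text \<open>
  The exponent for a new boundary spin at distance \<open>D\<close> from an interval of
  \<open>c\<close> sites. If \<open>D\<^sup>2 > c\<close> then \<open>c + D \<le> D ^ 3\<close>,
  and the windows of length \<open>D\<close> next to the interval contain few minus spins.
\<close>

definition step_cost :: "real \<Rightarrow> nat \<Rightarrow> nat \<Rightarrow> real" where
  "step_cost \<beta> c D = (if D\<^sup>2 \<le> c then 16 * \<beta> else 16 * exp (32 * \<beta>) * (4 * (1 / 2) ^ D))"

lemma sum_step_cost_le:
  assumes "0 \<le> \<beta>"
  shows "(\<Sum>k=1..D. step_cost \<beta> c k) \<le> 16 * \<beta> * sqrt (real c) + 64 * exp (32 * \<beta>)"
proof -
  have "(\<Sum>k=1..D. step_cost \<beta> c k)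
     \<le> (\<Sum>k=1..D. 16 * \<beta> * of_bool (k\<^sup>2 \<le> c) + 16 * exp (32 * \<beta>) * (4 * (1 / 2) ^ k))"
    by (rule sum_mono) (simp add: step_cost_def assms)
  also have "\<dots> = 16 * \<beta> * real (card ({1..D} \<inter> {k. k\<^sup>2 \<le> c})) + 64 * exp (32 * \<beta>) * (\<Sum>k=1..D. (1 / 2) ^ k)"
    by (simp add: sum.distrib sum_distrib_left[symmetric])
  also have "\<dots> \<le> 16 * \<beta> * sqrt (real c) + 64 * exp (32 * \<beta>) * 1"
  proof (intro add_mono mult_left_mono)
    have "{1..D} \<inter> {k. k\<^sup>2 \<le> c} \<subseteq> {1..nat \<lfloor>sqrt (real c)\<rfloor>}"
    proof
      fix k assume k: "k \<in> {1..D} \<inter> {k. k\<^sup>2 \<le> c}"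
      then have "(real k)\<^sup>2 \<le> real c" by (simp add: of_nat_power[symmetric] del: of_nat_power)
      then have "real k \<le> sqrt (real c)" by (rule real_le_rsqrt)
      then have "k \<le> nat \<lfloor>sqrt (real c)\<rfloor>" by (simp add: le_nat_floor)
      then show "k \<in> {1..nat \<lfloor>sqrt (real c)\<rfloor>}" using k by auto
    qed
    then have "card ({1..D} \<inter> {k. k\<^sup>2 \<le> c}) \<le> nat \<lfloor>sqrt (real c)\<rfloor>"
      using card_mono[of "{1..nat \<lfloor>sqrt (real c)\<rfloor>}" "{1..D} \<inter> {k. k\<^sup>2 \<le> c}"] by simp
    then have "real (card ({1..D} \<inter> {k. k\<^sup>2 \<le> c})) \<le> real (nat \<lfloor>sqrt (real c)\<rfloor>)"
      by (simp only: of_nat_le_iff)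
    also have "\<dots> \<le> sqrt (real c)" by (simp add: of_nat_floor)
    finally show "real (card ({1..D} \<inter> {k. k\<^sup>2 \<le> c})) \<le> sqrt (real c)" .
    have "(\<Sum>k=1..D. (1 / 2 :: real) ^ k) + (1 / 2) ^ D = 1" by (induction D) auto
    moreover have "(0::real) \<le> (1 / 2) ^ D" by simp
    ultimately show "(\<Sum>k=1..D. (1 / 2 :: real) ^ k) \<le> 1" by linarith
  qed (use assms in auto)
  finally show ?thesis by simp
qed

text \<open>
  A window of length \<open>k = Suc D\<close> on either side is seen from its outer end, whose
  distance from the origin is at most \<open>c + k\<close> for an interval of \<open>c\<close>
  sites. If \<open>k\<^sup>2 > c\<close>, both windows together contain at most \<open>2 * k /
  18 = k / 9\<close> minus spins, exactly the amount that \<open>add_minus_site\<close>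
  tolerates at distance \<open>k\<close>.
\<close>

lemma window_ratio_step:
  assumes \<beta>: "36 \<le> \<beta>" and N: "1 \<le> N" "a \<le> - N" "N \<le> b"
    and right: "\<And>i k. N \<le> \<bar>i\<bar> \<Longrightarrow> \<bar>i\<bar> \<le> int k ^ 3 \<Longrightarrow> 18 * card (M \<inter> {i..<i + int k}) \<le> k"
    and left: "\<And>i k. N \<le> \<bar>i\<bar> \<Longrightarrow> \<bar>i\<bar> \<le> int k ^ 3 \<Longrightarrow> 18 * card (M \<inter> {i - int k<..i}) \<le> k"
  shows "window_ratio \<beta> M a b (Suc D) \<le> window_ratio \<beta> M a b D * exp (2 * step_cost \<beta> (card {a..b}) (Suc D))"
proof -
  let ?V = "{a..b}" and ?g = "layer_weight \<beta>" and ?c = "card {a..b}"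
  define l l' r r' where "l = left_minus M a D" and "l' = left_minus M a (Suc D)"
    and "r = right_minus M b D" and "r' = right_minus M b (Suc D)"
  define e where "e = step_cost \<beta> ?c (Suc D)"
  have \<beta>0: "0 \<le> \<beta>" using \<beta> by simp
  have e: "0 \<le> e" using \<beta>0 by (simp add: e_def step_cost_def)
  have fin: "finite l" "finite l'" "finite r" "finite r'"
    by (simp_all add: l_def l'_def r_def r'_def)
  have pos: "0 < ?g l" "0 < ?g l'" "0 < ?g r" "0 < ?g r'"
    "0 < free_weight \<beta> ?V (l \<union> r)" "0 < free_weight \<beta> ?V (l' \<union> r)" "0 < free_weight \<beta> ?V (l' \<union> r')"
    using fin \<beta>0 by (auto intro!: layer_weight_pos free_weight_pos)
  have sub: "l \<subseteq> l'" "r \<subseteq> r'"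
    by (auto simp: l_def l'_def r_def r'_def left_minus_def right_minus_def)
  have few: "9 * card X \<le> Suc D" if X: "X \<subseteq> l' \<union> r'" and big: "\<not> (Suc D)\<^sup>2 \<le> ?c" for X
  proof -
    have cube: "int ?c + int (Suc D) \<le> int (Suc D) ^ 3"
    proof -
      have "c + d \<le> d ^ 3" if "\<not> d\<^sup>2 \<le> c" "1 \<le> d" for c d :: nat
      proof -
        have "d * (c + 1) \<le> d * d\<^sup>2" using that by (intro mult_left_mono) auto
        moreover have "1 * c \<le> d * c" using that(2) by (rule mult_right_mono) simp
        moreover have "d * d\<^sup>2 = d ^ 3" by (simp add: power3_eq_cube power2_eq_square)
        moreover have "d * (c + 1) = d * c + d" by simp
        ultimately show ?thesis by linarith
      qed
      from this[OF big] have "?c + Suc D \<le> Suc D ^ 3" by simp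
      then have "int (?c + Suc D) \<le> int (Suc D ^ 3)" by (simp only: of_nat_le_iff)
      then show ?thesis by simp
    qed
    have "18 * card (M \<inter> {a - int (Suc D)..<a - int (Suc D) + int (Suc D)}) \<le> Suc D"
      by (rule right) (use N cube in auto)
    moreover have "18 * card (M \<inter> {b + int (Suc D) - int (Suc D)<..b + int (Suc D)}) \<le> Suc D"
      by (rule left) (use N cube in auto)
    moreover have "card X \<le> card (l' \<union> r')" using X fin by (intro card_mono) auto
    moreover have "card (l' \<union> r') \<le> card l' + card r'" by (rule card_Un_le)
    ultimately show ?thesis by (simp add: l'_def r'_def left_minus_def right_minus_def)
  qed
  have L: "free_weight \<beta> ?V (l' \<union> r) * ?g l \<le> exp e * (free_weight \<beta> ?V (l \<union> r) * ?g l')"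
  proof (cases "a - int (Suc D) \<in> M")
    case True
    then have l': "l' = insert (a - int (Suc D)) l" unfolding l'_def l_def side_minus_Suc(1) by simp
    have disj: "?V \<inter> (r \<union> l) = {}" "r \<inter> l = {}" "a - int (Suc D) \<notin> ?V \<union> (r \<union> l)"
      using N by (auto simp: l_def r_def left_minus_def right_minus_def)
    have far: "Suc D \<le> nat \<bar>a - int (Suc D) - v\<bar>" if "v \<in> ?V \<union> r" for v
      using that N by (auto simp: r_def right_minus_def)
    have "r \<union> l \<subseteq> l' \<union> r'" using sub by auto
    note few = few[OF this]
    have eq: "l' \<union> r = insert (a - int (Suc D)) (r \<union> l)" "l \<union> r = r \<union> l" unfolding l' by auto
    show ?thesis
      using add_minus_site[OF \<beta> _ fin(3,1) disj far] few
      unfolding eq l'[symmetric] e_def step_cost_def by auto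
  next
    case False
    then have "l' = l" unfolding l'_def l_def side_minus_Suc(1) by simp
    then show ?thesis using e pos by simp
  qed
  have R: "free_weight \<beta> ?V (l' \<union> r') * ?g r \<le> exp e * (free_weight \<beta> ?V (l' \<union> r) * ?g r')"
  proof (cases "b + int (Suc D) \<in> M")
    case True
    then have r': "r' = insert (b + int (Suc D)) r" unfolding r'_def r_def side_minus_Suc(2) by simp
    have disj: "?V \<inter> (l' \<union> r) = {}" "l' \<inter> r = {}" "b + int (Suc D) \<notin> ?V \<union> (l' \<union> r)"
      using N by (auto simp: l'_def r_def left_minus_def right_minus_def)
    have far: "Suc D \<le> nat \<bar>b + int (Suc D) - v\<bar>" if "v \<in> ?V \<union> l'" for v
      using that N by (auto simp: l'_def left_minus_def)
    have "l' \<union> r \<subseteq> l' \<union> r'" using sub by auto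
    note few = few[OF this]
    have eq: "l' \<union> r' = insert (b + int (Suc D)) (l' \<union> r)" unfolding r' by auto
    show ?thesis
      using add_minus_site[OF \<beta> _ fin(2,3) disj far] few
      unfolding eq r'[symmetric] e_def step_cost_def by auto
  next
    case False
    then have "r' = r" unfolding r'_def r_def side_minus_Suc(2) by simp
    then show ?thesis using e pos by simp
  qed
  have "free_weight \<beta> ?V (l' \<union> r') / (?g l' * ?g r') \<le> exp e * (free_weight \<beta> ?V (l' \<union> r) / (?g l' * ?g r))"
    using R pos by (simp add: divide_simps mult_ac)
  also have "\<dots> \<le> exp e * (exp e * (free_weight \<beta> ?V (l \<union> r) / (?g l * ?g r)))"
    using L pos by (intro mult_left_mono) (simp_all add: divide_simps mult_ac)
  also have "\<dots> = free_weight \<beta> ?V (l \<union> r) / (?g l * ?g r) * exp (2 * e)"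
    by (simp add: mult_exp_exp)
  finally show ?thesis by (simp only: window_ratio_def l_def l'_def r_def r'_def e_def)
qed

text \<open>
  The distances at which only the crude bound is available number at most the square root of the
  length; the costs of all others form a convergent series.
\<close>

lemma window_ratio_le:
  assumes "36 \<le> \<beta>" "1 \<le> N" "a \<le> - N" "N \<le> b"
    and "\<And>i k. N \<le> \<bar>i\<bar> \<Longrightarrow> \<bar>i\<bar> \<le> int k ^ 3 \<Longrightarrow> 18 * card (M \<inter> {i..<i + int k}) \<le> k"
    and "\<And>i k. N \<le> \<bar>i\<bar> \<Longrightarrow> \<bar>i\<bar> \<le> int k ^ 3 \<Longrightarrow> 18 * card (M \<inter> {i - int k<..i}) \<le> k"
  shows "window_ratio \<beta> M a b D
    \<le> free_weight \<beta> {a..b} {} * exp (32 * \<beta> * sqrt (real (card {a..b})) + 128 * exp (32 * \<beta>))"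
proof -
  let ?e = "step_cost \<beta> (card {a..b})"
  have "window_ratio \<beta> M a b D \<le> free_weight \<beta> {a..b} {} * exp (2 * (\<Sum>k=1..D. ?e k))"
  proof (induction D)
    case 0
    show ?case by (simp add: window_ratio_def)
  next
    case (Suc D)
    have "window_ratio \<beta> M a b (Suc D) \<le> window_ratio \<beta> M a b D * exp (2 * ?e (Suc D))"
      by (rule window_ratio_step[OF assms])
    also have "\<dots> \<le> (free_weight \<beta> {a..b} {} * exp (2 * (\<Sum>k=1..D. ?e k))) * exp (2 * ?e (Suc D))"
      using Suc by (intro mult_right_mono) auto
    also have "\<dots> = free_weight \<beta> {a..b} {} * exp (2 * (\<Sum>k=1..Suc D. ?e k))"
      by (simp add: mult.assoc exp_add[symmetric] distrib_left)
    finally show ?case .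
  qed
  also have "\<dots> \<le> free_weight \<beta> {a..b} {} * exp (2 * (16 * \<beta> * sqrt (real (card {a..b})) + 64 * exp (32 * \<beta>)))"
    using assms(1) sum_step_cost_le[of \<beta> "card {a..b}" D] free_weight_pos[of "{a..b}" "{}" \<beta>]
    by (intro mult_left_mono) auto
  finally show ?thesis by (simp add: algebra_simps)
qed

text \<open>
  By \<open>window_ratio_ge\<close> and \<open>window_ratio_le\<close> the logarithms of the two
  partition functions differ by at most a multiple of the square root of the volume.
\<close>

lemma bc_pressure:
  assumes \<beta>: "36 \<le> \<beta>" and \<omega>: "\<omega> \<in> good_configs \<alpha>" and \<alpha>: "1 < \<alpha>"
  shows "((\<lambda>V. ln (bc_partition (telescoping \<beta>) \<omega> V) / real (card V))
          \<longlongrightarrow> pressure (telescoping \<beta>)) thermodynamic"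
proof -
  define M where "M = {m. \<omega> m = - 1}"
  have \<beta>0: "0 \<le> \<beta>" using \<beta> by simp
  obtain N where N: "1 \<le> N"
    and dens: "\<And>i k. N \<le> \<bar>i\<bar> \<Longrightarrow> \<bar>i\<bar> \<le> int k ^ 3 \<Longrightarrow> 18 * card (M \<inter> {i..<i + int k}) \<le> k"
    "\<And>i k. N \<le> \<bar>i\<bar> \<Longrightarrow> \<bar>i\<bar> \<le> int k ^ 3 \<Longrightarrow> 18 * card (M \<inter> {i - int k<..i}) \<le> k"
    using good_config_density[OF \<omega> \<alpha>] unfolding M_def by blast
  let ?F = "\<lambda>V. ln (free_partition (telescoping \<beta>) V) / real (card V)"
  let ?B = "\<lambda>V. ln (bc_partition (telescoping \<beta>) \<omega> V) / real (card V)"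
  let ?E = "\<lambda>c. (32 * \<beta> * sqrt (real c) + 128 * exp (32 * \<beta>)) / real c"
  \<comment> \<open>the error \<open>?E\<close> is the exponent of \<open>window_ratio_le\<close> per site\<close>
  have sandwich: "?F {a..b} \<le> ?B {a..b} \<and> ?B {a..b} \<le> ?F {a..b} + ?E (card {a..b})"
    if ab: "a \<le> - N" "N \<le> b" for a b
  proof -
    define Z where "Z = free_weight \<beta> {a..b} {}"
    define Y where "Y = bc_partition (telescoping \<beta>) \<omega> {a..b}"
    have Z: "0 < Z" unfolding Z_def using \<beta>0 by (intro free_weight_pos) auto
    have lim: "window_ratio \<beta> M a b \<longlonglongrightarrow> Y"
      unfolding M_def Y_def using ab N by (intro bc_partition_window_limit[OF \<beta> \<omega> \<alpha>]) simp
    have low: "Z \<le> Y"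
      by (rule LIMSEQ_le_const[OF lim]) (use ab N in \<open>auto simp: Z_def intro!: window_ratio_ge \<beta>0\<close>)
    have up: "Y \<le> Z * exp (32 * \<beta> * sqrt (real (card {a..b})) + 128 * exp (32 * \<beta>))"
      by (rule LIMSEQ_le_const2[OF lim]) (unfold Z_def, intro exI allI impI window_ratio_le[OF \<beta> N ab dens])
    have "ln Y \<le> ln (Z * exp (32 * \<beta> * sqrt (real (card {a..b})) + 128 * exp (32 * \<beta>)))"
      using low Z up by (intro ln_mono) auto
    also have "\<dots> = ln Z + (32 * \<beta> * sqrt (real (card {a..b})) + 128 * exp (32 * \<beta>))"
      using Z by (subst ln_mult_pos) auto
    finally have "ln Z \<le> ln Y" "ln Y \<le> ln Z + (32 * \<beta> * sqrt (real (card {a..b})) + 128 * exp (32 * \<beta>))"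
      using low Z by (auto intro: ln_mono)
    then show ?thesis
      unfolding Y_def[symmetric] free_partition_telescoping[OF \<beta>0] Z_def[symmetric]
      by (simp add: divide_right_mono add_divide_distrib[symmetric] del: card_atLeastAtMost_int)
  qed
  have "?E \<longlonglongrightarrow> 0" by real_asymp
  then have "((\<lambda>V. ?E (card V)) \<longlongrightarrow> 0) thermodynamic"
    by (rule filterlim_compose[OF _ card_thermodynamic])
  from tendsto_add[OF pressure_exists[OF \<beta>0] this]
  have "((\<lambda>V. ?F V + ?E (card V)) \<longlongrightarrow> pressure (telescoping \<beta>)) thermodynamic" by simp
  then show ?thesis
  proof (rule tendsto_sandwich[rotated -1])
    show "\<forall>\<^sub>F V in thermodynamic. ?F V \<le> ?B V" "\<forall>\<^sub>F V in thermodynamic. ?B V \<le> ?F V + ?E (card V)"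
      by (rule eventually_thermodynamic[of N]; use sandwich in blast)+
  qed (rule pressure_exists[OF \<beta>0])
qed

theorem proposition6p4:
  shows "\<exists>\<beta>\<^sub>0 :: real. \<forall>\<beta> \<ge> \<beta>\<^sub>0.
    ((\<lambda>V. ln (free_partition (telescoping \<beta>) V) / real (card V))
       \<longlongrightarrow> pressure (telescoping \<beta>)) thermodynamic \<and>
    (\<forall>\<alpha> \<omega>. 1 < \<alpha> \<longrightarrow> \<alpha> < 9 / 8 \<longrightarrow> \<omega> \<in> good_configs \<alpha> \<longrightarrow>
       (\<forall>V. finite V \<longrightarrow> (\<forall>\<sigma> \<in> configs V.
          (\<lambda>A. telescoping \<beta> A (glue V \<sigma> \<omega>)) summable_on finite_meeting V)) \<and>
       ((\<lambda>V. ln (bc_partition (telescoping \<beta>) \<omega> V) / real (card V))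
          \<longlongrightarrow> pressure (telescoping \<beta>)) thermodynamic)"
  by (rule exI[of _ 36]) (auto intro: pressure_exists telescoping_summable bc_pressure)

end
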